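(* Let $k\ge1$ and $n\ge 2$ be integers and let $\lambda=(\lambda_1\ge\lambda_2\ge\cdots)$ be a partition of $n$ such that $n\ge k+\lambda_2$. Then the multiplicity of the irreducible character $\chi^\lambda$ of $S_n$ in the $k$-th Kronecker power of $\chi^{(n-1,1)}$ is $${\chi^{(n-1,1)}}^{\otimes k}\big|_{\chi^\lambda}=f^{\overline{\lambda}}\sum_{m_1=0}^{n-\lambda_1}\left(\binom{k}{m_1}\sum_{m_2=n-\lambda_1-m_1}^{\lfloor (k-m_1)/2\rfloor}\binom{m_2}{n-\lambda_1-m_1}\,p_2(k-m_1,m_2)\right),$$ where $f^{\overline{\lambda}}$ is the number of standard tableaux of shape $\overline{\lambda}$ and $p_2(k-m_1,m_2)$ is the number of set partitions of a set of $k-m_1$ distinct integers into $m_2$ parts, each of size at least $2$.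
   Context: $\chi^\lambda$ denotes the irreducible character of the symmetric group $S_n$ indexed by $\lambda\vdash n$; $\chi^{\otimes k}$ is the $k$-th Kronecker (pointwise) power, and $\chi|_{\chi^\lambda}$ is the multiplicity of $\chi^\lambda$ in the character $\chi$. For $\lambda=(\lambda_1,\lambda_2,\ldots,\lambda_m)$ with $\lambda_1\ge\cdots\ge\lambda_m$, $\overline{\lambda}=(\lambda_2,\ldots,\lambda_m)$ is the partition with the largest part removed, and $\lambda_2=0$ if $\lambda$ has a single part. Conventions: $f^{\emptyset}=1$, $p_2(0,0)=1$, $\binom{k}{m}=0$ for $m>k$, and a sum whose lower limit exceeds its upper limit is $0$. *)

theory Defs
  imports
    Complex_Main
    "HOL-Library.Function_Algebras"
    "HOL-Library.Disjoint_Sets"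
    "HOL-Library.FuncSet"
    "HOL-Combinatorics.Permutations"
begin

definition partitions :: "nat \<Rightarrow> nat list set" where
  "partitions n = {\<mu>. sorted_wrt (\<ge>) \<mu> \<and> 0 \<notin> set \<mu> \<and> sum_list \<mu> = n}"

definition second_part :: "nat list \<Rightarrow> nat" where
  "second_part \<mu> = (if length \<mu> < 2 then 0 else \<mu> ! 1)"

definition cells :: "nat list \<Rightarrow> (nat \<times> nat) set" where
  "cells \<mu> = {(i, j). i < length \<mu> \<and> j < \<mu> ! i}"

text \<open>
  Tableaux are made extensional outside the diagram, so that distinct functions are
  distinct tableaux; the empty shape has exactly one.
\<close>

definition standard_tableaux :: "nat list \<Rightarrow> (nat \<times> nat \<Rightarrow> nat) set" where
  "standard_tableaux \<mu> =
    {T \<in> extensional (cells \<mu>).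
       bij_betw T (cells \<mu>) {1..sum_list \<mu>} \<and>
       (\<forall>i j j'. (i, j) \<in> cells \<mu> \<and> (i, j') \<in> cells \<mu> \<and> j < j' \<longrightarrow> T (i, j) < T (i, j')) \<and>
       (\<forall>i i' j. (i, j) \<in> cells \<mu> \<and> (i', j) \<in> cells \<mu> \<and> i < i' \<longrightarrow> T (i, j) < T (i', j))}"

definition num_standard_tableaux :: "nat list \<Rightarrow> nat" where
  "num_standard_tableaux \<mu> = card (standard_tableaux \<mu>)"

definition p2 :: "nat \<Rightarrow> nat \<Rightarrow> nat" where
  "p2 a b = card {P. partition_on {1..a} P \<and> card P = b \<and> (\<forall>X\<in>P. 2 \<le> card X)}"


text \<open>Complex-valued functions as a complex vector space, and the trace of a linear map
  on a finite-dimensional subspace \<open>V\<close>, computed in some basis of \<open>V\<close>.\<close>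

definition fscale :: "complex \<Rightarrow> ('a \<Rightarrow> complex) \<Rightarrow> 'a \<Rightarrow> complex" where
  "fscale c f = (\<lambda>x. c * f x)"

global_interpretation fvs: vector_space "fscale :: complex \<Rightarrow> ('a \<Rightarrow> complex) \<Rightarrow> 'a \<Rightarrow> complex"
  by unfold_locales (auto simp: fscale_def fun_eq_iff algebra_simps)

definition trace_on :: "('a \<Rightarrow> complex) set \<Rightarrow> (('a \<Rightarrow> complex) \<Rightarrow> 'a \<Rightarrow> complex) \<Rightarrow> complex" where
  "trace_on V T =
    (let B = (SOME B. \<not> fvs.dependent B \<and> fvs.span B = V)
     in \<Sum>b\<in>B. fvs.representation B (T b) b)"


text \<open>
  The group \<open>S\<^sub>n\<close> consists of the permutations of \<open>{..<n}\<close> under composition, and an element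
  of its group algebra is the function giving its coefficients. The simple module indexed by
  \<open>\<mu>\<close> is the left ideal generated by the Young symmetrizer \<open>c = a b\<close> of the tableau of shape
  \<open>\<mu>\<close> filled with \<open>0, 1, 2, \<dots>\<close> along successive rows, where \<open>a\<close> is the sum of the row
  stabilizer and \<open>b\<close> the signed sum of the column stabilizer. With this order of the factors,
  \<open>[n]\<close> yields the trivial and \<open>[1, \<dots>, 1]\<close> the sign character.
\<close>

definition tableau_entry :: "nat list \<Rightarrow> nat \<times> nat \<Rightarrow> nat" where
  "tableau_entry \<mu> = (\<lambda>(i, j). sum_list (take i \<mu>) + j)"

definition row_stabilizer :: "nat list \<Rightarrow> (nat \<Rightarrow> nat) set" where
  "row_stabilizer \<mu> =
    {p. p permutes {..<sum_list \<mu>} \<and>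
        (\<forall>i. let R = tableau_entry \<mu> ` {x \<in> cells \<mu>. fst x = i} in p ` R = R)}"

definition column_stabilizer :: "nat list \<Rightarrow> (nat \<Rightarrow> nat) set" where
  "column_stabilizer \<mu> =
    {q. q permutes {..<sum_list \<mu>} \<and>
        (\<forall>j. let C = tableau_entry \<mu> ` {x \<in> cells \<mu>. snd x = j} in q ` C = C)}"

definition young_symmetrizer :: "nat list \<Rightarrow> (nat \<Rightarrow> nat) \<Rightarrow> complex" where
  "young_symmetrizer \<mu> \<sigma> =
    (\<Sum>p\<in>row_stabilizer \<mu>. \<Sum>q\<in>column_stabilizer \<mu>. if p \<circ> q = \<sigma> then of_int (sign q) else 0)"

text \<open>Left multiplication by \<open>g\<close>: the coefficient of \<open>\<sigma>\<close> in \<open>g f\<close> is that of \<open>g\<inverse> \<sigma>\<close> in \<open>f\<close>.\<close>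

definition left_mult :: "(nat \<Rightarrow> nat) \<Rightarrow> ((nat \<Rightarrow> nat) \<Rightarrow> complex) \<Rightarrow> (nat \<Rightarrow> nat) \<Rightarrow> complex" where
  "left_mult g f = (\<lambda>\<sigma>. f (inv g \<circ> \<sigma>))"

definition specht_module :: "nat list \<Rightarrow> ((nat \<Rightarrow> nat) \<Rightarrow> complex) set" where
  "specht_module \<mu> =
    fvs.span ((\<lambda>g. left_mult g (young_symmetrizer \<mu>)) ` {g. g permutes {..<sum_list \<mu>}})"

definition irr_char :: "nat list \<Rightarrow> (nat \<Rightarrow> nat) \<Rightarrow> complex" where
  "irr_char \<mu> g = trace_on (specht_module \<mu>) (left_mult g)"


definition kronecker_power :: "((nat \<Rightarrow> nat) \<Rightarrow> complex) \<Rightarrow> nat \<Rightarrow> (nat \<Rightarrow> nat) \<Rightarrow> complex" where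
  "kronecker_power \<chi> k = (\<lambda>g. \<chi> g ^ k)"

text \<open>
  The multiplicity of the irreducible character indexed by \<open>\<mu>\<close> in a character \<open>\<chi>\<close> of
  \<open>S\<^sub>n\<close>: its coefficient in the decomposition of \<open>\<chi>\<close> into irreducible characters.
\<close>

definition irr_decomposition :: "nat \<Rightarrow> ((nat \<Rightarrow> nat) \<Rightarrow> complex) \<Rightarrow> (nat list \<Rightarrow> nat) \<Rightarrow> bool" where
  "irr_decomposition n \<chi> c \<longleftrightarrow>
    (\<forall>g. g permutes {..<n} \<longrightarrow> \<chi> g = (\<Sum>\<nu>\<in>partitions n. of_nat (c \<nu>) * irr_char \<nu> g))"

definition irr_multiplicity :: "nat \<Rightarrow> ((nat \<Rightarrow> nat) \<Rightarrow> complex) \<Rightarrow> nat list \<Rightarrow> nat" where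
  "irr_multiplicity n \<chi> \<mu> = (THE m. \<exists>c. irr_decomposition n \<chi> c \<and> c \<mu> = m)"

end

theory Submission
  imports Defs "HOL-Computational_Algebra.Polynomial"
begin

text \<open>
  If \<open>c\<close> is a Young symmetrizer with \<open>c\<^sup>2 = \<alpha> c\<close>, then the trace on the left ideal generated
  by \<open>c\<close> is \<open>\<alpha>\<^sup>-\<^sup>1\<close> times a trace on the whole group algebra, so that \<open>\<alpha> \<chi>(g)\<close> is the sum of
  the coefficients of \<open>c\<close> at the conjugates of \<open>g\<close>. Orthonormality of the characters is then a
  combinatorial statement about products of row and column stabilizers. The coefficient at the
  identity of \<open>a b b' a'\<close>, for symmetrizers \<open>a b\<close> of \<open>\<lambda>\<close> and \<open>a' b'\<close> of a shape obtained by removing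
  a corner of \<open>\<lambda>\<close>, is nonzero; comparing Bessel's inequality \<open>\<Sum>(\<chi>\<^sup>\<lambda>(1))\<^sup>2 \<le> n!\<close> with
  \<open>\<Sum>(f\<^sup>\<lambda>)\<^sup>2 = n!\<close> turns this into the branching rule.

  Since \<open>\<chi>\<^sup>(\<^sup>n\<^sup>-\<^sup>1\<^sup>,\<^sup>1\<^sup>)\<close> is the number of fixed points minus one, multiplying by it moves one box
  of the diagram in all possible ways, minus the identity. If \<open>n \<ge> k + \<lambda>\<^sub>2\<close>, the first row never gets in
  the way of the others, and with \<open>\<Sum> f\<^sup>\<beta>\<^sup>+\<^sup>\<box> = (r + 1) f\<^sup>\<beta>\<close> for \<open>\<beta>\<close> of size \<open>r\<close> the multiplicities
  are \<open>f\<close> of the tail times a number \<open>F k r\<close> satisfying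
  \<open>F (k + 1) r = F k (r - 1) + r F k r + (r + 1) F k (r + 1)\<close>. This is also the recurrence for
  the number of set partitions of \<open>k\<close> points with \<open>r\<close> marked blocks, in which all singletons
  are marked; the inner double sum of the statement counts them by their singletons.
\<close>

section \<open>Set partitions with marked blocks\<close>

text \<open>The characters are given as traces on left ideals, with nothing known about
  irreducibility, so everything has to come from the scalar \<alpha>. That it is nonzero is read off
  at the identity, where the trace is a dimension: \<alpha> times the degree is n!. The same device,
  with a quasi-idempotent on either side of the group algebra, exhibits a restriction multiplicity
  as a dimension. This makes it a natural number, and a nonzero coefficient makes it at least one.
  Orthonormality does not tell whether the list of characters is complete, and conjugacy classes are
  never counted. Instead, equality in Bessel's inequality says that the sum of the characters
  weighted by their degrees is the regular character, and convolution with it expands every class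
  function. The sum of squares of the tableau numbers comes from the commutation of adding and
  removing boxes, not from an insertion algorithm. In the final recursion, the number F vanishes
  wherever the first row would block a move, so sums over all moves of the tail remain
  correct.\<close>

definition big_partitions :: "'a set \<Rightarrow> nat \<Rightarrow> 'a set set set" where
  "big_partitions A m = {P. partition_on A P \<and> card P = m \<and> (\<forall>X\<in>P. 2 \<le> card X)}"

lemma finite_big_partitions [simp]: "finite A \<Longrightarrow> finite (big_partitions A m)"
  unfolding big_partitions_def by (rule finite_subset[OF _ finitely_many_partition_on]) auto

lemma inj_on_image_big_partition:
  assumes "P \<in> big_partitions A m" "inj_on f A"
  shows "(`) f ` P \<in> big_partitions (f ` A) m"
proof -
  have P: "partition_on A P" "card P = m" "\<forall>X\<in>P. 2 \<le> card X"
    using assms by (auto simp: big_partitions_def)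
  have sub: "X \<subseteq> A" if "X \<in> P" for X using P(1) that by (auto simp: partition_on_def)
  have "{} \<notin> (`) f ` P" using P(1) by (auto simp: partition_on_def)
  then have 1: "partition_on (f ` A) ((`) f ` P)"
    using partition_on_inj_image[OF P(1) assms(2)] by simp
  have "inj_on ((`) f) P"
    using sub assms(2) by (intro inj_onI) (metis inj_on_image_eq_iff)
  then have 2: "card ((`) f ` P) = m" using P by (simp add: card_image)
  have "2 \<le> card (f ` X)" if "X \<in> P" for X
    using card_image[OF inj_on_subset[OF assms(2) sub[OF that]]] P(3) that by simp
  with 1 2 show ?thesis by (auto simp: big_partitions_def)
qed

lemma card_big_partitions_le:
  assumes "finite A" "bij_betw f A B"
  shows "card (big_partitions A m) \<le> card (big_partitions B m)"
proof (rule card_inj_on_le)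
  have inj: "inj_on f A" and B: "B = f ` A" using assms(2) by (auto simp: bij_betw_def)
  show "(`) ((`) f) ` big_partitions A m \<subseteq> big_partitions B m"
    using inj_on_image_big_partition[OF _ inj] B by auto
  have "big_partitions A m \<subseteq> Pow (Pow A)" by (auto simp: big_partitions_def partition_on_def)
  moreover have "inj_on ((`) ((`) f)) (Pow (Pow A))"
    using inj by (simp add: inj_on_image_Pow)
  ultimately show "inj_on ((`) ((`) f)) (big_partitions A m)" by (rule inj_on_subset[rotated])
  show "finite (big_partitions B m)" using assms(1) B by auto
qed

text \<open>\<open>p2\<close> speaks of intervals only, but deleting a point or a block leaves an
  arbitrary finite set. With this, the recurrence can be proved on whatever set remains.\<close>

lemma card_big_partitions:
  assumes "finite A"
  shows "card (big_partitions A m) = p2 (card A) m"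
proof -
  obtain f where f: "bij_betw f A {1..card A}"
    using assms by (metis card_atLeastAtMost diff_Suc_1 finite_atLeastAtMost finite_same_card_bij)
  have "card (big_partitions A m) = card (big_partitions {1..card A} m)"
    using card_big_partitions_le[OF assms f, of m]
      card_big_partitions_le[OF _ bij_betw_inv_into[OF f], of m] by simp
  then show ?thesis by (simp add: p2_def big_partitions_def)
qed

lemma big_partition_block:
  assumes "P \<in> big_partitions A m" "Y \<in> P" "finite A"
  shows "partition_on (A - Y) (P - {Y})" "Y \<subseteq> A" "Y \<noteq> {}" "2 \<le> card Y" "finite P" "card (P - {Y}) = m - 1" "m > 0"
proof -
  have P: "partition_on A P" "card P = m" "\<forall>X\<in>P. 2 \<le> card X"
    using assms by (auto simp: big_partitions_def)
  have "disjnt Y (\<Union>(P - {Y}))"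
    using P(1) assms(2) by (auto simp: partition_on_def disjoint_def disjnt_def)
  then have "partition_on A (insert Y (P - {Y})) \<longleftrightarrow> partition_on (A - Y) (P - {Y}) \<and> Y \<subseteq> A \<and> Y \<noteq> {}"
    by (rule partition_on_insert)
  moreover have "insert Y (P - {Y}) = P" using assms(2) by auto
  ultimately show "partition_on (A - Y) (P - {Y})" "Y \<subseteq> A" "Y \<noteq> {}" using P(1) by auto
  show "2 \<le> card Y" using P(3) assms(2) by auto
  show fin: "finite P" using P(1) assms(3) by (metis finite_elements)
  show "card (P - {Y}) = m - 1" using P(2) assms(2) by simp
  show "m > 0" using P(2) assms(2) fin by (auto simp: card_gt_0_iff)
qed

lemma insert_block_big_partition:
  assumes "partition_on (A - X) P" "X \<subseteq> A" "2 \<le> card X" "card P = m" "finite A" "\<forall>Z\<in>P. 2 \<le> card Z"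
  shows "insert X P \<in> big_partitions A (Suc m)" "X \<notin> P"
proof -
  have UP: "\<Union>P = A - X" using assms(1) by (simp add: partition_on_def)
  have ne: "X \<noteq> {}" using assms(3) by auto
  show nin: "X \<notin> P" using UP ne by auto
  have "disjnt X (\<Union>P)" using UP by (auto simp: disjnt_def)
  then have "partition_on A (insert X P)" using assms(1,2) ne by (simp add: partition_on_insert)
  moreover have "finite P" using assms(1,5) by (metis finite_Diff finite_elements)
  ultimately show "insert X P \<in> big_partitions A (Suc m)"
    using assms nin by (simp add: big_partitions_def)
qed

text \<open>Take \<open>e\<close> away from its block. A block with at least three elements survives
  as \<open>Y\<close>, which has to be remembered; a block \<open>{e, j}\<close> disappears and
  leaves a partition of \<open>A - {j}\<close>. The maps \<open>g\<close> and \<open>h\<close> undo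
  this. The block of \<open>e\<close> can be recovered from the result as the only one containing
  \<open>e\<close>, which gives injectivity and disjointness.\<close>

lemma big_partitions_insert:
  assumes A: "finite A" "e \<notin> A"
  defines "g \<equiv> \<lambda>(P, Y). insert (insert e Y) (P - {Y})"
    and "h \<equiv> \<lambda>(j, P). insert {e, j} P"
  shows "big_partitions (insert e A) (Suc m) =
      g ` (SIGMA P:big_partitions A (Suc m). P) \<union> h ` (SIGMA j:A. big_partitions (A - {j}) m)"
    and "g ` (SIGMA P:big_partitions A (Suc m). P) \<inter> h ` (SIGMA j:A. big_partitions (A - {j}) m) = {}"
    and "inj_on g (SIGMA P:big_partitions A (Suc m). P)"
    and "inj_on h (SIGMA j:A. big_partitions (A - {j}) m)"
proof -
  let ?G = "SIGMA P:big_partitions A (Suc m). P" and ?H = "SIGMA j:A. big_partitions (A - {j}) m"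
  have G1: "g (P, Y) \<in> big_partitions (insert e A) (Suc m)" "insert e Y \<notin> P - {Y}" "3 \<le> card (insert e Y)"
       "{Z \<in> g (P, Y). e \<in> Z} = {insert e Y}"
    if "(P, Y) \<in> ?G" for P Y
  proof -
    from that have P: "P \<in> big_partitions A (Suc m)" "Y \<in> P" by auto
    note B = big_partition_block[OF P A(1)]
    have c: "card (insert e Y) = Suc (card Y)"
      using B(2) A by (intro card_insert_disjoint) (auto intro: finite_subset)
    have "insert e A - insert e Y = A - Y" using A B(2) by auto
    then have 1: "partition_on (insert e A - insert e Y) (P - {Y})" using B(1) by simp
    have 2: "\<forall>Z\<in>P - {Y}. 2 \<le> card Z" using P by (auto simp: big_partitions_def)
    have 3: "insert e Y \<subseteq> insert e A" using B(2) by auto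
    have 4: "card (P - {Y}) = m" using B(6) by simp
    have "insert (insert e Y) (P - {Y}) \<in> big_partitions (insert e A) (Suc m)"
      by (rule insert_block_big_partition[OF 1 3 _ 4 _ 2]) (use A B(4) c in auto)
    then show "g (P, Y) \<in> big_partitions (insert e A) (Suc m)" by (simp add: g_def)
    show "insert e Y \<notin> P - {Y}"
      by (rule insert_block_big_partition(2)[OF 1 3 _ 4 _ 2]) (use A B(4) c in auto)
    show "3 \<le> card (insert e Y)" using c B(4) by simp
    have "e \<notin> Z" if "Z \<in> P" for Z using P(1) that A(2) by (auto simp: big_partitions_def partition_on_def)
    then show "{Z \<in> g (P, Y). e \<in> Z} = {insert e Y}" by (auto simp: g_def)
  qed
  have H1: "h (j, P) \<in> big_partitions (insert e A) (Suc m)" "{e, j} \<notin> P"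
       "{Z \<in> h (j, P). e \<in> Z} = {{e, j}}" "e \<noteq> j"
    if "(j, P) \<in> ?H" for j P
  proof -
    from that have j: "j \<in> A" and P: "P \<in> big_partitions (A - {j}) m" by auto
    show ej: "e \<noteq> j" using j A by auto
    have "insert e A - {e, j} = A - {j}" using A by auto
    then have 1: "partition_on (insert e A - {e, j}) P" "card P = m" "\<forall>Z\<in>P. 2 \<le> card Z"
      using P by (auto simp: big_partitions_def)
    have "insert {e, j} P \<in> big_partitions (insert e A) (Suc m)"
      by (rule insert_block_big_partition[OF 1(1) _ _ 1(2) _ 1(3)]) (use A ej j in auto)
    then show "h (j, P) \<in> big_partitions (insert e A) (Suc m)" by (simp add: h_def)
    show "{e, j} \<notin> P"
      by (rule insert_block_big_partition(2)[OF 1(1) _ _ 1(2) _ 1(3)]) (use A ej j in auto)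
    have "e \<notin> Z" if "Z \<in> P" for Z using P(1) that A(2) by (auto simp: big_partitions_def partition_on_def)
    then show "{Z \<in> h (j, P). e \<in> Z} = {{e, j}}" by (auto simp: h_def)
  qed
  have "Q \<in> g ` ?G \<union> h ` ?H" if Q: "Q \<in> big_partitions (insert e A) (Suc m)" for Q
  proof -
    have "\<Union>Q = insert e A" using Q by (auto simp: big_partitions_def partition_on_def)
    then obtain X where X: "X \<in> Q" "e \<in> X" by blast
    have fin: "finite (insert e A)" using A by simp
    note B = big_partition_block[OF Q X(1) fin]
    have big: "\<forall>Z\<in>Q - {X}. 2 \<le> card Z" using Q by (auto simp: big_partitions_def)
    have cX: "card X = Suc (card (X - {e}))" using X(2) B(2) fin
      by (metis card_Suc_Diff1 finite_subset)
    have e: "insert e (X - {e}) = X" using X(2) by auto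
    show ?thesis
    proof (cases "card X = 2")
      case True
      then have "card (X - {e}) = 1" using cX by simp
      then obtain j where j: "X - {e} = {j}" by (metis card_1_singletonE)
      then have Xe: "X = {e, j}" "j \<in> A" using e B(2) by auto
      have "insert e A - X = A - {j}" using Xe A by auto
      then have "(j, Q - {X}) \<in> ?H" using B(1,6) big Xe(2) by (auto simp: big_partitions_def)
      moreover have "h (j, Q - {X}) = Q" using Xe(1) X(1) by (auto simp: h_def)
      ultimately show ?thesis by (metis UnI2 imageI)
    next
      case False
      let ?Y = "X - {e}"
      have c2: "2 \<le> card ?Y" using False B(4) cX by simp
      have eq: "insert e A - X = A - ?Y" using A X(2) by auto
      have "insert ?Y (Q - {X}) \<in> big_partitions A (Suc m)" "?Y \<notin> Q - {X}"
        using insert_block_big_partition[of A ?Y "Q - {X}" m] B(1,2,6) big c2 A unfolding eq by auto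
      then have "(insert ?Y (Q - {X}), ?Y) \<in> ?G" "g (insert ?Y (Q - {X}), ?Y) = Q"
        using e X(1) by (auto simp: g_def)
      then show ?thesis by (metis UnI1 imageI)
    qed
  qed
  then show "big_partitions (insert e A) (Suc m) = g ` ?G \<union> h ` ?H"
    using G1(1) H1(1) by auto
  show "g ` ?G \<inter> h ` ?H = {}"
  proof -
    have False if "(P, Y) \<in> ?G" "(j, P') \<in> ?H" "g (P, Y) = h (j, P')" for P Y j P'
    proof -
      have "insert e Y = {e, j}" using G1(4)[OF that(1)] H1(3)[OF that(2)] that(3) by auto
      moreover have "card {e, j} = 2" using H1(4)[OF that(2)] by simp
      ultimately show False using G1(3)[OF that(1)] by simp
    qed
    then show ?thesis by fast
  qed
  show "inj_on g ?G"
  proof (rule inj_onI)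
    fix u v assume uv: "u \<in> ?G" "v \<in> ?G" and eq: "g u = g v"
    obtain P Y P' Y' where w: "u = (P, Y)" "v = (P', Y')" by (metis surj_pair)
    have G: "(P, Y) \<in> ?G" "(P', Y') \<in> ?G" using uv w by auto
    have i: "insert e Y = insert e Y'" using G1(4)[OF G(1)] G1(4)[OF G(2)] eq w by auto
    moreover have "e \<notin> Y" "e \<notin> Y'" using G A(2) by (auto simp: big_partitions_def partition_on_def)
    ultimately have Y: "Y = Y'" by (metis insert_ident)
    have "P - {Y} = P' - {Y'}" using eq i G1(2)[OF G(1)] G1(2)[OF G(2)] w unfolding g_def
      by (simp add: insert_ident)
    then show "u = v" using Y G w by auto
  qed
  show "inj_on h ?H"
  proof (rule inj_onI)
    fix u v assume uv: "u \<in> ?H" "v \<in> ?H" and eq: "h u = h v"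
    obtain j P j' P' where w: "u = (j, P)" "v = (j', P')" by (metis surj_pair)
    have "{e, j} = {e, j'}" using H1(3)[of j P] H1(3)[of j' P'] eq uv w by auto
    then have j: "j = j'" using H1(4)[of j P] H1(4)[of j' P'] uv w by (auto simp: doubleton_eq_iff)
    then have "P = P'" using eq H1(2)[of j P] H1(2)[of j' P'] uv w unfolding h_def
      by (simp add: insert_ident)
    then show "u = v" using j w by simp
  qed
qed

section \<open>The recurrence of the associated Stirling numbers of the second kind\<close>

lemma p2_0: "p2 0 m = (if m = 0 then 1 else 0)"
proof -
  have "{P. partition_on {1..0::nat} P \<and> card P = m \<and> (\<forall>X\<in>P. 2 \<le> card X)} = (if m = 0 then {{}} else {})"
    by (auto simp: partition_on_empty)
  then show ?thesis by (simp add: p2_def)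
qed

lemma p2_Suc_0: "p2 (Suc k) 0 = 0"
proof -
  have "{P. partition_on {1..Suc k} P \<and> card P = 0 \<and> (\<forall>X\<in>P. 2 \<le> card X)} = {}"
  proof -
    have "\<not> (partition_on {1..Suc k} P \<and> card P = 0)" for P
    proof
      assume P: "partition_on {1..Suc k} P \<and> card P = 0"
      then have "P = {}" using finite_elements[of "{1..Suc k}" P] by simp
      then show False using P by (simp add: partition_on_def)
    qed
    then show ?thesis by blast
  qed
  then show ?thesis unfolding p2_def by (metis card.empty)
qed

text \<open>The new point joins one of \<open>Suc m\<close> blocks or forms a block with one of the
  \<open>k\<close> old points. At \<open>k = 0\<close> the truncated \<open>k - 1\<close> is
  harmless, being multiplied by \<open>k\<close>.\<close>

lemma p2_Suc_Suc: "p2 (Suc k) (Suc m) = Suc m * p2 k (Suc m) + k * p2 (k - 1) m"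
proof -
  let ?A = "{..<k}"
  have A: "finite ?A" "k \<notin> ?A" by auto
  note I = big_partitions_insert[OF A, of m]
  have f2: "finite P" if "P \<in> big_partitions ?A (Suc m)" for P
    using that by (auto simp: big_partitions_def intro: card_ge_0_finite)
  have "p2 (Suc k) (Suc m) = card (big_partitions (insert k ?A) (Suc m))"
    using card_big_partitions[of "insert k ?A" "Suc m"] by simp
  also have "\<dots> = card (SIGMA P:big_partitions ?A (Suc m). P) + card (SIGMA j:?A. big_partitions (?A - {j}) m)"
    unfolding I(1) using f2
    by (subst card_Un_disjoint)
       (auto intro!: finite_SigmaI finite_imageI simp: card_image[OF I(3)] card_image[OF I(4)] I(2)[simplified])
  also have "card (SIGMA P:big_partitions ?A (Suc m). P) = (\<Sum>P\<in>big_partitions ?A (Suc m). Suc m)"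
    using f2 by (subst card_SigmaI) (simp, simp, simp add: big_partitions_def)
  also have "\<dots> = Suc m * p2 k (Suc m)" by (simp add: card_big_partitions)
  also have "card (SIGMA j:?A. big_partitions (?A - {j}) m) = k * p2 (k - 1) m"
    by (subst card_SigmaI) (auto simp: card_big_partitions)
  finally show ?thesis .
qed

lemma p2_eq_0: "k < 2 * m \<Longrightarrow> p2 k m = 0"
proof (induction k arbitrary: m rule: less_induct)
  case (less k)
  show ?case
  proof (cases k)
    case 0
    then show ?thesis using less.prems by (simp add: p2_0)
  next
    case (Suc j)
    then obtain l where l: "m = Suc l" using less.prems by (cases m) auto
    have "p2 j (Suc l) = 0" using less Suc l by auto
    moreover have "j * p2 (j - 1) l = 0"
      using less.IH[of "j - 1" l] less.prems Suc l by (cases j) auto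
    ultimately show ?thesis using Suc l by (simp add: p2_Suc_Suc)
  qed
qed

section \<open>Generating polynomials of partitions, without and with marks\<close>

definition big_poly :: "nat \<Rightarrow> int poly" where
  "big_poly k = (\<Sum>m\<le>k. monom (int (p2 k m)) m)"

lemma coeff_big_poly: "coeff (big_poly k) m = int (p2 k m)"
  by (auto simp: big_poly_def coeff_sum p2_eq_0)

text \<open>The variable counts blocks: multiplied by it, the derivative chooses a block for the new
  point, and the other term chooses a partner for it. The coefficients are integers because the
  recurrence will be solved for the derivative, by a subtraction.\<close>

lemma big_poly_Suc:
  "big_poly (Suc k) = [:0, 1:] * pderiv (big_poly k) + of_nat k * [:0, 1:] * big_poly (k - 1)"
proof (rule poly_eqI)
  fix m
  show "coeff (big_poly (Suc k)) m =
    coeff ([:0, 1:] * pderiv (big_poly k) + of_nat k * [:0, 1:] * big_poly (k - 1)) m"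
    by (cases m) (simp_all add: coeff_big_poly p2_Suc_0 p2_Suc_Suc coeff_pderiv of_nat_poly algebra_simps)
qed

text \<open>Here \<open>i\<close> is the number of singletons, all of them marked, and
  \<open>m\<close> the number of larger blocks, of which \<open>r - i\<close> are marked.\<close>

definition marked_count :: "nat \<Rightarrow> nat \<Rightarrow> nat" where
  "marked_count k r = (\<Sum>i = 0..r. (k choose i) *
     (\<Sum>m = r - i..(k - i) div 2. (m choose (r - i)) * p2 (k - i) m))"

text \<open>The variable counts marks: a singleton is marked, any other block may or may not be.\<close>

definition marked_poly :: "nat \<Rightarrow> int poly" where
  "marked_poly k = (\<Sum>i\<le>k. of_nat (k choose i) * [:0, 1:] ^ i * pcompose (big_poly (k - i)) [:1, 1:])"

text \<open>Substituting 1 + x for the variable lets every block choose between a mark and none. The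
  range of summation shrinks to that of the theorem because too many blocks of size at least 2 do
  not fit.\<close>

lemma coeff_pcompose_big_poly:
  "coeff (pcompose (big_poly k) [:1, 1:]) r = int (\<Sum>m = r..k div 2. (m choose r) * p2 k m)"
proof -
  have *: "coeff ([:1, 1 :: int:] ^ m) r = int (m choose r)" for m
  proof -
    have "[:1, 1 :: int:] ^ m = ([:0, 1:] + 1) ^ m" by (simp add: one_pCons)
    also have "\<dots> = (\<Sum>j\<le>m. of_nat (m choose j) * [:0, 1:] ^ j)" by (simp add: binomial_ring)
    also have "\<dots> = (\<Sum>j\<le>m. monom (int (m choose j)) j)"
      by (simp add: monom_altdef of_nat_poly)
    finally show ?thesis by (auto simp: coeff_sum binomial_eq_0)
  qed
  have "pcompose (monom c m) q = smult c (q ^ m)" for c :: int and m q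
    by (induction m) (simp_all add: monom_0 monom_Suc pcompose_pCons)
  then have "pcompose (big_poly k) [:1, 1:] = (\<Sum>m\<le>k. smult (int (p2 k m)) ([:1, 1:] ^ m))"
    by (simp add: big_poly_def pcompose_sum)
  then have "coeff (pcompose (big_poly k) [:1, 1:]) r = (\<Sum>m\<le>k. int (p2 k m * (m choose r)))"
    by (simp add: coeff_sum *)
  also have "\<dots> = (\<Sum>m = r..k div 2. int (p2 k m * (m choose r)))"
    by (rule sum.mono_neutral_right) (auto simp: binomial_eq_0 p2_eq_0 not_le)
  finally show ?thesis by (simp add: mult.commute)
qed

lemma coeff_marked_poly: "coeff (marked_poly k) r = int (marked_count k r)"
proof -
  let ?t = "\<lambda>i. int ((k choose i) * (\<Sum>m = r - i..(k - i) div 2. (m choose (r - i)) * p2 (k - i) m))"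
  have "coeff (marked_poly k) r = (\<Sum>i\<le>k. if i \<le> r then ?t i else 0)"
    unfolding marked_poly_def coeff_sum
  proof (rule sum.cong)
    fix i assume "i \<in> {..k}"
    have "of_nat (k choose i) * [:0, 1:] ^ i * pcompose (big_poly (k - i)) [:1, 1:] =
        smult (int (k choose i)) (monom 1 i * pcompose (big_poly (k - i)) [:1, 1:])"
      by (simp add: of_nat_poly monom_altdef mult.assoc)
    then show "coeff (of_nat (k choose i) * [:0, 1:] ^ i * pcompose (big_poly (k - i)) [:1, 1:]) r =
       (if i \<le> r then ?t i else 0)"
      by (simp add: coeff_monom_mult coeff_pcompose_big_poly)
  qed simp
  also have "\<dots> = (\<Sum>i\<in>{..k} \<inter> {..r}. ?t i)"
    by (subst sum.inter_restrict) simp_all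
  also have "\<dots> = (\<Sum>i = 0..r. ?t i)"
    by (rule sum.mono_neutral_left) (auto simp: binomial_eq_0)
  finally show ?thesis by (simp add: marked_count_def)
qed

text \<open>This is the differential equation of the exponential generating function exp((1 + x)(e^z
  - 1) - z). The proof stays with polynomials: what the product rule yields from the powers of
  \<open>t\<close> cancels the term of \<open>big_poly_Suc\<close> that pairs the new point with an
  old one, and Pascal's rule does the rest.\<close>

lemma marked_poly_Suc:
  "marked_poly (Suc k) = [:0, 1:] * marked_poly k + [:1, 1:] * pderiv (marked_poly k)"
proof -
  define t u :: "int poly" where "t = [:0, 1:]" and "u = [:1, 1:]"
  define R where "R j = pcompose (big_poly j) u" for j
  define R' where "R' j = pcompose (pderiv (big_poly j)) u" for j
  have du: "pderiv u = 1" and dt: "pderiv t = 1" by (simp_all add: t_def u_def pderiv_pCons)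
  have dR: "pderiv (R j) = R' j" for j
    by (simp add: R_def R'_def pderiv_pcompose du)
  have RS: "u * R' j = R (Suc j) - of_nat j * u * R (j - 1)" for j
    by (simp add: R_def R'_def big_poly_Suc pcompose_add pcompose_mult pcompose_smult pcompose_pCons u_def of_nat_poly)
  have M: "marked_poly j = (\<Sum>i\<le>j. of_nat (j choose i) * t ^ i * R (j - i))" for j
    by (simp add: marked_poly_def t_def R_def u_def)
  have pd_sum: "pderiv (sum h A) = (\<Sum>x\<in>A. pderiv (h x))" for h :: "nat \<Rightarrow> int poly" and A
    by (induction A rule: infinite_finite_induct) (simp_all add: pderiv_add)
  have "pderiv (marked_poly k) = (\<Sum>i\<le>k. of_nat (k choose i) * (of_nat i * t ^ (i - 1) * R (k - i) + t ^ i * R' (k - i)))"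
    unfolding M pd_sum
  proof (intro sum.cong refl, goal_cases)
    case (1 i)
    have "pderiv (of_nat (k choose i) * (t ^ i * R (k - i))) = of_nat (k choose i) * pderiv (t ^ i * R (k - i))"
      by (simp add: of_nat_poly pderiv_smult)
    also have "pderiv (t ^ i * R (k - i)) = t ^ i * R' (k - i) + R (k - i) * (of_nat i * t ^ (i - 1))"
      by (simp add: pderiv_mult pderiv_power dR dt of_nat_poly)
    finally show ?case
      by (simp only: mult_ac add.commute)
  qed
  then have "u * pderiv (marked_poly k) =
      (\<Sum>i\<le>k. of_nat (k choose i) * of_nat i * t ^ (i - 1) * u * R (k - i))
     + (\<Sum>i\<le>k. of_nat (k choose i) * t ^ i * (u * R' (k - i)))"
    by (simp add: sum_distrib_left sum.distrib[symmetric] algebra_simps)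
  also have "(\<Sum>i\<le>k. of_nat (k choose i) * t ^ i * (u * R' (k - i))) =
      (\<Sum>i\<le>k. of_nat (k choose i) * t ^ i * R (Suc (k - i)))
    - (\<Sum>i\<le>k. of_nat (k choose i) * of_nat (k - i) * t ^ i * u * R (k - i - 1))"
    unfolding RS by (simp add: sum_subtractf[symmetric] algebra_simps)
  \<comment> \<open>Choosing singletons and then one of them amounts, after a shift of
    \<open>i\<close>, to choosing one singleton fewer and then one of the other points. So this sum
    cancels the subtracted one.\<close>
  also have "(\<Sum>i\<le>k. of_nat (k choose i) * of_nat i * t ^ (i - 1) * u * R (k - i)) =
     (\<Sum>i\<le>k. of_nat (k choose i) * of_nat (k - i) * t ^ i * u * R (k - i - 1))"
  proof (cases k)
    case (Suc l)
    have "(Suc l choose Suc i) * Suc i = (Suc l choose i) * (Suc l - i)" for i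
      using binomial_absorb_comp[of "Suc l" i] binomial_absorption[of i "Suc l"] by (simp add: mult.commute)
    then have *: "of_nat (Suc l choose Suc i) * of_nat (Suc i) = (of_nat (Suc l choose i) * of_nat (Suc l - i) :: int poly)" for i
      by (metis of_nat_mult)
    have "(\<Sum>i\<le>k. of_nat (k choose i) * of_nat i * t ^ (i - 1) * u * R (k - i)) =
      (\<Sum>i\<le>l. of_nat (k choose Suc i) * of_nat (Suc i) * t ^ i * u * R (l - i))"
      unfolding Suc by (subst sum.atMost_Suc_shift) simp
    also have "\<dots> = (\<Sum>i\<le>l. of_nat (k choose i) * of_nat (k - i) * t ^ i * u * R (k - i - 1))"
      unfolding Suc * by simp
    also have "\<dots> = (\<Sum>i\<le>k. of_nat (k choose i) * of_nat (k - i) * t ^ i * u * R (k - i - 1))"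
      unfolding Suc by simp
    finally show ?thesis .
  qed simp
  finally have A: "u * pderiv (marked_poly k) = (\<Sum>i\<le>k. of_nat (k choose i) * t ^ i * R (Suc (k - i)))"
    by simp
  have "t * marked_poly k = (\<Sum>i\<le>k. of_nat (k choose i) * t ^ Suc i * R (k - i))"
    unfolding M by (simp add: sum_distrib_left algebra_simps)
  moreover have "marked_poly (Suc k) = R (Suc k) + (\<Sum>i\<le>k. of_nat (Suc k choose Suc i) * t ^ Suc i * R (k - i))"
    unfolding M by (subst sum.atMost_Suc_shift) simp
  moreover have "(\<Sum>i\<le>k. of_nat (Suc k choose Suc i) * t ^ Suc i * R (k - i)) =
     (\<Sum>i\<le>k. of_nat (k choose i) * t ^ Suc i * R (k - i)) + (\<Sum>i\<le>k. of_nat (k choose Suc i) * t ^ Suc i * R (k - i))"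
    unfolding sum.distrib[symmetric] by (intro sum.cong refl) (simp add: algebra_simps)
  moreover have "(\<Sum>i\<le>k. of_nat (k choose i) * t ^ i * R (Suc (k - i))) =
     R (Suc k) + (\<Sum>i\<le>k. of_nat (k choose Suc i) * t ^ Suc i * R (k - i))"
  proof -
    have "(\<Sum>i\<le>k. of_nat (k choose i) * t ^ i * R (Suc (k - i))) =
        (\<Sum>i\<le>Suc k. of_nat (k choose i) * t ^ i * R (Suc k - i))"
      by (simp add: binomial_eq_0 Suc_diff_le)
    also have "\<dots> = R (Suc k) + (\<Sum>i\<le>k. of_nat (k choose Suc i) * t ^ Suc i * R (k - i))"
      by (subst sum.atMost_Suc_shift) simp
    finally show ?thesis .
  qed
  ultimately show ?thesis using A by (simp add: t_def u_def algebra_simps)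
qed

lemma marked_count_0: "marked_count 0 r = (if r = 0 then 1 else 0)"
proof -
  have "marked_count 0 r = (\<Sum>i = 0..r. if i = 0 then (\<Sum>m = r..0. (m choose r) * p2 0 m) else 0)"
    unfolding marked_count_def by (intro sum.cong refl) (simp add: binomial_eq_0)
  then show ?thesis by (cases r) (simp_all add: p2_0)
qed

text \<open>Bijectively: delete the last point and mark what remains of its block. A singleton
  disappears with its mark, a larger marked block stays marked, an unmarked one gains a mark; in the
  last two cases any of the marked blocks may have been the one.\<close>

lemma marked_count_Suc:
  "marked_count (Suc k) r = (if r = 0 then 0 else marked_count k (r - 1)) + r * marked_count k r
     + Suc r * marked_count k (Suc r)"
proof -
  have "int (marked_count (Suc k) r) = int ((if r = 0 then 0 else marked_count k (r - 1)) + r * marked_count k r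
     + Suc r * marked_count k (Suc r))"
    unfolding coeff_marked_poly[symmetric] marked_poly_Suc
    by (cases r) (simp_all add: coeff_pderiv coeff_marked_poly algebra_simps)
  then show ?thesis by (simp only: of_nat_eq_iff)
qed

lemma marked_count_eq_0: "k < r \<Longrightarrow> marked_count k r = 0"
  by (induction k arbitrary: r) (auto simp: marked_count_0 marked_count_Suc)

section \<open>Diagrams of partitions\<close>

text \<open>Row lengths are padded with zeros to an infinite sequence, so that adding or removing a
  box is a function update even if the number of rows changes.\<close>

definition rows :: "nat list \<Rightarrow> nat \<Rightarrow> nat" where
  "rows \<mu> i = (if i < length \<mu> then \<mu> ! i else 0)"

definition diagrams :: "nat \<Rightarrow> (nat \<Rightarrow> nat) set" where
  "diagrams n = {a. antimono a \<and> finite {i. 0 < a i} \<and> sum a {i. 0 < a i} = n}"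

definition of_rows :: "(nat \<Rightarrow> nat) \<Rightarrow> nat list" where
  "of_rows a = map a [0..<card {i. 0 < a i}]"

lemma down_closed_eq_lessThan:
  fixes S :: "nat set"
  assumes "finite S" "\<And>i j. i \<in> S \<Longrightarrow> j < i \<Longrightarrow> j \<in> S"
  shows "S = {..<card S}"
proof (cases "S = {}")
  case False
  have "S = {..Max S}"
    using assms(1) assms(2)[OF Max_in[OF assms(1) False]] Max_in[OF assms(1) False]
    by (auto simp: atMost_def) (metis le_less)
  then show ?thesis by (metis card_atMost lessThan_Suc_atMost)
qed simp

lemma less_card_support_iff:
  assumes "antimono a" "finite {i. (0::nat) < a i}"
  shows "i < card {i. 0 < a i} \<longleftrightarrow> 0 < a i"
proof -
  have "{i. 0 < a i} = {..<card {i. 0 < a i}}"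
  proof (rule down_closed_eq_lessThan[OF assms(2)])
    fix i j :: nat assume "i \<in> {i. 0 < a i}" "j < i"
    then show "j \<in> {i. 0 < a i}" using antimonoD[OF assms(1), of j i] by simp
  qed
  then show ?thesis by blast
qed

lemma rows_of_rows:
  assumes "antimono a" "finite {i. 0 < a i}"
  shows "rows (of_rows a) = a"
  by (simp add: rows_def of_rows_def fun_eq_iff less_card_support_iff[OF assms])

lemma rows_support: "0 \<notin> set \<mu> \<Longrightarrow> {i. 0 < rows \<mu> i} = {..<length \<mu>}"
  by (auto simp: rows_def in_set_conv_nth intro: gr0I)

lemma of_rows_row_lengths: "0 \<notin> set \<mu> \<Longrightarrow> of_rows (rows \<mu>) = \<mu>"
  unfolding of_rows_def rows_support by (rule nth_equalityI) (auto simp: rows_def)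

lemma sum_row_lengths: "0 \<notin> set \<mu> \<Longrightarrow> sum (rows \<mu>) {i. 0 < rows \<mu> i} = sum_list \<mu>"
  unfolding rows_support
  by (simp add: rows_def sum_list_sum_nth atLeast0LessThan)

lemma rows_in_diagrams:
  assumes "\<mu> \<in> partitions n"
  shows "rows \<mu> \<in> diagrams n"
proof -
  have \<mu>: "sorted_wrt (\<ge>) \<mu>" "0 \<notin> set \<mu>" "sum_list \<mu> = n" using assms by (auto simp: partitions_def)
  have "rows \<mu> j \<le> rows \<mu> i" if "i \<le> j" for i j
  proof (cases "i = j")
    case False
    then have "i < j" using that by simp
    then show ?thesis using \<mu>(1) by (simp add: rows_def sorted_wrt_iff_nth_less)
  qed simp
  then show ?thesis
    using sum_row_lengths[OF \<mu>(2)] \<mu>(2,3) by (simp add: diagrams_def rows_support antimonoI)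
qed

lemma of_rows_in_partitions:
  assumes "a \<in> diagrams n"
  shows "of_rows a \<in> partitions n"
proof -
  have a: "antimono a" "finite {i. 0 < a i}" and n: "sum a {i. 0 < a i} = n"
    using assms by (auto simp: diagrams_def)
  have pos: "0 < a i" if "i < card {i. 0 < a i}" for i
    using less_card_support_iff[OF a] that by blast
  have 0: "0 \<notin> set (of_rows a)"
  proof
    assume "0 \<in> set (of_rows a)"
    then obtain i where "i < card {i. 0 < a i}" "a i = 0" unfolding of_rows_def by fastforce
    then show False using pos[of i] by simp
  qed
  have "sum_list (of_rows a) = n"
    using sum_row_lengths[OF 0] n unfolding rows_of_rows[OF a] by (rule trans[OF sym])
  moreover have "sorted_wrt (\<ge>) (of_rows a)"
    unfolding sorted_wrt_iff_nth_less of_rows_def using antimonoD[OF a(1)] by simp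
  ultimately show ?thesis using 0 unfolding partitions_def by blast
qed

lemma bij_row_lengths: "bij_betw rows (partitions n) (diagrams n)"
proof (rule bij_betw_byWitness[where f' = of_rows])
  show "\<forall>\<mu>\<in>partitions n. of_rows (rows \<mu>) = \<mu>"
    using of_rows_row_lengths unfolding partitions_def by blast
  show "\<forall>a\<in>diagrams n. rows (of_rows a) = a"
    using rows_of_rows unfolding diagrams_def by blast
  show "rows ` partitions n \<subseteq> diagrams n" using rows_in_diagrams by auto
  show "of_rows ` diagrams n \<subseteq> partitions n" using of_rows_in_partitions by auto
qed

section \<open>Young's lattice: adding and removing boxes\<close>

definition removable :: "(nat \<Rightarrow> nat) \<Rightarrow> nat set" where
  "removable a = {i. a (Suc i) < a i}"

definition addable :: "(nat \<Rightarrow> nat) \<Rightarrow> nat set" where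
  "addable a = {i. i = 0 \<or> a i < a (i - 1)}"

definition inc :: "(nat \<Rightarrow> nat) \<Rightarrow> nat \<Rightarrow> nat \<Rightarrow> nat" where
  "inc a i = a(i := Suc (a i))"

definition dec :: "(nat \<Rightarrow> nat) \<Rightarrow> nat \<Rightarrow> nat \<Rightarrow> nat" where
  "dec a i = a(i := a i - 1)"

abbreviation down :: "((nat \<Rightarrow> nat) \<Rightarrow> 'b::comm_monoid_add) \<Rightarrow> (nat \<Rightarrow> nat) \<Rightarrow> 'b" where
  "down g a \<equiv> \<Sum>i\<in>removable a. g (dec a i)"

abbreviation up :: "((nat \<Rightarrow> nat) \<Rightarrow> 'b::comm_monoid_add) \<Rightarrow> (nat \<Rightarrow> nat) \<Rightarrow> 'b" where
  "up g a \<equiv> \<Sum>j\<in>addable a. g (inc a j)"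

lemma diagramsD:
  assumes "a \<in> diagrams n"
  shows "antimono a" "finite {i. 0 < a i}" "sum a {i. 0 < a i} = n"
  using assms by (auto simp: diagrams_def)

lemma sum_support: "finite A \<Longrightarrow> {i. 0 < a i} \<subseteq> A \<Longrightarrow> sum a {i. 0 < a i} = sum a A"
  for a :: "nat \<Rightarrow> nat"
  by (rule sum.mono_neutral_left) auto

text \<open>There is one more place to add a box than to remove one. This surplus is the extra term
  in the commutation of \<open>up\<close> and \<open>down\<close>.\<close>

lemma addable_eq: "addable a = insert 0 (Suc ` removable a)"
  by (auto simp: addable_def removable_def image_iff) (metis Suc_pred diff_Suc_1 gr0I not_gr_zero)

lemma finite_removable: "finite {i. 0 < a i} \<Longrightarrow> finite (removable a)"
  by (rule finite_subset[rotated]) (auto simp: removable_def)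

lemma finite_addable: "finite {i. 0 < a i} \<Longrightarrow> finite (addable a)"
  by (simp add: addable_eq finite_removable)

lemma antimono_Suc_iff: "antimono a \<longleftrightarrow> (\<forall>i. a (Suc i) \<le> a i)" for a :: "nat \<Rightarrow> nat"
  by (auto simp: antimono_def intro: lift_Suc_antimono_le)

lemma inc_in_diagrams:
  assumes "a \<in> diagrams n" "j \<in> addable a"
  shows "inc a j \<in> diagrams (Suc n)"
proof -
  note a = diagramsD[OF assms(1)]
  have 1: "antimono (inc a j)"
    using a(1) assms(2) unfolding antimono_Suc_iff addable_def inc_def
    by (auto simp: le_Suc_eq Suc_le_eq)
  have S: "{i. 0 < inc a j i} = insert j {i. 0 < a i}" by (auto simp: inc_def)
  have "sum (inc a j) (insert j {i. 0 < a i}) = Suc (sum a (insert j {i. 0 < a i}))"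
  proof -
    let ?S = "{i. 0 < a i} - {j}"
    have "insert j {i. 0 < a i} = insert j ?S" by auto
    moreover have "sum (inc a j) ?S = sum a ?S" by (intro sum.cong) (auto simp: inc_def)
    ultimately show ?thesis using a(2) by (simp add: inc_def sum.insert_remove)
  qed
  also have "sum a (insert j {i. 0 < a i}) = n" using sum_support[where A = "insert j {i. 0 < a i}" and a = a, OF _ subset_insertI] a(2,3) by simp
  finally show ?thesis using 1 S a(2) by (simp add: diagrams_def)
qed

lemma dec_in_diagrams:
  assumes "a \<in> diagrams (Suc n)" "i \<in> removable a"
  shows "dec a i \<in> diagrams n"
proof -
  note a = diagramsD[OF assms(1)]
  have i: "a (Suc i) < a i" using assms(2) by (simp add: removable_def)
  have 1: "antimono (dec a i)"
    using a(1) i unfolding antimono_Suc_iff dec_def by (auto intro: le_trans[OF diff_le_self])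
  have S: "{j. 0 < dec a i j} \<subseteq> {i. 0 < a i}" by (auto simp: dec_def)
  have f: "finite {j. 0 < dec a i j}" using S a(2) by (rule finite_subset)
  have "Suc n = sum a {i. 0 < a i}" using a by simp
  also have "\<dots> = a i + sum a ({i. 0 < a i} - {i})" using a(2) i by (subst sum.remove) auto
  also have "sum a ({i. 0 < a i} - {i}) = sum (dec a i) ({i. 0 < a i} - {i})"
    by (intro sum.cong) (auto simp: dec_def)
  also have "a i = Suc (dec a i i)" using i by (simp add: dec_def)
  also have "Suc (dec a i i) + sum (dec a i) ({i. 0 < a i} - {i}) = Suc (sum (dec a i) {i. 0 < a i})"
    using a(2) i by (subst sum.remove[of "{i. 0 < a i}" i]) auto
  also have "sum (dec a i) {i. 0 < a i} = sum (dec a i) {j. 0 < dec a i j}"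
    using sum_support[OF a(2) S] by simp
  finally show ?thesis using 1 f by (simp add: diagrams_def)
qed

lemma removable_inc: "antimono a \<Longrightarrow> j \<in> addable a \<Longrightarrow> j \<in> removable (inc a j)"
  by (auto simp: removable_def inc_def antimono_Suc_iff less_Suc_eq_le)

lemma dec_inc [simp]: "dec (inc a j) j = a"
  by (auto simp: dec_def inc_def)

lemma inc_dec: "i \<in> removable a \<Longrightarrow> inc (dec a i) i = a"
  by (auto simp: dec_def inc_def removable_def fun_eq_iff)

lemma addable_dec: "antimono a \<Longrightarrow> i \<in> removable a \<Longrightarrow> i \<in> addable (dec a i)"
  by (cases i) (auto simp: removable_def addable_def dec_def antimono_Suc_iff intro: less_le_trans)

text \<open>Both sides run over the pairs of a diagram and one with a box less; in other words,
  \<open>up\<close> and \<open>down\<close> are adjoint.\<close>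

lemma sum_diagrams_Suc:
  assumes "finite (diagrams n)" "finite (diagrams (Suc n))"
  shows "(\<Sum>a\<in>diagrams (Suc n). \<Sum>i\<in>removable a. g a (dec a i)) =
    (\<Sum>b\<in>diagrams n. \<Sum>j\<in>addable b. g (inc b j) b)"
proof -
  have "(\<Sum>a\<in>diagrams (Suc n). \<Sum>i\<in>removable a. g a (dec a i)) =
      (\<Sum>(a, i)\<in>(SIGMA a:diagrams (Suc n). removable a). g a (dec a i))"
    using assms by (intro sum.Sigma) (auto dest: diagramsD(2) simp: finite_removable)
  also have "\<dots> = (\<Sum>(b, j)\<in>(SIGMA b:diagrams n. addable b). g (inc b j) b)"
    by (rule sum.reindex_bij_witness[where i = "\<lambda>(b, j). (inc b j, j)" and j = "\<lambda>(a, i). (dec a i, i)"])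
       (auto simp: inc_dec dec_in_diagrams inc_in_diagrams dest: diagramsD(1) intro: addable_dec removable_inc)
  also have "\<dots> = (\<Sum>b\<in>diagrams n. \<Sum>j\<in>addable b. g (inc b j) b)"
    using assms by (intro sum.Sigma[symmetric]) (auto dest: diagramsD(2) simp: finite_addable)
  finally show ?thesis .
qed

text \<open>Young's lattice is a differential poset. Adding and removing in different rows commute;
  what is left are the returns to \<open>a\<close>, one for each addable row on the left and one for
  each removable row on the right.\<close>

lemma down_up_commute:
  fixes g :: "(nat \<Rightarrow> nat) \<Rightarrow> 'b :: comm_monoid_add"
  assumes "antimono a" "finite {i. 0 < a i}"
  shows "up (down g) a = down (up g) a + g a"
proof -
  have fi: "finite (removable (inc a j))" for j
    by (rule finite_removable, rule finite_subset[of _ "insert j {i. 0 < a i}"])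
       (use assms in \<open>auto simp: inc_def\<close>)
  have fd: "finite (addable (dec a i))" for i
    by (rule finite_addable, rule finite_subset[of _ "{i. 0 < a i}"])
       (use assms in \<open>auto simp: dec_def\<close>)
  note fin = finite_removable[OF assms(2)] finite_addable[OF assms(2)]
  let ?L = "SIGMA j:addable a. removable (inc a j) - {j}" and ?R = "SIGMA i:removable a. addable (dec a i) - {i}"
  have sumc: "(\<Sum>j\<in>addable a. g a) = (\<Sum>i\<in>removable a. g a) + g a"
    unfolding addable_eq using fin by (subst sum.insert) (auto simp: sum.reindex add.commute)
  have L: "down g (inc a j) =
      g a + (\<Sum>i\<in>removable (inc a j) - {j}. g (dec (inc a j) i))" if "j \<in> addable a" for j
    using that removable_inc[OF assms(1)] by (subst sum.remove[OF fi]) auto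
  have R: "up g (dec a i) =
      g a + (\<Sum>j\<in>addable (dec a i) - {i}. g (inc (dec a i) j))" if "i \<in> removable a" for i
    using that addable_dec[OF assms(1)] by (subst sum.remove[OF fd]) (auto simp: inc_dec)
  have "(\<Sum>j\<in>addable a. \<Sum>i\<in>removable (inc a j) - {j}. g (dec (inc a j) i)) =
     (\<Sum>(j, i)\<in>?L. g (dec (inc a j) i))"
    using fin fi by (intro sum.Sigma) auto
  also have "\<dots> = (\<Sum>(i, j)\<in>?R. g (inc (dec a i) j))"
  proof (rule sum.reindex_bij_witness[where i = "\<lambda>(i, j). (j, i)" and j = "\<lambda>(j, i). (i, j)"])
    \<comment> \<open>Only for \<open>j = Suc i\<close> does one of the two moves affect whether the
      other is allowed.\<close>
    have *: "j \<in> addable a \<and> i \<in> removable (inc a j) \<longleftrightarrow> i \<in> removable a \<and> j \<in> addable (dec a i)"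
      if "i \<noteq> j" for i j
      using that by (cases "j = Suc i"; cases j) (auto simp: addable_def removable_def inc_def dec_def)
    then show "(case x of (j, i) \<Rightarrow> (i, j)) \<in> ?R"
      if "x \<in> ?L" for x using that by auto
    show "(case x of (i, j) \<Rightarrow> (j, i)) \<in> ?L"
      if "x \<in> ?R" for x
      using that *[of "fst x" "snd x"] by auto
    show "(case case x of (j, i) \<Rightarrow> (i, j) of (i, j) \<Rightarrow> g (inc (dec a i) j)) =
         (case x of (j, i) \<Rightarrow> g (dec (inc a j) i))"
      if "x \<in> ?L" for x
    proof -
      have "inc (dec a i) j = dec (inc a j) i" if "i \<noteq> j" for i j
        using that by (auto simp: inc_def dec_def fun_eq_iff)
      moreover obtain j i where "x = (j, i)" "i \<noteq> j" using \<open>x \<in> _\<close> by auto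
      ultimately show ?thesis by simp
    qed
  qed auto
  also have "\<dots> = (\<Sum>i\<in>removable a. \<Sum>j\<in>addable (dec a i) - {i}. g (inc (dec a i) j))"
    using fin fd by (intro sum.Sigma[symmetric]) auto
  finally show ?thesis
    by (simp add: L R sum.distrib sumc add.assoc add.left_commute add.commute)
qed

lemma finite_diagrams: "finite (diagrams n)"
proof -
  have "length (of_rows a) \<le> n" "set (of_rows a) \<subseteq> {..n}" if a: "a \<in> diagrams n" for a
  proof -
    have p: "of_rows a \<in> partitions n" using of_rows_in_partitions[OF a] .
    then have s: "sum_list (of_rows a) = n" "0 \<notin> set (of_rows a)" by (auto simp: partitions_def)
    show "set (of_rows a) \<subseteq> {..n}" using member_le_sum_list[of _ "of_rows a"] s by auto
    have "sum_list xs \<ge> length xs" if "0 \<notin> set xs" for xs :: "nat list"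
      using that by (induction xs) (auto simp: Suc_le_eq)
    then show "length (of_rows a) \<le> n" using s by metis
  qed
  then have "diagrams n \<subseteq> of_rows -` {xs. set xs \<subseteq> {..n} \<and> length xs \<le> n} \<inter> diagrams n"
    by blast
  moreover have "inj_on of_rows (diagrams n)"
    by (rule inj_on_inverseI[where g = rows]) (rule rows_of_rows[OF diagramsD(1,2)])
  moreover have "finite {xs. set xs \<subseteq> {..n} \<and> length xs \<le> n}" by (rule finite_lists_length_le) simp
  ultimately show ?thesis using finite_subset[OF _ finite_vimage_IntI] by blast
qed

lemma finite_partitions: "finite (partitions n)"
  using finite_diagrams bij_betw_finite[OF bij_row_lengths] by blast

section \<open>Standard tableaux\<close>

definition cell_less :: "nat \<times> nat \<Rightarrow> nat \<times> nat \<Rightarrow> bool" where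
  "cell_less x y \<longleftrightarrow> fst x = fst y \<and> snd x < snd y \<or> snd x = snd y \<and> fst x < fst y"

definition tableaux_on :: "(nat \<times> nat) set \<Rightarrow> (nat \<times> nat \<Rightarrow> nat) set" where
  "tableaux_on D =
    {T \<in> extensional D. bij_betw T D {1..card D} \<and> (\<forall>x\<in>D. \<forall>y\<in>D. cell_less x y \<longrightarrow> T x < T y)}"

definition corners :: "(nat \<times> nat) set \<Rightarrow> (nat \<times> nat) set" where
  "corners D = {x \<in> D. \<forall>y\<in>D. \<not> cell_less x y}"

lemma finite_tableaux_on: "finite D \<Longrightarrow> finite (tableaux_on D)"
proof (rule finite_subset)
  show "tableaux_on D \<subseteq> (\<Pi>\<^sub>E x\<in>D. {1..card D})"
    by (auto simp: tableaux_on_def PiE_def bij_betw_def)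
qed (auto intro: finite_PiE)

text \<open>The largest entry \<open>card D\<close> sits in a corner, the cell \<open>?x T\<close>,
  and erasing it leaves a tableau on the other cells.\<close>

lemma card_tableaux_on:
  assumes "finite D" "D \<noteq> {}"
  shows "card (tableaux_on D) = (\<Sum>x\<in>corners D. card (tableaux_on (D - {x})))"
proof -
  let ?x = "\<lambda>T. inv_into D T (card D)" and ?S = "SIGMA x:corners D. tableaux_on (D - {x})"
  have N: "card D > 0" using assms by (simp add: card_gt_0_iff)
  have x: "?x T \<in> D" "T (?x T) = card D" if "T \<in> tableaux_on D" for T
  proof -
    have "card D \<in> T ` D" using that N by (auto simp: tableaux_on_def bij_betw_def)
    then show "?x T \<in> D" "T (?x T) = card D" by (auto intro: inv_into_into f_inv_into_f)
  qed
  have fw: "?x T \<in> corners D \<and> T(?x T := undefined) \<in> tableaux_on (D - {?x T})" if T: "T \<in> tableaux_on D" for T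
  proof
    define z where "z = ?x T"
    note z = x[OF T, folded z_def]
    have b: "bij_betw T D {1..card D}" and ext: "T \<in> extensional D"
      and mono: "\<And>x y. x \<in> D \<Longrightarrow> y \<in> D \<Longrightarrow> cell_less x y \<Longrightarrow> T x < T y"
      using T by (auto simp: tableaux_on_def)
    have "\<not> cell_less z y" if "y \<in> D" for y
      using mono[OF z(1) that] z(2) bij_betw_apply[OF b that] by auto
    then show "?x T \<in> corners D" using z(1) by (simp add: corners_def z_def)
    have "bij_betw T (D - {z}) ({1..card D} - {card D})"
      using b by (rule bij_betw_DiffI) (use z N in \<open>auto simp: bij_betw_def\<close>)
    also have "{1..card D} - {card D} = {1..card (D - {z})}" using z assms by auto
    finally have "bij_betw (T(z := undefined)) (D - {z}) {1..card (D - {z})}"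
      by (subst bij_betw_cong[where g = T]) auto
    moreover have "T(z := undefined) \<in> extensional (D - {z})" using ext by (auto simp: extensional_def)
    ultimately show "T(?x T := undefined) \<in> tableaux_on (D - {?x T})"
      using mono unfolding z_def[symmetric] tableaux_on_def by simp
  qed
  have bw: "T(x := card D) \<in> tableaux_on D \<and> ?x (T(x := card D)) = x"
    if xc: "x \<in> corners D" and T: "T \<in> tableaux_on (D - {x})" for x T
  proof
    have xD: "x \<in> D" using xc by (simp add: corners_def)
    have b0: "bij_betw T (D - {x}) {1..card D - 1}" and ext: "T \<in> extensional (D - {x})"
      and mono: "\<And>u v. u \<in> D - {x} \<Longrightarrow> v \<in> D - {x} \<Longrightarrow> cell_less u v \<Longrightarrow> T u < T v"
      using T xD assms by (auto simp: tableaux_on_def)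
    have lt: "T y < card D" if "y \<in> D - {x}" for y
      using bij_betw_apply[OF b0 that] N by auto
    have "bij_betw (T(x := card D)) (D - {x}) {1..card D - 1}"
      using b0 by (subst bij_betw_cong[where g = T]) auto
    then have "bij_betw (T(x := card D)) ((D - {x}) \<union> {x}) ({1..card D - 1} \<union> {card D})"
      by (rule bij_betw_combine) (use N in auto)
    moreover have "(D - {x}) \<union> {x} = D" "{1..card D - 1} \<union> {card D} = {1..card D}" using xD N by auto
    ultimately have b: "bij_betw (T(x := card D)) D {1..card D}" by simp
    have "(T(x := card D)) u < (T(x := card D)) v" if uv: "u \<in> D" "v \<in> D" "cell_less u v" for u v
    proof -
      have "u \<noteq> x" using xc uv by (auto simp: corners_def)
      then show ?thesis using lt[of u] mono[of u v] uv by (cases "v = x") simp_all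
    qed
    moreover have "T(x := card D) \<in> extensional D" using ext xD by (auto simp: extensional_def)
    ultimately show "T(x := card D) \<in> tableaux_on D" using b by (simp add: tableaux_on_def)
    show "?x (T(x := card D)) = x"
      using b xD by (intro inv_into_f_eq) (auto simp: bij_betw_def)
  qed
  have ext: "T(x := undefined) = T" if "T \<in> tableaux_on (D - {x})" for x T
    using that by (auto simp: tableaux_on_def extensional_def fun_eq_iff)
  have "bij_betw (\<lambda>T. (?x T, T(?x T := undefined))) (tableaux_on D) ?S"
  proof (rule bij_betw_byWitness[where f' = "\<lambda>(x, T). T(x := card D)"])
    show "\<forall>T\<in>tableaux_on D. (case (?x T, T(?x T := undefined)) of (x, T) \<Rightarrow> T(x := card D)) = T"
      using x(2) by (simp add: fun_upd_idem_iff)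
    show "(\<lambda>T. (?x T, T(?x T := undefined))) ` tableaux_on D \<subseteq> ?S" using fw by auto
    show "\<forall>z\<in>?S. (?x (case z of (x, T) \<Rightarrow> T(x := card D)), (case z of (x, T) \<Rightarrow> T(x := card D))
           (?x (case z of (x, T) \<Rightarrow> T(x := card D)) := undefined)) = z"
      using bw ext by auto
    show "(\<lambda>(x, T). T(x := card D)) ` ?S \<subseteq> tableaux_on D" using bw by auto
  qed
  then have "card (tableaux_on D) = card ?S" by (rule bij_betw_same_card)
  also have "\<dots> = (\<Sum>x\<in>corners D. card (tableaux_on (D - {x})))"
    using assms by (intro card_SigmaI) (auto simp: corners_def finite_tableaux_on)
  finally show ?thesis .
qed

definition diagram_cells :: "(nat \<Rightarrow> nat) \<Rightarrow> (nat \<times> nat) set" where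
  "diagram_cells a = {(i, j). j < a i}"

definition tab_count :: "(nat \<Rightarrow> nat) \<Rightarrow> nat" where
  "tab_count a = card (tableaux_on (diagram_cells a))"

lemma diagram_cells_row_lengths: "diagram_cells (rows \<mu>) = cells \<mu>"
  by (auto simp: diagram_cells_def cells_def rows_def split: if_splits)

lemma cells_eq_Sigma: "cells \<mu> = (SIGMA i:{..<length \<mu>}. {..<\<mu> ! i})"
  by (auto simp: cells_def)

lemma finite_cells: "finite (cells \<mu>)"
  by (simp add: cells_eq_Sigma)

lemma card_cells: "card (cells \<mu>) = sum_list \<mu>"
  by (simp add: cells_eq_Sigma card_SigmaI sum_list_sum_nth atLeast0LessThan)

lemma num_standard_tableaux_eq: "num_standard_tableaux \<mu> = tab_count (rows \<mu>)"
proof -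
  have "standard_tableaux \<mu> = tableaux_on (cells \<mu>)"
    unfolding standard_tableaux_def tableaux_on_def cell_less_def card_cells by fastforce
  then show ?thesis by (simp add: num_standard_tableaux_def tab_count_def diagram_cells_row_lengths)
qed

lemma finite_diagram_cells: "a \<in> diagrams n \<Longrightarrow> finite (diagram_cells a)"
  by (metis diagram_cells_row_lengths diagramsD(1,2) finite_cells rows_of_rows)

lemma corners_diagram_cells:
  assumes "antimono a"
  shows "corners (diagram_cells a) = (\<lambda>i. (i, a i - 1)) ` removable a"
proof (intro equalityI subsetI)
  fix x assume "x \<in> corners (diagram_cells a)"
  then obtain i j where x: "x = (i, j)" "j < a i" and c: "\<And>i' j'. j' < a i' \<Longrightarrow> \<not> cell_less (i, j) (i', j')"
    unfolding corners_def diagram_cells_def by fast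
  have "\<not> Suc j < a i" "\<not> j < a (Suc i)" using c[of "Suc j" i] c[of j "Suc i"] by (auto simp: cell_less_def)
  then have "i \<in> removable a" "j = a i - 1" using x(2) by (auto simp: removable_def)
  then show "x \<in> (\<lambda>i. (i, a i - 1)) ` removable a" using x(1) by blast
next
  fix x assume "x \<in> (\<lambda>i. (i, a i - 1)) ` removable a"
  then obtain i where i: "x = (i, a i - 1)" "a (Suc i) < a i" by (auto simp: removable_def)
  have "i' \<le> i" if "a i - 1 < a i'" for i'
  proof (rule ccontr)
    assume "\<not> i' \<le> i"
    then have "a i' \<le> a (Suc i)" using antimonoD[OF assms, of "Suc i" i'] by simp
    then show False using that i(2) by simp
  qed
  then show "x \<in> corners (diagram_cells a)" using i by (force simp: corners_def diagram_cells_def cell_less_def)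
qed

lemma tab_count_rec:
  assumes "a \<in> diagrams (Suc n)"
  shows "tab_count a = down tab_count a"
proof -
  note a = diagramsD[OF assms]
  have "diagram_cells a \<noteq> {}"
  proof
    assume "diagram_cells a = {}"
    then have "a i = 0" for i by (auto simp: diagram_cells_def)
    then show False using a(3) by simp
  qed
  then have "tab_count a = (\<Sum>x\<in>corners (diagram_cells a). card (tableaux_on (diagram_cells a - {x})))"
    unfolding tab_count_def using finite_diagram_cells[OF assms] by (intro card_tableaux_on)
  also have "\<dots> = (\<Sum>i\<in>removable a. card (tableaux_on (diagram_cells a - {(i, a i - 1)})))"
    unfolding corners_diagram_cells[OF a(1)] by (subst sum.reindex) (auto simp: inj_on_def)
  also have "\<dots> = down tab_count a"
  proof (intro sum.cong refl, goal_cases)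
    case (1 i)
    then have "diagram_cells a - {(i, a i - 1)} = diagram_cells (dec a i)"
      by (auto simp: diagram_cells_def dec_def removable_def split: if_splits)
    then show ?case
      by (simp add: tab_count_def)
  qed
  finally show ?thesis .
qed

lemma diagrams_0: "diagrams 0 = {\<lambda>_. 0}"
  by (auto simp: diagrams_def antimono_def)

lemma tab_count_zero: "tab_count (\<lambda>_. 0) = 1"
proof -
  have "tableaux_on {} = {\<lambda>_. undefined}"
    by (auto simp: tableaux_on_def bij_betw_def)
  then show ?thesis by (simp add: tab_count_def diagram_cells_def)
qed

text \<open>By its recursion \<open>tab_count\<close> is fixed by \<open>down\<close>, so moving
  \<open>up\<close> past \<open>down\<close> adds one more copy of \<open>tab_count\<close> for
  every box.\<close>

lemma tab_count_up:
  "a \<in> diagrams n \<Longrightarrow> up tab_count a = Suc n * tab_count a"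
proof (induction n arbitrary: a)
  case 0
  then have a: "a = (\<lambda>_. 0)" by (simp add: diagrams_0)
  have "addable a = {0}" by (auto simp: a addable_def)
  moreover have "inc a 0 \<in> diagrams (Suc 0)" using 0 by (intro inc_in_diagrams) (auto simp: addable_def)
  moreover have "removable (inc a 0) = {0}" by (auto simp: a removable_def inc_def)
  ultimately show ?case using tab_count_rec[of "inc a 0" 0] by simp
next
  case (Suc n)
  note a = diagramsD[OF Suc.prems]
  have "up tab_count a =
      up (down tab_count) a"
    using inc_in_diagrams[OF Suc.prems] tab_count_rec by (intro sum.cong) blast+
  also have "\<dots> = down (up tab_count) a + tab_count a"
    by (rule down_up_commute[OF a(1,2)])
  also have "down (up tab_count) a =
      (\<Sum>i\<in>removable a. Suc n * tab_count (dec a i))"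
    using Suc.IH dec_in_diagrams[OF Suc.prems] by (intro sum.cong) auto
  also have "\<dots> = Suc n * tab_count a"
    by (simp only: sum_distrib_left[symmetric] tab_count_rec[OF Suc.prems])
  finally show ?case by simp
qed

text \<open>This takes the place of the Robinson-Schensted correspondence: one factor is expanded by
  \<open>down\<close>, adjointness turns this into \<open>up\<close> on the other factor, and
  \<open>up\<close> multiplies by \<open>Suc n\<close>.\<close>

lemma sum_tab_count_squares: "(\<Sum>a\<in>diagrams n. (tab_count a)\<^sup>2) = fact n"
proof (induction n)
  case 0
  then show ?case by (simp add: diagrams_0 tab_count_zero)
next
  case (Suc n)
  have "(\<Sum>a\<in>diagrams (Suc n). (tab_count a)\<^sup>2) =
      (\<Sum>a\<in>diagrams (Suc n). \<Sum>i\<in>removable a. tab_count a * tab_count (dec a i))"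
    by (intro sum.cong refl) (simp add: power2_eq_square sum_distrib_left[symmetric] tab_count_rec[symmetric])
  also have "\<dots> = (\<Sum>b\<in>diagrams n. \<Sum>j\<in>addable b. tab_count (inc b j) * tab_count b)"
    by (rule sum_diagrams_Suc) (simp_all add: finite_diagrams)
  also have "\<dots> = (\<Sum>b\<in>diagrams n. Suc n * (tab_count b)\<^sup>2)"
    by (intro sum.cong refl) (simp only: sum_distrib_right[symmetric] tab_count_up power2_eq_square mult.assoc)
  also have "\<dots> = fact (Suc n)" by (simp only: sum_distrib_left[symmetric] Suc fact_Suc of_nat_id)
  finally show ?case .
qed

section \<open>Traces on spans\<close>

lemma fvs_basis_of_span:
  assumes "finite S" "\<not> fvs.dependent B" "fvs.span B = fvs.span S"
  shows "finite B"
proof -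
  have "B \<subseteq> fvs.span S" using assms(3) fvs.span_superset by blast
  then show ?thesis using fvs.independent_span_bound[OF assms(1,2)] by blast
qed

text \<open>The basis that \<open>trace_on\<close> picks by \<open>SOME\<close> depends on the space
  only, so a single one serves for all maps \<open>T\<close>.\<close>

lemma trace_on_basis:
  assumes "finite S"
  obtains B where "\<not> fvs.dependent B" "fvs.span B = fvs.span S" "finite B"
    "\<And>T. trace_on (fvs.span S) T = (\<Sum>b\<in>B. fvs.representation B (T b) b)"
proof -
  obtain B0 where "B0 \<subseteq> fvs.span S" "\<not> fvs.dependent B0" "fvs.span S \<subseteq> fvs.span B0"
    using fvs.maximal_independent_subset by blast
  then have "\<not> fvs.dependent B0 \<and> fvs.span B0 = fvs.span S"
    using fvs.span_minimal[OF _ fvs.subspace_span] by blast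
  then have "\<not> fvs.dependent (SOME B. \<not> fvs.dependent B \<and> fvs.span B = fvs.span S) \<and>
      fvs.span (SOME B. \<not> fvs.dependent B \<and> fvs.span B = fvs.span S) = fvs.span S"
    by (rule someI)
  with fvs_basis_of_span[OF assms] show ?thesis
    by (intro that[of "SOME B. \<not> fvs.dependent B \<and> fvs.span B = fvs.span S"]) (auto simp: trace_on_def Let_def)
qed

lemma sum_fun_apply: "(\<Sum>i\<in>A. f i) x = (\<Sum>i\<in>A. f i x)" for f :: "'i \<Rightarrow> 'a \<Rightarrow> complex"
  by (induction A rule: infinite_finite_induct) auto

text \<open>
  The \<open>u x\<close> play the role of the images of the indicator functions of the points
  \<open>x\<close> under a map which is \<open>\<alpha>\<close> times a projection onto their span.
\<close>

lemma trace_on_quasi_projection: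
  fixes u :: "'a \<Rightarrow> 'a \<Rightarrow> complex"
  assumes fin: "finite G"
    and proj: "\<And>y. y \<in> G \<Longrightarrow> (\<Sum>x\<in>G. fscale (u y x) (u x)) = fscale \<alpha> (u y)"
    and add: "\<And>f g. T (f + g) = T f + T g"
    and scale: "\<And>c f. T (fscale c f) = fscale c (T f)"
    and inv: "\<And>y. y \<in> G \<Longrightarrow> T (u y) \<in> fvs.span (u ` G)"
  shows "(\<Sum>x\<in>G. T (u x) x) = \<alpha> * trace_on (fvs.span (u ` G)) T"
proof -
  let ?V = "fvs.span (u ` G)"
  obtain B where B: "\<not> fvs.dependent B" "fvs.span B = ?V" "finite B"
    and tr: "\<And>T. trace_on ?V T = (\<Sum>b\<in>B. fvs.representation B (T b) b)"
    using trace_on_basis[OF finite_imageI[OF fin], of u] by blast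
  define r where "r x b = fvs.representation B (u x) b" for x b
  have "fscale 0 f = 0" for f :: "'a \<Rightarrow> complex" by (rule ext) (simp add: fscale_def)
  then have T0: "T 0 = 0" using scale[of 0 0] by metis
  have Tsum: "T (\<Sum>i\<in>I. f i) = (\<Sum>i\<in>I. T (f i))" for f :: "('a \<Rightarrow> complex) \<Rightarrow> 'a \<Rightarrow> complex" and I
    by (induction I rule: infinite_finite_induct) (simp_all only: sum.infinite sum.empty sum.insert T0 add not_False_eq_True)
  have proj': "(\<Sum>x\<in>G. fscale (v x) (u x)) = fscale \<alpha> v" if "v \<in> ?V" for v
    using that
  proof (induction rule: fvs.span_induct_alt)
    case base
    show ?case by (rule ext) (simp add: fscale_def sum_fun_apply)
  next
    case (step c v w)
    then obtain y where y: "y \<in> G" "v = u y" by auto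
    have "(\<Sum>x\<in>G. fscale ((fscale c v + w) x) (u x)) =
        fscale c (\<Sum>x\<in>G. fscale (v x) (u x)) + (\<Sum>x\<in>G. fscale (w x) (u x))"
      by (rule ext) (simp add: fscale_def sum_fun_apply sum_distrib_left sum.distrib[symmetric] distrib_right mult.assoc)
    also have "\<dots> = fscale \<alpha> (fscale c v + w)"
      unfolding y(2) proj[OF y(1)] step.IH by (rule ext) (simp add: fscale_def algebra_simps)
    finally show ?case .
  qed
  have TV: "T v \<in> ?V" if "v \<in> ?V" for v
    using that
  proof (induction rule: fvs.span_induct_alt)
    case base
    show ?case unfolding T0 by (rule fvs.span_zero)
  next
    case (step c v w)
    then show ?case unfolding add scale using inv by (blast intro: fvs.span_add fvs.span_scale)
  qed
  have uV: "u x \<in> ?V" if "x \<in> G" for x using that by (auto intro: fvs.span_base)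
  have bV: "b \<in> ?V" if "b \<in> B" for b using that B(2) fvs.span_base by blast
  have Tu: "T (u x) x = (\<Sum>b\<in>B. r x b * T b x)" if "x \<in> G" for x
  proof -
    have "u x = (\<Sum>b\<in>B. fscale (r x b) b)"
      using fvs.sum_representation_eq[OF B(1) _ B(3), of "u x"] uV[OF that] B(2) by (simp add: r_def)
    then have "T (u x) = (\<Sum>b\<in>B. fscale (r x b) (T b))" by (metis (no_types, lifting) Tsum scale sum.cong)
    then show ?thesis by (simp add: sum_fun_apply fscale_def)
  qed
  have rep: "\<alpha> * fvs.representation B (T b) b = (\<Sum>x\<in>G. T b x * r x b)" if "b \<in> B" for b
  proof -
    have Tb: "T b \<in> ?V" using TV bV that by blast
    have "\<alpha> * fvs.representation B (T b) b = fvs.representation B (fscale \<alpha> (T b)) b"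
      using fvs.representation_scale[OF B(1)] Tb B(2) by simp
    also have "\<dots> = fvs.representation B (\<Sum>x\<in>G. fscale (T b x) (u x)) b"
      using proj'[OF Tb] by simp
    also have "\<dots> = (\<Sum>x\<in>G. fvs.representation B (fscale (T b x) (u x)) b)"
      using uV B(2) by (subst fvs.representation_sum[OF B(1)]) (auto intro: fvs.span_scale)
    also have "\<dots> = (\<Sum>x\<in>G. T b x * r x b)"
      using uV B(2) by (intro sum.cong refl) (simp add: fvs.representation_scale[OF B(1)] r_def)
    finally show ?thesis .
  qed
  \<comment> \<open>The matrices \<open>r x b\<close> and \<open>T b x\<close> are multiplied in
    either order: one product has its trace over the points \<open>x\<close>, the other over the
    basis.\<close>
  have "(\<Sum>x\<in>G. T (u x) x) = (\<Sum>x\<in>G. \<Sum>b\<in>B. r x b * T b x)" by (simp add: Tu)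
  also have "\<dots> = (\<Sum>b\<in>B. \<Sum>x\<in>G. T b x * r x b)" by (subst sum.swap) (simp add: mult.commute)
  also have "\<dots> = \<alpha> * trace_on ?V T" by (simp add: tr sum_distrib_left rep)
  finally show ?thesis .
qed

text \<open>The trace of the identity is the dimension. This is where the degrees and the
  restriction multiplicities get to be natural numbers.\<close>

lemma trace_on_id:
  assumes "finite S"
  shows "\<exists>d. trace_on (fvs.span S) (\<lambda>f. f) = of_nat d \<and> ((\<exists>v\<in>S. v \<noteq> 0) \<longrightarrow> d > 0)"
proof -
  obtain B where B: "\<not> fvs.dependent B" "fvs.span B = fvs.span S" "finite B"
    and tr: "\<And>T. trace_on (fvs.span S) T = (\<Sum>b\<in>B. fvs.representation B (T b) b)"
    using trace_on_basis[OF assms(1)] by blast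
  have "trace_on (fvs.span S) (\<lambda>f. f) = (\<Sum>b\<in>B. 1)"
    unfolding tr by (intro sum.cong refl) (simp add: fvs.representation_basis[OF B(1)])
  moreover have "B \<noteq> {}" if "v \<in> S" "v \<noteq> 0" for v using B(2) that fvs.span_base[of v S] by auto
  ultimately show ?thesis using B(3) by (intro exI[of _ "card B"]) (auto simp: card_gt_0_iff)
qed

section \<open>Young symmetrizers\<close>

abbreviation perms :: "nat \<Rightarrow> (nat \<Rightarrow> nat) set" where
  "perms n \<equiv> {p. p permutes {..<n}}"

lemma sum_list_part: "\<mu> \<in> partitions n \<Longrightarrow> sum_list \<mu> = n"
  by (simp add: partitions_def)

lemma mem_cells_iff: "(i, j) \<in> cells \<mu> \<longleftrightarrow> j < rows \<mu> i"
  by (simp add: cells_def rows_def)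

lemma tableau_entry_less:
  assumes "(i, j) \<in> cells \<mu>" "i < i'"
  shows "tableau_entry \<mu> (i, j) < sum_list (take i' \<mu>)"
proof -
  have ij: "i < length \<mu>" "j < \<mu> ! i" using assms(1) by (auto simp: cells_def)
  have "take i' \<mu> = take (Suc i) \<mu> @ take (i' - Suc i) (drop (Suc i) \<mu>)"
    using assms(2) by (metis Suc_leI le_add_diff_inverse take_add)
  then have "sum_list (take (Suc i) \<mu>) \<le> sum_list (take i' \<mu>)" by simp
  moreover have "tableau_entry \<mu> (i, j) < sum_list (take (Suc i) \<mu>)"
    using ij by (simp add: tableau_entry_def take_Suc_conv_app_nth)
  ultimately show ?thesis by simp
qed

lemma bij_tableau_entry: "bij_betw (tableau_entry \<mu>) (cells \<mu>) {..<sum_list \<mu>}"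
proof -
  have "inj_on (tableau_entry \<mu>) (cells \<mu>)"
  proof (rule inj_onI)
    fix x y assume xy: "x \<in> cells \<mu>" "y \<in> cells \<mu>" "tableau_entry \<mu> x = tableau_entry \<mu> y"
    obtain i j i' j' where w: "x = (i, j)" "y = (i', j')" by fastforce
    have "\<not> i < i'" if "(i, j) \<in> cells \<mu>" "tableau_entry \<mu> (i, j) = tableau_entry \<mu> (i', j')" for i j i' j'
      using tableau_entry_less[OF that(1), of i'] that(2) by (auto simp: tableau_entry_def)
    from this[of i j i' j'] this[of i' j' i j] have "i = i'" using xy w by auto
    then show "x = y" using xy(3) w by (simp add: tableau_entry_def)
  qed
  moreover have "tableau_entry \<mu> ` cells \<mu> \<subseteq> {..<sum_list \<mu>}"
    using tableau_entry_less[of _ _ \<mu> "length \<mu>"] by (auto simp: cells_def)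
  ultimately show ?thesis
    by (simp add: bij_betw_def card_image card_cells card_subset_eq)
qed

section \<open>Rows, columns and their stabilizers\<close>

definition row_of :: "nat list \<Rightarrow> nat \<Rightarrow> nat" where
  "row_of \<mu> x = fst (inv_into (cells \<mu>) (tableau_entry \<mu>) x)"

definition col_of :: "nat list \<Rightarrow> nat \<Rightarrow> nat" where
  "col_of \<mu> x = snd (inv_into (cells \<mu>) (tableau_entry \<mu>) x)"

lemma row_of_entry: "(i, j) \<in> cells \<mu> \<Longrightarrow> row_of \<mu> (tableau_entry \<mu> (i, j)) = i"
  and col_of_entry: "(i, j) \<in> cells \<mu> \<Longrightarrow> col_of \<mu> (tableau_entry \<mu> (i, j)) = j"
  using bij_tableau_entry[of \<mu>] by (simp_all add: row_of_def col_of_def bij_betw_def)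

lemma row_col_cell: "x < sum_list \<mu> \<Longrightarrow> (row_of \<mu> x, col_of \<mu> x) \<in> cells \<mu>"
  unfolding row_of_def col_of_def
  using bij_betw_apply[OF bij_betw_inv_into[OF bij_tableau_entry[of \<mu>]], of x] by simp

lemma entry_row_col: "x < sum_list \<mu> \<Longrightarrow> tableau_entry \<mu> (row_of \<mu> x, col_of \<mu> x) = x"
  unfolding row_of_def col_of_def
  using bij_betw_inv_into_right[OF bij_tableau_entry[of \<mu>], of x] by simp

lemma row_col_inject:
  assumes "x < sum_list \<mu>" "y < sum_list \<mu>" "row_of \<mu> x = row_of \<mu> y" "col_of \<mu> x = col_of \<mu> y"
  shows "x = y"
proof -
  have "tableau_entry \<mu> (row_of \<mu> x, col_of \<mu> x) = tableau_entry \<mu> (row_of \<mu> y, col_of \<mu> y)"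
    by (simp only: assms(3,4))
  then show ?thesis unfolding entry_row_col[OF assms(1)] entry_row_col[OF assms(2)] .
qed

lemma permutes_fibers_iff:
  assumes "p permutes S" "finite S"
  shows "(\<forall>i. p ` {x\<in>S. r x = i} = {x\<in>S. r x = i}) \<longleftrightarrow> (\<forall>x\<in>S. r (p x) = r x)"
proof
  assume "\<forall>i. p ` {x\<in>S. r x = i} = {x\<in>S. r x = i}"
  then show "\<forall>x\<in>S. r (p x) = r x" by blast
next
  assume *: "\<forall>x\<in>S. r (p x) = r x"
  show "\<forall>i. p ` {x\<in>S. r x = i} = {x\<in>S. r x = i}"
  proof
    fix i
    have "p ` {x\<in>S. r x = i} \<subseteq> {x\<in>S. r x = i}" using * permutes_in_image[OF assms(1)] by auto
    moreover have "inj_on p {x\<in>S. r x = i}" using permutes_inj[OF assms(1)] by (rule inj_on_subset) simp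
    ultimately show "p ` {x\<in>S. r x = i} = {x\<in>S. r x = i}"
      using assms(2) by (simp add: endo_inj_surj)
  qed
qed

text \<open>\<open>s\<close> will be \<open>fst\<close> for the row stabilizer and
  \<open>snd\<close> for the column stabilizer, which are thus treated alike, as permutations
  preserving one coordinate of the cell of every entry.\<close>

lemma stabilizer_iff:
  fixes s :: "nat \<times> nat \<Rightarrow> nat" and \<mu> :: "nat list"
  defines "r \<equiv> \<lambda>x. s (inv_into (cells \<mu>) (tableau_entry \<mu>) x)"
  shows "p permutes {..<sum_list \<mu>} \<and>
      (\<forall>i. let R = tableau_entry \<mu> ` {x \<in> cells \<mu>. s x = i} in p ` R = R) \<longleftrightarrow>
    p permutes {..<sum_list \<mu>} \<and> (\<forall>x<sum_list \<mu>. r (p x) = r x)"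
proof (cases "p permutes {..<sum_list \<mu>}")
  case True
  note B = bij_tableau_entry[of \<mu>]
  have img: "tableau_entry \<mu> ` {x \<in> cells \<mu>. s x = i} = {x\<in>{..<sum_list \<mu>}. r x = i}" for i
  proof (intro equalityI subsetI)
    fix y assume "y \<in> tableau_entry \<mu> ` {x \<in> cells \<mu>. s x = i}"
    then obtain x where x: "x \<in> cells \<mu>" "s x = i" "y = tableau_entry \<mu> x" by blast
    then show "y \<in> {x\<in>{..<sum_list \<mu>}. r x = i}"
      using bij_betw_apply[OF B x(1)] inv_into_f_f[OF bij_betw_imp_inj_on[OF B] x(1)] by (simp add: r_def)
  next
    fix y assume y: "y \<in> {x\<in>{..<sum_list \<mu>}. r x = i}"
    then show "y \<in> tableau_entry \<mu> ` {x \<in> cells \<mu>. s x = i}"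
      using bij_betw_apply[OF bij_betw_inv_into[OF B], of y] bij_betw_inv_into_right[OF B, of y]
      by (intro image_eqI[of _ _ "inv_into (cells \<mu>) (tableau_entry \<mu>) y"]) (auto simp: r_def)
  qed
  show ?thesis
    unfolding Let_def img permutes_fibers_iff[OF True finite_lessThan] by (simp only: Ball_def lessThan_iff)
qed (simp only: simp_thms)

lemma row_stab_iff:
  "p \<in> row_stabilizer \<mu> \<longleftrightarrow> p permutes {..<sum_list \<mu>} \<and> (\<forall>x<sum_list \<mu>. row_of \<mu> (p x) = row_of \<mu> x)"
  unfolding row_stabilizer_def row_of_def mem_Collect_eq by (rule stabilizer_iff)

lemma col_stab_iff:
  "p \<in> column_stabilizer \<mu> \<longleftrightarrow> p permutes {..<sum_list \<mu>} \<and> (\<forall>x<sum_list \<mu>. col_of \<mu> (p x) = col_of \<mu> x)"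
  unfolding column_stabilizer_def col_of_def mem_Collect_eq by (rule stabilizer_iff)

lemma permutes_less_iff: "p permutes {..<n} \<Longrightarrow> p x < n \<longleftrightarrow> x < n" for n :: nat
  using permutes_in_image[of p "{..<n}" x] by simp

lemma fiber_stabilizer_comp:
  fixes p q :: "nat \<Rightarrow> nat"
  assumes "p permutes {..<n}" "q permutes {..<n}" "\<forall>x<n. r (p x) = r x" "\<forall>x<n. r (q x) = r x"
  shows "p \<circ> q permutes {..<n} \<and> (\<forall>x<n. r ((p \<circ> q) x) = r x)"
  using assms(3,4) permutes_compose[OF assms(2,1)] permutes_less_iff[OF assms(2)] by simp

lemma fiber_stabilizer_inv:
  fixes p :: "nat \<Rightarrow> nat"
  assumes "p permutes {..<n}" "\<forall>x<n. r (p x) = r x"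
  shows "inv p permutes {..<n} \<and> (\<forall>x<n. r (inv p x) = r x)"
proof (intro conjI allI impI)
  show inv: "inv p permutes {..<n}" by (rule permutes_inv[OF assms(1)])
  fix x assume "x < n"
  then have "r (p (inv p x)) = r (inv p x)" using assms(2) permutes_less_iff[OF inv] by simp
  then show "r (inv p x) = r x" by (simp add: permutes_inverses(1)[OF assms(1)])
qed

lemma row_stab_comp: "p \<in> row_stabilizer \<mu> \<Longrightarrow> q \<in> row_stabilizer \<mu> \<Longrightarrow> p \<circ> q \<in> row_stabilizer \<mu>"
  unfolding row_stab_iff by (elim conjE) (rule fiber_stabilizer_comp)

lemma col_stab_comp: "p \<in> column_stabilizer \<mu> \<Longrightarrow> q \<in> column_stabilizer \<mu> \<Longrightarrow> p \<circ> q \<in> column_stabilizer \<mu>"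
  unfolding col_stab_iff by (elim conjE) (rule fiber_stabilizer_comp)

lemma row_stab_inv: "p \<in> row_stabilizer \<mu> \<Longrightarrow> inv p \<in> row_stabilizer \<mu>"
  unfolding row_stab_iff by (elim conjE) (rule fiber_stabilizer_inv)

lemma col_stab_inv: "p \<in> column_stabilizer \<mu> \<Longrightarrow> inv p \<in> column_stabilizer \<mu>"
  unfolding col_stab_iff by (elim conjE) (rule fiber_stabilizer_inv)

lemma row_stab_permutes: "p \<in> row_stabilizer \<mu> \<Longrightarrow> p permutes {..<sum_list \<mu>}"
  and col_stab_permutes: "p \<in> column_stabilizer \<mu> \<Longrightarrow> p permutes {..<sum_list \<mu>}"
  by (simp_all add: row_stab_iff col_stab_iff)

lemma finite_row_stabilizer: "finite (row_stabilizer \<mu>)"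
  by (rule finite_subset[OF _ finite_permutations[of "{..<sum_list \<mu>}"]])
     (use row_stab_permutes in blast, simp)

lemma finite_column_stabilizer: "finite (column_stabilizer \<mu>)"
  by (rule finite_subset[OF _ finite_permutations[of "{..<sum_list \<mu>}"]])
     (use col_stab_permutes in blast, simp)

lemma id_row_stabilizer: "id \<in> row_stabilizer \<mu>" and id_column_stabilizer: "id \<in> column_stabilizer \<mu>"
  unfolding row_stab_iff col_stab_iff using permutes_id by simp_all

lemma row_column_stabilizer_trivial:
  assumes "p \<in> row_stabilizer \<mu>" "p \<in> column_stabilizer \<mu>"
  shows "p = id"
proof
  fix x
  have p: "p permutes {..<sum_list \<mu>}" using assms by (simp add: row_stab_iff)
  show "p x = id x"
  proof (cases "x < sum_list \<mu>")
    case True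
    then show ?thesis
      using assms permutes_less_iff[OF p, of x] row_col_inject[of "p x" \<mu> x]
      by (simp add: row_stab_iff col_stab_iff)
  next
    case False
    then show ?thesis using permutes_not_in[OF p, of x] by simp
  qed
qed

section \<open>Dominance order, and factorization into a row and a column permutation\<close>

definition dominated :: "nat list \<Rightarrow> nat list \<Rightarrow> bool" where
  "dominated \<mu> \<nu> \<longleftrightarrow> (\<forall>i. (\<Sum>k<i. rows \<mu> k) \<le> (\<Sum>k<i. rows \<nu> k))"

lemma dominated_antisym:
  assumes "\<mu> \<in> partitions n" "\<nu> \<in> partitions n" "dominated \<mu> \<nu>" "dominated \<nu> \<mu>"
  shows "\<mu> = \<nu>"
proof -
  have *: "(\<Sum>k<i. rows \<mu> k) = (\<Sum>k<i. rows \<nu> k)" for i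
    using assms(3)[unfolded dominated_def, rule_format, of i] assms(4)[unfolded dominated_def, rule_format, of i]
    by (rule antisym)
  have "rows \<mu> i = rows \<nu> i" for i
    using *[of i] *[of "Suc i"] by simp
  then have "rows \<mu> = rows \<nu>" by auto
  then show ?thesis by (rule inj_onD[OF bij_betw_imp_inj_on[OF bij_row_lengths] _ assms(1,2)])
qed

lemma card_rows_less: "card {x. x < sum_list \<mu> \<and> row_of \<mu> x < i} = (\<Sum>k<i. rows \<mu> k)"
proof -
  have "bij_betw (\<lambda>x. (row_of \<mu> x, col_of \<mu> x)) {x. x < sum_list \<mu> \<and> row_of \<mu> x < i} (SIGMA k:{..<i}. {..<rows \<mu> k})"
  proof (rule bij_betw_byWitness[where f' = "tableau_entry \<mu>"])
    show "(\<lambda>x. (row_of \<mu> x, col_of \<mu> x)) ` {x. x < sum_list \<mu> \<and> row_of \<mu> x < i} \<subseteq> (SIGMA k:{..<i}. {..<rows \<mu> k})"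
      using row_col_cell by (auto simp: mem_cells_iff)
    show "tableau_entry \<mu> ` (SIGMA k:{..<i}. {..<rows \<mu> k}) \<subseteq> {x. x < sum_list \<mu> \<and> row_of \<mu> x < i}"
      using bij_betw_apply[OF bij_tableau_entry] by (auto simp: row_of_entry simp flip: mem_cells_iff)
    show "\<forall>x\<in>{x. x < sum_list \<mu> \<and> row_of \<mu> x < i}. tableau_entry \<mu> (row_of \<mu> x, col_of \<mu> x) = x"
      by (simp add: entry_row_col)
    show "\<forall>c\<in>SIGMA k:{..<i}. {..<rows \<mu> k}. (row_of \<mu> (tableau_entry \<mu> c), col_of \<mu> (tableau_entry \<mu> c)) = c"
      by (auto simp: row_of_entry col_of_entry simp flip: mem_cells_iff)
  qed
  then have "card {x. x < sum_list \<mu> \<and> row_of \<mu> x < i} = card (SIGMA k:{..<i}. {..<rows \<mu> k})"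
    by (rule bij_betw_same_card)
  then show ?thesis by simp
qed

lemma card_Int_lessThan_le:
  "finite A \<Longrightarrow> card (A \<inter> {..<i}) \<le> card ({..<card A} \<inter> {..<i::nat})"
proof -
  assume A: "finite A"
  have "{..<card A} \<inter> {..<i} = {..<min (card A) i}" by auto
  moreover have "card (A \<inter> {..<i}) \<le> card A" "card (A \<inter> {..<i}) \<le> card {..<i}"
    by (rule card_mono; use A in blast)+
  ultimately show ?thesis by simp
qed

lemma eq_of_card_Int_lessThan:
  fixes A B :: "nat set"
  assumes "\<And>i. card (A \<inter> {..<i}) = card (B \<inter> {..<i})"
  shows "A = B"
proof -
  have "card (S \<inter> {..<Suc i}) = card (S \<inter> {..<i}) + (if i \<in> S then 1 else 0)" for S i
  proof -
    have "S \<inter> {..<Suc i} = (if i \<in> S then insert i (S \<inter> {..<i}) else S \<inter> {..<i})"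
      by (auto simp: lessThan_Suc)
    then show ?thesis by simp
  qed
  then have "i \<in> A \<longleftrightarrow> i \<in> B" for i using assms[of i] assms[of "Suc i"] by (auto split: if_splits)
  then show ?thesis by blast
qed

lemma rows_in_column:
  assumes "\<nu> \<in> partitions n"
  shows "row_of \<nu> ` {y. y < n \<and> col_of \<nu> y = j} = {..<card {y. y < n \<and> col_of \<nu> y = j}}"
proof -
  let ?S = "{y. y < n \<and> col_of \<nu> y = j}"
  have inj: "inj_on (row_of \<nu>) ?S" using row_col_inject[of _ \<nu>] sum_list_part[OF assms] by (auto simp: inj_on_def)
  have an: "antimono (rows \<nu>)" using rows_in_diagrams[OF assms] unfolding diagrams_def by blast
  have "row_of \<nu> ` ?S = {..<card (row_of \<nu> ` ?S)}"
  proof (rule down_closed_eq_lessThan)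
    fix i k assume "i \<in> row_of \<nu> ` ?S" and k: "k < i"
    then obtain y where y: "y < n" "col_of \<nu> y = j" "row_of \<nu> y = i" by auto
    then have "j < rows \<nu> i" using row_col_cell[of y \<nu>] sum_list_part[OF assms] by (simp add: mem_cells_iff)
    also have "rows \<nu> i \<le> rows \<nu> k"
      using antimonoD[OF an] k by simp
    finally have c: "(k, j) \<in> cells \<nu>" by (simp add: mem_cells_iff)
    show "k \<in> row_of \<nu> ` ?S"
      using row_of_entry[OF c] col_of_entry[OF c] bij_betw_apply[OF bij_tableau_entry c] sum_list_part[OF assms]
      by (intro image_eqI[of _ _ "tableau_entry \<nu> (k, j)"]) auto
  qed simp
  then show ?thesis by (simp add: card_image[OF inj])
qed

lemma sum_rows_by_columns:
  assumes \<mu>: "\<mu> \<in> partitions n" and J: "f ` {..<n} \<subseteq> J" "finite J"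
    and inj: "\<And>j. inj_on (row_of \<mu>) {x. x < n \<and> f x = j}"
  shows "(\<Sum>k<i. rows \<mu> k) = (\<Sum>j\<in>J. card (row_of \<mu> ` {x. x < n \<and> f x = j} \<inter> {..<i}))"
proof -
  let ?S = "{x. x < n \<and> row_of \<mu> x < i}"
  have "(\<Sum>k<i. rows \<mu> k) = (\<Sum>x\<in>?S. 1)" using card_rows_less[of \<mu> i] sum_list_part[OF \<mu>] by simp
  also have "\<dots> = (\<Sum>j\<in>J. \<Sum>x\<in>{x\<in>?S. f x = j}. 1)"
    using J by (intro sum.group[symmetric]) auto
  also have "\<dots> = (\<Sum>j\<in>J. card (row_of \<mu> ` {x. x < n \<and> f x = j} \<inter> {..<i}))"
  proof (rule sum.cong[OF refl], goal_cases)
    case (1 j)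
    have "row_of \<mu> ` {x. x < n \<and> f x = j} \<inter> {..<i} = row_of \<mu> ` {x\<in>?S. f x = j}" by auto
    moreover have "inj_on (row_of \<mu>) {x\<in>?S. f x = j}" by (rule inj_on_subset[OF inj[of j]]) auto
    ultimately show ?case by (simp add: card_image)
  qed
  finally show ?thesis .
qed

text \<open>
  The cells \<open>(row\<^sub>\<mu> x, col\<^sub>\<nu> (\<tau> x))\<close> are pairwise distinct. Pushing each column of this
  set of cells to the top turns it into the diagram of \<open>\<nu>\<close>, so the first \<open>i\<close> rows can
  only gain cells.
\<close>

lemma row_column_count:
  assumes \<mu>: "\<mu> \<in> partitions n" and \<nu>: "\<nu> \<in> partitions n" and \<tau>: "\<tau> permutes {..<n}"
    and inj: "\<And>x y. x < n \<Longrightarrow> y < n \<Longrightarrow> row_of \<mu> x = row_of \<mu> y \<Longrightarrow> col_of \<nu> (\<tau> x) = col_of \<nu> (\<tau> y) \<Longrightarrow> x = y"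
  shows "dominated \<mu> \<nu>"
    and "\<mu> = \<nu> \<Longrightarrow> row_of \<mu> ` {x. x < n \<and> col_of \<nu> (\<tau> x) = j} = row_of \<mu> ` {y. y < n \<and> col_of \<nu> y = j}"
proof -
  define A where "A j = row_of \<mu> ` {x. x < n \<and> col_of \<nu> (\<tau> x) = j}" for j
  define B where "B j = row_of \<nu> ` {y. y < n \<and> col_of \<nu> y = j}" for j
  let ?J = "col_of \<nu> ` {..<n}"
  have finA: "finite (A j)" for j by (simp add: A_def)
  have iA: "inj_on (row_of \<mu>) {x. x < n \<and> col_of \<nu> (\<tau> x) = j}" for j
    using inj by (auto simp: inj_on_def)
  have iB: "inj_on (row_of \<nu>) {y. y < n \<and> col_of \<nu> y = j}" for j
    using row_col_inject[of _ \<nu>] sum_list_part[OF \<nu>] by (auto simp: inj_on_def)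
  have "\<tau> ` {x. x < n \<and> col_of \<nu> (\<tau> x) = j} = {y. y < n \<and> col_of \<nu> y = j}" for j
  proof (intro equalityI subsetI)
    fix y assume "y \<in> {y. y < n \<and> col_of \<nu> y = j}"
    then show "y \<in> \<tau> ` {x. x < n \<and> col_of \<nu> (\<tau> x) = j}"
      using permutes_less_iff[OF permutes_inv[OF \<tau>], of y] permutes_inverses(1)[OF \<tau>, of y]
      by (intro image_eqI[of _ _ "inv \<tau> y"]) auto
  qed (use permutes_less_iff[OF \<tau>] in auto)
  then have cAB: "card (A j) = card {y. y < n \<and> col_of \<nu> y = j}" for j
    unfolding A_def card_image[OF iA]
    using card_image[OF inj_on_subset[OF permutes_inj[OF \<tau>] subset_UNIV], of "{x. x < n \<and> col_of \<nu> (\<tau> x) = j}"]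
    by simp
  have B: "B j = {..<card (A j)}" for j
    unfolding B_def cAB by (rule rows_in_column[OF \<nu>])
  have le: "card (A j \<inter> {..<i}) \<le> card (B j \<inter> {..<i})" for i j
    unfolding B by (rule card_Int_lessThan_le[OF finA])
  have sumA: "(\<Sum>k<i. rows \<mu> k) = (\<Sum>j\<in>?J. card (A j \<inter> {..<i}))" for i
    unfolding A_def using permutes_less_iff[OF \<tau>] by (intro sum_rows_by_columns[OF \<mu>] iA) auto
  have sumB: "(\<Sum>k<i. rows \<nu> k) = (\<Sum>j\<in>?J. card (B j \<inter> {..<i}))" for i
    unfolding B_def by (intro sum_rows_by_columns[OF \<nu>] iB) auto
  show "dominated \<mu> \<nu>"
    unfolding dominated_def sumA sumB by (intro allI sum_mono le)
  show "row_of \<mu> ` {x. x < n \<and> col_of \<nu> (\<tau> x) = j} = row_of \<mu> ` {y. y < n \<and> col_of \<nu> y = j}" if eq: "\<mu> = \<nu>"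
  proof (cases "j \<in> ?J")
    case True
    \<comment> \<open>The totals agree now, so the inequality \<open>le\<close> is an equality in
      each column separately.\<close>
    have "card (A j \<inter> {..<i}) = card (B j \<inter> {..<i})" for i
    proof (rule sum_mono_inv[of "\<lambda>j. card (A j \<inter> {..<i})" ?J "\<lambda>j. card (B j \<inter> {..<i})"])
      show "(\<Sum>j\<in>?J. card (A j \<inter> {..<i})) = (\<Sum>j\<in>?J. card (B j \<inter> {..<i}))"
        using sumA[of i] sumB[of i] eq by simp
    qed (use le True in auto)
    then have "A j = B j" by (rule eq_of_card_Int_lessThan)
    then show ?thesis by (simp add: A_def B_def eq)
  next
    case False
    then have "{y. y < n \<and> col_of \<nu> y = j} = {}" by auto
    moreover have "{x. x < n \<and> col_of \<nu> (\<tau> x) = j} = {}" using False permutes_less_iff[OF \<tau>] by auto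
    ultimately show ?thesis by (simp only: image_empty)
  qed
qed

text \<open>By the equality case of the column count, each row can be rearranged so that its entries
  reach the columns prescribed by \<open>inv \<sigma>\<close>. If \<open>p\<close> is this
  rearrangement, \<open>p \<circ> \<sigma>\<close> preserves columns, and \<open>inv p\<close> is
  the row factor.\<close>

lemma row_column_factorization:
  assumes \<mu>: "\<mu> \<in> partitions n" and \<sigma>: "\<sigma> permutes {..<n}"
    and inj: "\<And>x y. x < n \<Longrightarrow> y < n \<Longrightarrow> row_of \<mu> x = row_of \<mu> y \<Longrightarrow> col_of \<mu> (inv \<sigma> x) = col_of \<mu> (inv \<sigma> y) \<Longrightarrow> x = y"
  obtains p q where "p \<in> row_stabilizer \<mu>" "q \<in> column_stabilizer \<mu>" "\<sigma> = p \<circ> q"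
proof -
  let ?\<tau> = "inv \<sigma>"
  have \<tau>: "?\<tau> permutes {..<n}" by (rule permutes_inv[OF \<sigma>])
  have "\<exists>y. y < n \<and> row_of \<mu> y = row_of \<mu> x \<and> col_of \<mu> y = col_of \<mu> (?\<tau> x)" if "x < n" for x
  proof -
    have eq: "row_of \<mu> ` {x'. x' < n \<and> col_of \<mu> (?\<tau> x') = col_of \<mu> (?\<tau> x)} =
        row_of \<mu> ` {y. y < n \<and> col_of \<mu> y = col_of \<mu> (?\<tau> x)}"
      by (rule row_column_count(2)[OF \<mu> \<mu> \<tau> _ refl]) (fact inj)
    have "row_of \<mu> x \<in> row_of \<mu> ` {x'. x' < n \<and> col_of \<mu> (?\<tau> x') = col_of \<mu> (?\<tau> x)}" using that by auto
    then have "row_of \<mu> x \<in> row_of \<mu> ` {y. y < n \<and> col_of \<mu> y = col_of \<mu> (?\<tau> x)}"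
      unfolding eq .
    then show ?thesis by (auto simp only: image_iff mem_Collect_eq)
  qed
  then have "\<exists>e. \<forall>x<n. e x < n \<and> row_of \<mu> (e x) = row_of \<mu> x \<and> col_of \<mu> (e x) = col_of \<mu> (?\<tau> x)"
    by (intro choice) blast
  then obtain e where e: "e x < n" "row_of \<mu> (e x) = row_of \<mu> x" "col_of \<mu> (e x) = col_of \<mu> (?\<tau> x)"
    if "x < n" for x by blast
  define p where "p x = (if x < n then e x else x)" for x
  have "inj_on e {..<n}"
  proof (rule inj_onI)
    fix x y assume xy: "x \<in> {..<n}" "y \<in> {..<n}" "e x = e y"
    then have "row_of \<mu> x = row_of \<mu> y" "col_of \<mu> (?\<tau> x) = col_of \<mu> (?\<tau> y)"
      using e(2,3)[of x] e(2,3)[of y] by simp_all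
    then show "x = y" using inj xy(1,2) by simp
  qed
  moreover have "e ` {..<n} \<subseteq> {..<n}" using e by auto
  ultimately have "bij_betw e {..<n} {..<n}" by (simp add: bij_betw_def endo_inj_surj)
  then have "bij_betw p {..<n} {..<n}" by (subst bij_betw_cong[of _ _ e]) (auto simp: p_def)
  then have p: "p permutes {..<n}" by (rule bij_imp_permutes) (simp add: p_def)
  have pR: "p \<in> row_stabilizer \<mu>" using p e sum_list_part[OF \<mu>] by (simp add: row_stab_iff p_def)
  have q: "p \<circ> \<sigma> permutes {..<n}" using permutes_compose[OF \<sigma> p] .
  have "p \<circ> \<sigma> \<in> column_stabilizer \<mu>"
    using q sum_list_part[OF \<mu>] e permutes_less_iff[OF \<sigma>] permutes_inverses(2)[OF \<sigma>]
    by (simp add: col_stab_iff p_def)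
  moreover have "\<sigma> = inv p \<circ> (p \<circ> \<sigma>)" using permutes_inv_o(2)[OF p] by (simp add: o_assoc)
  ultimately show ?thesis using that row_stab_inv[OF pR] by blast
qed

section \<open>Functions with the symmetries of a Young symmetrizer\<close>

lemma transpose_row_stabilizer:
  assumes "x < sum_list \<mu>" "y < sum_list \<mu>" "row_of \<mu> x = row_of \<mu> y"
  shows "transpose x y \<in> row_stabilizer \<mu>"
  unfolding row_stab_iff
proof
  show "transpose x y permutes {..<sum_list \<mu>}" using assms(1,2) by (intro permutes_swap_id) simp_all
  show "\<forall>z<sum_list \<mu>. row_of \<mu> (transpose x y z) = row_of \<mu> z"
    using assms(3) by (metis transpose_apply_first transpose_apply_second transpose_apply_other)
qed

lemma transpose_column_stabilizer:
  assumes "x < sum_list \<mu>" "y < sum_list \<mu>" "col_of \<mu> x = col_of \<mu> y"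
  shows "transpose x y \<in> column_stabilizer \<mu>"
  unfolding col_stab_iff
proof
  show "transpose x y permutes {..<sum_list \<mu>}" using assms(1,2) by (intro permutes_swap_id) simp_all
  show "\<forall>z<sum_list \<mu>. col_of \<mu> (transpose x y z) = col_of \<mu> z"
    using assms(3) by (metis transpose_apply_first transpose_apply_second transpose_apply_other)
qed

text \<open>Otherwise the transposition of \<open>x\<close> and \<open>y\<close> preserves the rows,
  and carried through \<sigma> it becomes a transposition preserving the columns. The first leaves
  \<open>z \<sigma>\<close> unchanged, the second reverses its sign.\<close>

lemma semi_invariant_dichotomy:
  fixes z :: "(nat \<Rightarrow> nat) \<Rightarrow> complex"
  assumes \<mu>: "\<mu> \<in> partitions n" and \<nu>: "\<nu> \<in> partitions n" and \<sigma>: "\<sigma> permutes {..<n}"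
    and zl: "\<And>p. p \<in> row_stabilizer \<mu> \<Longrightarrow> z (p \<circ> \<sigma>) = z \<sigma>"
    and zr: "\<And>q. q \<in> column_stabilizer \<nu> \<Longrightarrow> z (\<sigma> \<circ> q) = of_int (sign q) * z \<sigma>"
    and nz: "z \<sigma> \<noteq> 0"
  shows "x < n \<Longrightarrow> y < n \<Longrightarrow> row_of \<mu> x = row_of \<mu> y \<Longrightarrow> col_of \<nu> (inv \<sigma> x) = col_of \<nu> (inv \<sigma> y) \<Longrightarrow> x = y"
proof (rule ccontr)
  assume xy: "x < n" "y < n" "row_of \<mu> x = row_of \<mu> y" "col_of \<nu> (inv \<sigma> x) = col_of \<nu> (inv \<sigma> y)" "x \<noteq> y"
  let ?t = "transpose x y" and ?q = "transpose (inv \<sigma> x) (inv \<sigma> y)"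
  have t: "?t \<in> row_stabilizer \<mu>"
    by (rule transpose_row_stabilizer) (unfold sum_list_part[OF \<mu>], fact xy(1), fact xy(2), fact xy(3))
  have q: "?q \<in> column_stabilizer \<nu>"
    by (rule transpose_column_stabilizer)
       (unfold sum_list_part[OF \<nu>] permutes_less_iff[OF permutes_inv[OF \<sigma>]], fact xy(1), fact xy(2), fact xy(4))
  have ne: "inv \<sigma> x \<noteq> inv \<sigma> y" using xy(5) injD[OF permutes_inj[OF permutes_inv[OF \<sigma>]]] by blast
  have "?t \<circ> \<sigma> = \<sigma> \<circ> ?q"
  proof
    fix w
    show "(?t \<circ> \<sigma>) w = (\<sigma> \<circ> ?q) w"
      using permutes_inverses[OF \<sigma>] by (auto simp: transpose_def)
  qed
  then have "z \<sigma> = - z \<sigma>" using zl[OF t] zr[OF q] ne by (simp add: sign_swap_id)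
  then show False using nz by simp
qed

lemma semi_invariant_eq_0:
  fixes z :: "(nat \<Rightarrow> nat) \<Rightarrow> complex"
  assumes "\<mu> \<in> partitions n" "\<nu> \<in> partitions n" "\<sigma> permutes {..<n}" "\<not> dominated \<mu> \<nu>"
    and "\<And>p. p \<in> row_stabilizer \<mu> \<Longrightarrow> z (p \<circ> \<sigma>) = z \<sigma>"
    and "\<And>q. q \<in> column_stabilizer \<nu> \<Longrightarrow> z (\<sigma> \<circ> q) = of_int (sign q) * z \<sigma>"
  shows "z \<sigma> = 0"
  using semi_invariant_dichotomy[where z = z and \<sigma> = \<sigma>, OF assms(1-3,5,6)]
    row_column_count(1)[OF assms(1,2) permutes_inv[OF assms(3)]] assms(4)
  by metis

lemma comp_left_cancel: "inj p \<Longrightarrow> p \<circ> f = p \<circ> g \<longleftrightarrow> f = g"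
  by (simp add: fun_eq_iff inj_eq)

lemma comp_right_cancel: "surj p \<Longrightarrow> f \<circ> p = g \<circ> p \<longleftrightarrow> f = g"
  by (auto simp: fun_eq_iff) (metis surjD)

lemma ysym_left:
  assumes p: "p \<in> row_stabilizer \<mu>"
  shows "young_symmetrizer \<mu> (p \<circ> \<sigma>) = young_symmetrizer \<mu> \<sigma>"
proof -
  note perm = row_stab_permutes[OF p]
  have "young_symmetrizer \<mu> (p \<circ> \<sigma>) = (\<Sum>p'\<in>row_stabilizer \<mu>. \<Sum>q\<in>column_stabilizer \<mu>.
      if (p \<circ> p') \<circ> q = p \<circ> \<sigma> then of_int (sign q) else 0)"
    unfolding young_symmetrizer_def
    by (rule sum.reindex_bij_witness[where i = "\<lambda>p'. p \<circ> p'" and j = "\<lambda>p'. inv p \<circ> p'"])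
       (simp_all add: o_assoc permutes_inv_o[OF perm] p row_stab_comp row_stab_inv)
  also have "\<dots> = young_symmetrizer \<mu> \<sigma>"
    unfolding young_symmetrizer_def comp_assoc comp_left_cancel[OF permutes_inj[OF perm]] ..
  finally show ?thesis .
qed

lemma ysym_right:
  assumes q: "q \<in> column_stabilizer \<mu>"
  shows "young_symmetrizer \<mu> (\<sigma> \<circ> q) = of_int (sign q) * young_symmetrizer \<mu> \<sigma>"
proof -
  note perm = col_stab_permutes[OF q]
  have s: "sign (q' \<circ> q) = sign q * sign q'" if "q' \<in> column_stabilizer \<mu>" for q'
    using permutes_imp_permutation[OF finite_lessThan perm]
      permutes_imp_permutation[OF finite_lessThan col_stab_permutes[OF that]]
    by (simp add: sign_compose mult.commute)
  have "(\<Sum>q'\<in>column_stabilizer \<mu>. if p \<circ> q' = \<sigma> \<circ> q then of_int (sign q') else (0::complex)) =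
      of_int (sign q) * (\<Sum>q'\<in>column_stabilizer \<mu>. if p \<circ> q' = \<sigma> then of_int (sign q') else 0)" for p
  proof -
    have "(\<Sum>q'\<in>column_stabilizer \<mu>. if p \<circ> q' = \<sigma> \<circ> q then of_int (sign q') else (0::complex)) =
        (\<Sum>q'\<in>column_stabilizer \<mu>. if p \<circ> (q' \<circ> q) = \<sigma> \<circ> q then of_int (sign (q' \<circ> q)) else 0)"
      by (rule sum.reindex_bij_witness[where i = "\<lambda>q'. q' \<circ> q" and j = "\<lambda>q'. q' \<circ> inv q"])
         (simp_all add: comp_assoc permutes_inv_o[OF perm] q col_stab_comp col_stab_inv)
    then show ?thesis
      unfolding sum_distrib_left
      by (simp add: o_assoc comp_right_cancel[OF permutes_surj[OF perm]]) (intro sum.cong refl, simp add: s)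
  qed
  then show ?thesis unfolding young_symmetrizer_def by (simp add: sum_distrib_left)
qed

text \<open>Only \<open>id\<close> preserves both rows and columns, so
  \<open>p \<circ> q = id\<close> has a single solution. This normalizes everything that is read off
  at the identity.\<close>

lemma ysym_id: "young_symmetrizer \<mu> id = 1"
proof -
  have "p \<circ> q = id \<longleftrightarrow> p = id \<and> q = id" if p: "p \<in> row_stabilizer \<mu>" and q: "q \<in> column_stabilizer \<mu>" for p q
  proof
    assume pq: "p \<circ> q = id"
    have "inv p \<circ> (p \<circ> q) = q"
      by (simp add: o_assoc permutes_inv_o(2)[OF row_stab_permutes[OF p]])
    then have "q = inv p" unfolding pq by simp
    then have "q = id" using row_stab_inv[OF p] q by (intro row_column_stabilizer_trivial) simp_all
    then show "p = id \<and> q = id" using pq by simp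
  qed simp
  then have *: "(if p \<circ> q = id then of_int (sign q) else 0) = (if p = id then (if q = id then of_int (sign q) else 0) else (0::complex))"
    if "p \<in> row_stabilizer \<mu>" "q \<in> column_stabilizer \<mu>" for p q using that by simp
  have "young_symmetrizer \<mu> id =
      (\<Sum>p\<in>row_stabilizer \<mu>. \<Sum>q\<in>column_stabilizer \<mu>. if p = id then (if q = id then of_int (sign q) else 0) else 0)"
    unfolding young_symmetrizer_def by (intro sum.cong refl *)
  also have "\<dots> = (\<Sum>p\<in>row_stabilizer \<mu>. if p = id then (\<Sum>q\<in>column_stabilizer \<mu>. (if q = id then of_int (sign q) else 0)) else 0)"
    by (intro sum.cong refl) auto
  also have "\<dots> = 1"
    by (simp add: finite_row_stabilizer finite_column_stabilizer id_row_stabilizer id_column_stabilizer)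
  finally show ?thesis .
qed

lemma ysym_not_permutes:
  assumes "\<not> \<sigma> permutes {..<sum_list \<mu>}"
  shows "young_symmetrizer \<mu> \<sigma> = 0"
proof -
  have "p \<circ> q \<noteq> \<sigma>" if "p \<in> row_stabilizer \<mu>" "q \<in> column_stabilizer \<mu>" for p q
    using assms permutes_compose[OF col_stab_permutes[OF that(2)] row_stab_permutes[OF that(1)]] by metis
  then show ?thesis by (simp add: young_symmetrizer_def)
qed

lemma ysym_real: "young_symmetrizer \<mu> \<sigma> \<in> \<real>"
  unfolding young_symmetrizer_def by (intro sum_in_Reals) auto

text \<open>Von Neumann's lemma: the functions with both symmetries form a line. Where either of the
  two functions is nonzero, \<sigma> factors as \<open>p \<circ> q\<close>, and then both are
  determined by the sign of \<open>q\<close> and the value at \<open>id\<close>.\<close>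

lemma semi_invariant_eq_scalar:
  fixes z :: "(nat \<Rightarrow> nat) \<Rightarrow> complex"
  assumes \<mu>: "\<mu> \<in> partitions n" and \<sigma>: "\<sigma> permutes {..<n}"
    and zl: "\<And>p \<sigma>. p \<in> row_stabilizer \<mu> \<Longrightarrow> \<sigma> permutes {..<n} \<Longrightarrow> z (p \<circ> \<sigma>) = z \<sigma>"
    and zr: "\<And>q \<sigma>. q \<in> column_stabilizer \<mu> \<Longrightarrow> \<sigma> permutes {..<n} \<Longrightarrow> z (\<sigma> \<circ> q) = of_int (sign q) * z \<sigma>"
  shows "z \<sigma> = z id * young_symmetrizer \<mu> \<sigma>"
proof (cases "z \<sigma> = 0 \<and> young_symmetrizer \<mu> \<sigma> = 0")
  case False
  have "x = y" if "x < n" "y < n" "row_of \<mu> x = row_of \<mu> y" "col_of \<mu> (inv \<sigma> x) = col_of \<mu> (inv \<sigma> y)" for x y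
  proof (cases "z \<sigma> = 0")
    case True
    then have "young_symmetrizer \<mu> \<sigma> \<noteq> 0" using False by simp
    then show ?thesis
      using semi_invariant_dichotomy[where z = "young_symmetrizer \<mu>", OF \<mu> \<mu> \<sigma> ysym_left ysym_right _ that]
      by blast
  next
    case False
    then show ?thesis
      using semi_invariant_dichotomy[where z = z, OF \<mu> \<mu> \<sigma> zl[OF _ \<sigma>] zr[OF _ \<sigma>] _ that] by blast
  qed
  then obtain p q where pq: "p \<in> row_stabilizer \<mu>" "q \<in> column_stabilizer \<mu>" "\<sigma> = p \<circ> q"
    using row_column_factorization[OF \<mu> \<sigma>] by blast
  have q: "q permutes {..<n}" using col_stab_permutes[OF pq(2)] sum_list_part[OF \<mu>] by simp
  have "z \<sigma> = z (id \<circ> q)" using pq zl[OF pq(1) q] by simp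
  also have "\<dots> = of_int (sign q) * z id" using zr[OF pq(2), of id] by (simp add: permutes_id)
  finally have 1: "z \<sigma> = of_int (sign q) * z id" .
  have "young_symmetrizer \<mu> \<sigma> = young_symmetrizer \<mu> (id \<circ> q)"
    using pq ysym_left[OF pq(1), of q] by simp
  also have "\<dots> = of_int (sign q)" using ysym_right[OF pq(2), of id] by (simp add: ysym_id)
  finally show ?thesis using 1 by (simp add: mult.commute)
qed simp

section \<open>The group algebra and the irreducible characters\<close>

lemma perms_comp: "p \<in> perms n \<Longrightarrow> q \<in> perms n \<Longrightarrow> p \<circ> q \<in> perms n"
  by (simp add: permutes_compose)

lemma perms_inv: "p \<in> perms n \<Longrightarrow> inv p \<in> perms n"
  by (simp add: permutes_inv)

lemma perms_id: "id \<in> perms n"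
  by (simp add: permutes_id)

lemma finite_perms: "finite (perms n)"
  by (simp add: finite_permutations)

lemma card_perms: "card (perms n) = fact n"
  by (simp add: card_permutations)

lemma perms_cancel:
  assumes "p \<in> perms n"
  shows "inv p \<circ> (p \<circ> s) = s" "p \<circ> (inv p \<circ> s) = s" "inv p \<circ> p = id" "p \<circ> inv p = id" "inv (inv p) = p"
proof -
  have p: "p permutes {..<n}" using assms by simp
  show 1: "inv p \<circ> p = id" "p \<circ> inv p = id" using permutes_inv_o[OF p] by simp_all
  show "inv p \<circ> (p \<circ> s) = s" "p \<circ> (inv p \<circ> s) = s" by (simp_all add: o_assoc 1)
  show "inv (inv p) = p" by (rule permutes_inv_inv[OF p])
qed

lemma perms_inv_comp:
  assumes "p \<in> perms n" "q \<in> perms n"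
  shows "inv (p \<circ> q) = inv q \<circ> inv p"
  using assms by (intro o_inv_distrib) (auto intro: permutes_bij)

lemma perms_inv_conj:
  assumes h: "h \<in> perms n" and g: "g \<in> perms n"
  shows "inv (h \<circ> g \<circ> inv h) = h \<circ> inv g \<circ> inv h"
proof -
  have "inv (h \<circ> g \<circ> inv h) = inv (inv h) \<circ> inv (h \<circ> g)"
    by (rule perms_inv_comp[OF perms_comp[OF h g] perms_inv[OF h]])
  then show ?thesis by (simp only: perms_inv_comp[OF h g] perms_cancel(5)[OF h] comp_assoc)
qed

lemma perms_mono: "perms n \<subseteq> perms (Suc n)"
  by (auto intro: permutes_subset)

lemma sum_perms_left:
  assumes "h \<in> perms n"
  shows "(\<Sum>p\<in>perms n. f (h \<circ> p)) = (\<Sum>p\<in>perms n. f p)"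
  by (rule sum.reindex_bij_witness[where i = "\<lambda>p. inv h \<circ> p" and j = "\<lambda>p. h \<circ> p"])
     (use assms perms_comp perms_inv perms_cancel in \<open>blast+\<close>)

lemma sum_perms_right:
  assumes "h \<in> perms n"
  shows "(\<Sum>p\<in>perms n. f (p \<circ> h)) = (\<Sum>p\<in>perms n. f p)"
proof (rule sum.reindex_bij_witness[where i = "\<lambda>p. p \<circ> inv h" and j = "\<lambda>p. p \<circ> h"])
  fix p assume "p \<in> perms n"
  then show "p \<circ> h \<in> perms n" "p \<circ> inv h \<in> perms n" using assms perms_comp perms_inv by blast+
  show "p \<circ> h \<circ> inv h = p" "p \<circ> inv h \<circ> h = p" by (simp_all add: comp_assoc perms_cancel[OF assms])
qed simp

lemma sum_perms_inv: "(\<Sum>p\<in>perms n. f (inv p)) = (\<Sum>p\<in>perms n. f p)"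
  by (rule sum.reindex_bij_witness[where i = inv and j = inv])
     (use perms_inv perms_cancel in \<open>blast+\<close>)

lemma sum_perms_conj:
  assumes "h \<in> perms n"
  shows "(\<Sum>p\<in>perms n. f (h \<circ> p \<circ> inv h)) = (\<Sum>p\<in>perms n. f p)"
  using sum_perms_left[OF assms, of "\<lambda>p. f (p \<circ> inv h)"] sum_perms_right[OF perms_inv[OF assms], of f]
  by simp

section \<open>Convolution, class functions and the trace formula\<close>

definition conv :: "nat \<Rightarrow> ((nat \<Rightarrow> nat) \<Rightarrow> complex) \<Rightarrow> ((nat \<Rightarrow> nat) \<Rightarrow> complex) \<Rightarrow> (nat \<Rightarrow> nat) \<Rightarrow> complex" where
  "conv n f g \<sigma> = (\<Sum>p\<in>perms n. f p * g (inv p \<circ> \<sigma>))"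

definition conj_sum :: "nat \<Rightarrow> ((nat \<Rightarrow> nat) \<Rightarrow> complex) \<Rightarrow> (nat \<Rightarrow> nat) \<Rightarrow> complex" where
  "conj_sum n f g = (\<Sum>h\<in>perms n. f (h \<circ> g \<circ> inv h))"

definition class_fun :: "nat \<Rightarrow> ((nat \<Rightarrow> nat) \<Rightarrow> complex) \<Rightarrow> bool" where
  "class_fun n f \<longleftrightarrow> (\<forall>h\<in>perms n. \<forall>g\<in>perms n. f (h \<circ> g \<circ> inv h) = f g)"

lemma class_funD: "class_fun n f \<Longrightarrow> h \<in> perms n \<Longrightarrow> g \<in> perms n \<Longrightarrow> f (h \<circ> g \<circ> inv h) = f g"
  by (simp add: class_fun_def)

lemma class_fun_conj_sum: "class_fun n (conj_sum n f)"
  unfolding class_fun_def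
proof (intro ballI)
  fix h g assume h: "h \<in> perms n" and g: "g \<in> perms n"
  have "conj_sum n f (h \<circ> g \<circ> inv h) = (\<Sum>k\<in>perms n. f ((k \<circ> h) \<circ> g \<circ> inv (k \<circ> h)))"
    unfolding conj_sum_def by (intro sum.cong refl) (simp add: perms_inv_comp[OF _ h] comp_assoc)
  also have "\<dots> = conj_sum n f g"
    unfolding conj_sum_def by (rule sum_perms_right[OF h, of "\<lambda>k. f (k \<circ> g \<circ> inv k)"])
  finally show "conj_sum n f (h \<circ> g \<circ> inv h) = conj_sum n f g" .
qed

text \<open>Conjugation changes neither \<psi> nor the range of summation, so all n! terms of
  \<open>conj_sum\<close> contribute the same.\<close>

lemma sum_conj_sum_mult:
  assumes "class_fun n \<psi>"
  shows "(\<Sum>g\<in>perms n. conj_sum n f g * \<psi> g) = fact n * (\<Sum>g\<in>perms n. f g * \<psi> g)"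
proof -
  have "(\<Sum>g\<in>perms n. conj_sum n f g * \<psi> g) = (\<Sum>h\<in>perms n. \<Sum>g\<in>perms n. f (h \<circ> g \<circ> inv h) * \<psi> (h \<circ> g \<circ> inv h))"
    unfolding conj_sum_def sum_distrib_right
    by (rule trans[OF sum.swap]) (intro sum.cong refl, simp only: class_funD[OF assms])
  also have "\<dots> = (\<Sum>h\<in>perms n. \<Sum>g\<in>perms n. f g * \<psi> g)"
    by (rule sum.cong[OF refl]) (rule sum_perms_conj[where f = "\<lambda>g. f g * \<psi> g"])
  also have "\<dots> = fact n * (\<Sum>g\<in>perms n. f g * \<psi> g)" by (simp add: card_perms)
  finally show ?thesis .
qed

lemma perms_comp_iff:
  assumes "p \<in> perms n"
  shows "inv p \<circ> \<sigma> \<in> perms n \<longleftrightarrow> \<sigma> \<in> perms n"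
  using perms_comp[OF assms, of "inv p \<circ> \<sigma>"] perms_comp[OF perms_inv[OF assms], of \<sigma>] perms_cancel(2)[OF assms, of \<sigma>]
  by auto

context
  fixes \<mu> :: "nat list" and n :: nat and c :: "(nat \<Rightarrow> nat) \<Rightarrow> complex"
  assumes \<mu>: "\<mu> \<in> partitions n"
  defines "c \<equiv> young_symmetrizer \<mu>"
begin

lemma ys_row_perms: "p \<in> row_stabilizer \<mu> \<Longrightarrow> p \<in> perms n"
  and ys_column_perms: "p \<in> column_stabilizer \<mu> \<Longrightarrow> p \<in> perms n"
  using row_stab_permutes[of p \<mu>] col_stab_permutes[of p \<mu>] sum_list_part[OF \<mu>] by simp_all

lemma conv_ys_left:
  assumes p: "p \<in> row_stabilizer \<mu>"
  shows "conv n c f (p \<circ> \<sigma>) = conv n c f \<sigma>"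
proof -
  have p': "p \<in> perms n" using ys_row_perms[OF p] .
  have "conv n c f (p \<circ> \<sigma>) = (\<Sum>g\<in>perms n. c (p \<circ> g) * f (inv (p \<circ> g) \<circ> (p \<circ> \<sigma>)))"
    unfolding conv_def by (rule sum_perms_left[OF p', symmetric])
  also have "\<dots> = conv n c f \<sigma>"
    unfolding conv_def c_def
    by (intro sum.cong refl)
       (simp only: ysym_left[OF p] perms_inv_comp[OF p'] comp_assoc perms_cancel[OF p'])
  finally show ?thesis .
qed

lemma conv_ys_right: "q \<in> column_stabilizer \<mu> \<Longrightarrow> conv n f c (\<sigma> \<circ> q) = of_int (sign q) * conv n f c \<sigma>"
  unfolding conv_def c_def sum_distrib_left
  by (intro sum.cong refl) (simp add: o_assoc ysym_right mult.left_commute)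

lemma ys_eq_0: "\<sigma> \<notin> perms n \<Longrightarrow> c \<sigma> = 0"
  using ysym_not_permutes[of \<sigma> \<mu>] sum_list_part[OF \<mu>] by (simp add: c_def)

lemma conv_ys_ys: "conv n c c \<sigma> = conv n c c id * c \<sigma>"
proof (cases "\<sigma> \<in> perms n")
  case True
  show ?thesis unfolding c_def
    by (rule semi_invariant_eq_scalar[OF \<mu>])
       (use True in simp, erule conv_ys_left[unfolded c_def], erule conv_ys_right[unfolded c_def])
next
  case False
  have "c (inv p \<circ> \<sigma>) = 0" if "p \<in> perms n" for p
    by (rule ys_eq_0) (use False perms_comp_iff[OF that] in blast)
  then have "conv n c c \<sigma> = 0" by (simp add: conv_def)
  then show ?thesis using ys_eq_0[OF False] by simp
qed

text \<open>A class function is central in the group algebra, so its product with \<open>c\<close>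
  keeps the symmetries of \<open>c\<close> on both sides. This stands in for Schur's lemma.\<close>

lemma conv_class_fun_ys:
  assumes \<phi>: "class_fun n \<phi>" and \<sigma>: "\<sigma> \<in> perms n"
  shows "conv n \<phi> c \<sigma> = conv n \<phi> c id * c \<sigma>"
proof -
  have left: "conv n \<phi> c (q \<circ> \<sigma>) = conv n \<phi> c \<sigma>" if q: "q \<in> row_stabilizer \<mu>" for q \<sigma>
  proof -
    have q': "q \<in> perms n" using ys_row_perms[OF q] .
    have "conv n \<phi> c (q \<circ> \<sigma>) = (\<Sum>p\<in>perms n. \<phi> (q \<circ> p \<circ> inv q) * c (inv (q \<circ> p \<circ> inv q) \<circ> (q \<circ> \<sigma>)))"
      unfolding conv_def by (rule sum_perms_conj[OF q', symmetric])
    also have "\<dots> = (\<Sum>p\<in>perms n. \<phi> p * c (q \<circ> (inv p \<circ> \<sigma>)))"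
    proof (intro sum.cong refl, goal_cases)
      case p: (1 p)
      have "inv (q \<circ> p \<circ> inv q) \<circ> (q \<circ> \<sigma>) = q \<circ> (inv p \<circ> \<sigma>)"
        unfolding perms_inv_conj[OF q' p] by (simp only: comp_assoc perms_cancel[OF q'])
      then show ?case
        by (simp only: class_funD[OF \<phi> q' p])
    qed
    also have "\<dots> = conv n \<phi> c \<sigma>" by (simp only: conv_def c_def ysym_left[OF q])
    finally show ?thesis .
  qed
  show ?thesis unfolding c_def
    by (rule semi_invariant_eq_scalar[OF \<mu>])
       (use \<sigma> in simp, erule left[unfolded c_def], erule conv_ys_right[unfolded c_def])
qed

text \<open>Right multiplication by \<open>c\<close> sends \<open>x\<close> to
  \<open>left_mult x c\<close> and is a multiple of a projection onto the left ideal. The inverse of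
  \<open>g\<close> comes from \<open>left_mult g\<close>, which evaluates at
  \<open>inv g \<circ> \<sigma>\<close>.\<close>

lemma irr_char_trace:
  assumes g: "g \<in> perms n"
  shows "conv n c c id * irr_char \<mu> g = conj_sum n c (inv g)"
proof -
  let ?u = "\<lambda>x. left_mult x c"
  have "(\<Sum>x\<in>perms n. left_mult g (?u x) x) = conv n c c id * trace_on (fvs.span (?u ` perms n)) (left_mult g)"
  proof (rule trace_on_quasi_projection[OF finite_perms])
    show "(\<Sum>x\<in>perms n. fscale (?u y x) (?u x)) = fscale (conv n c c id) (?u y)" if y: "y \<in> perms n" for y
    proof
      fix \<sigma>
      have "(\<Sum>x\<in>perms n. fscale (?u y x) (?u x)) \<sigma> = (\<Sum>x\<in>perms n. c (inv y \<circ> x) * c (inv x \<circ> \<sigma>))"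
        by (simp add: sum_fun_apply fscale_def left_mult_def)
      also have "\<dots> = (\<Sum>x\<in>perms n. c (inv y \<circ> (y \<circ> x)) * c (inv (y \<circ> x) \<circ> \<sigma>))"
        by (rule sum_perms_left[OF y, symmetric])
      also have "\<dots> = conv n c c (inv y \<circ> \<sigma>)"
        unfolding conv_def by (intro sum.cong refl) (simp only: perms_cancel[OF y] perms_inv_comp[OF y] comp_assoc)
      also have "\<dots> = fscale (conv n c c id) (?u y) \<sigma>"
        by (subst conv_ys_ys) (simp add: fscale_def left_mult_def)
      finally show "(\<Sum>x\<in>perms n. fscale (?u y x) (?u x)) \<sigma> = fscale (conv n c c id) (?u y) \<sigma>" .
    qed
    show "left_mult g (f + h) = left_mult g f + left_mult g h" for f h
      by (simp add: left_mult_def plus_fun_def)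
    show "left_mult g (fscale a f) = fscale a (left_mult g f)" for a f
      by (simp add: left_mult_def fscale_def)
    show "left_mult g (?u y) \<in> fvs.span (?u ` perms n)" if y: "y \<in> perms n" for y
    proof -
      have "left_mult g (?u y) = ?u (g \<circ> y)"
        by (simp add: left_mult_def perms_inv_comp[OF g y] comp_assoc)
      then show ?thesis using perms_comp[OF g y] by (auto intro: fvs.span_base)
    qed
  qed
  moreover have "fvs.span (?u ` perms n) = specht_module \<mu>"
    by (simp add: specht_module_def c_def sum_list_part[OF \<mu>])
  moreover have "(\<Sum>x\<in>perms n. left_mult g (?u x) x) = (\<Sum>x\<in>perms n. c (inv x \<circ> inv g \<circ> inv (inv x)))"
    by (intro sum.cong refl) (simp add: left_mult_def comp_assoc perms_cancel[OF _, of _ n])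
  moreover have "\<dots> = conj_sum n c (inv g)"
    unfolding conj_sum_def by (rule sum_perms_inv[of "\<lambda>x. c (x \<circ> inv g \<circ> inv x)"])
  ultimately show ?thesis by (simp add: irr_char_def)
qed

text \<open>At the identity every conjugate contributes \<open>c id = 1\<close>, so the scalar times
  the dimension is n!. In particular the scalar is not zero.\<close>

lemma irr_char_degree: "\<exists>d>0. irr_char \<mu> id = of_nat d \<and> conv n c c id * of_nat d = fact n"
proof -
  let ?S = "(\<lambda>g. left_mult g c) ` perms n"
  have "left_mult id c id = 1" by (simp add: left_mult_def c_def ysym_id)
  then have "left_mult id c \<noteq> 0" by (metis zero_fun_apply zero_neq_one)
  then have "\<exists>v\<in>?S. v \<noteq> 0" using perms_id by blast
  then obtain d where d: "trace_on (fvs.span ?S) (\<lambda>f. f) = of_nat d" "d > 0"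
    using trace_on_id[OF finite_imageI[OF finite_perms], of "\<lambda>g. left_mult g c"] by blast
  have "left_mult id = (\<lambda>f. f)" by (simp add: left_mult_def fun_eq_iff)
  then have *: "irr_char \<mu> id = of_nat d"
    using d(1) by (simp add: irr_char_def specht_module_def c_def sum_list_part[OF \<mu>])
  have "conj_sum n c (inv id) = (\<Sum>h\<in>perms n. 1)"
    unfolding conj_sum_def
    by (intro sum.cong refl) (simp add: perms_cancel(4)[of _ n] c_def ysym_id)
  then show ?thesis using irr_char_trace[OF perms_id] * d(2) by (intro exI[of _ d]) (simp add: card_perms)
qed

text \<open>The inverse of \<open>p \<circ> q\<close> is conjugate to
  \<open>inv p \<circ> inv q\<close>, and inversion permutes each stabilizer and preserves signs.
  Hence a character takes the same value at \<open>g\<close> and \<open>inv g\<close>.\<close>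

lemma conj_sum_ys_inv:
  assumes g: "g \<in> perms n"
  shows "conj_sum n c (inv g) = conj_sum n c g"
proof -
  let ?S = "\<lambda>F. \<Sum>p\<in>row_stabilizer \<mu>. \<Sum>q\<in>column_stabilizer \<mu>. of_int (sign q) * F p q"
  \<comment> \<open>\<open>K \<sigma> g\<close> counts the \<open>h\<close> that conjugate
    \<open>g\<close> into \<sigma>.\<close>
  define K :: "(nat \<Rightarrow> nat) \<Rightarrow> (nat \<Rightarrow> nat) \<Rightarrow> complex"
    where "K \<sigma> g = (\<Sum>h\<in>perms n. if \<sigma> = h \<circ> g \<circ> inv h then 1 else 0)" for \<sigma> g
  have E: "conj_sum n c g = ?S (\<lambda>p q. K (p \<circ> q) g)" for g
    unfolding conj_sum_def c_def young_symmetrizer_def K_def sum_distrib_left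
    by (rule trans[OF sum.swap], rule sum.cong[OF refl], rule trans[OF sum.swap], intro sum.cong refl) simp
  have K1: "K (inv \<sigma>) (inv g) = K \<sigma> g" if \<sigma>: "\<sigma> \<in> perms n" for \<sigma>
    unfolding K_def
  proof (intro sum.cong refl, goal_cases)
    case h: (1 h)
    have "inv \<sigma> = h \<circ> inv g \<circ> inv h \<longleftrightarrow> \<sigma> = h \<circ> g \<circ> inv h"
      unfolding perms_inv_conj[OF h g, symmetric]
      using perms_cancel(5)[OF \<sigma>] perms_cancel(5)[OF perms_comp[OF perms_comp[OF h g] perms_inv[OF h]]] by metis
    then show ?case by simp
  qed
  have K2: "K (q \<circ> \<sigma> \<circ> inv q) g = K \<sigma> g" if q: "q \<in> perms n" and g: "g \<in> perms n" for q \<sigma> g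
  proof -
    have "K (q \<circ> \<sigma> \<circ> inv q) g = (\<Sum>h\<in>perms n. if q \<circ> \<sigma> \<circ> inv q = (q \<circ> h) \<circ> g \<circ> inv (q \<circ> h) then 1 else 0)"
      unfolding K_def by (rule sum_perms_left[OF q, symmetric])
    also have "\<dots> = K \<sigma> g" unfolding K_def
    proof (intro sum.cong refl, goal_cases)
      case h: (1 h)
      have "inv q \<circ> (q \<circ> x \<circ> inv q) \<circ> q = x" for x
        by (simp only: comp_assoc perms_cancel[OF q] comp_id)
      then have "q \<circ> \<sigma> \<circ> inv q = q \<circ> (h \<circ> g \<circ> inv h) \<circ> inv q \<longleftrightarrow> \<sigma> = h \<circ> g \<circ> inv h" by metis
      moreover have "(q \<circ> h) \<circ> g \<circ> inv (q \<circ> h) = q \<circ> (h \<circ> g \<circ> inv h) \<circ> inv q"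
        by (simp only: perms_inv_comp[OF q h] comp_assoc)
      ultimately show ?case by simp
    qed
    finally show ?thesis .
  qed
  have "conj_sum n c g = ?S (\<lambda>p q. K (p \<circ> q) g)"
    by (rule E)
  also have "\<dots> = ?S (\<lambda>p q. K (inv p \<circ> inv q) (inv g))"
  proof (intro sum.cong refl)
    fix p q assume p: "p \<in> row_stabilizer \<mu>" and q: "q \<in> column_stabilizer \<mu>"
    note p' = ys_row_perms[OF p] and q' = ys_column_perms[OF q]
    have "K (p \<circ> q) g = K (inv q \<circ> inv p) (inv g)"
      using K1[OF perms_comp[OF p' q']] perms_inv_comp[OF p' q'] by simp
    also have "\<dots> = K (q \<circ> (inv q \<circ> inv p) \<circ> inv q) (inv g)"
      by (rule K2[OF q' perms_inv[OF g], symmetric])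
    also have "q \<circ> (inv q \<circ> inv p) \<circ> inv q = inv p \<circ> inv q" by (simp only: perms_cancel[OF q'])
    finally show "of_int (sign q) * K (p \<circ> q) g = of_int (sign q) * K (inv p \<circ> inv q) (inv g)" by (simp only:)
  qed
  also have "\<dots> = ?S (\<lambda>p q. K (p \<circ> inv q) (inv g))"
    by (rule sum.reindex_bij_witness[where i = inv and j = inv])
       (simp_all only: row_stab_inv perms_cancel(5)[OF ys_row_perms])
  also have "\<dots> = ?S (\<lambda>p q. K (p \<circ> q) (inv g))"
  proof (rule sum.cong[OF refl], goal_cases)
    case (1 p)
    have s: "sign (inv q) = sign q" if "q \<in> column_stabilizer \<mu>" for q
      by (rule sign_inverse[OF permutes_imp_permutation[OF finite_lessThan col_stab_permutes[OF that]]])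
    show ?case
      by (rule sum.reindex_bij_witness[where i = inv and j = inv])
         (simp_all only: col_stab_inv perms_cancel(5)[OF ys_column_perms] s)
  qed
  also have "\<dots> = conj_sum n c (inv g)" by (rule E[symmetric])
  finally show ?thesis by simp
qed

end

section \<open>Orthonormality of the irreducible characters\<close>

definition ys_const :: "nat \<Rightarrow> nat list \<Rightarrow> complex" where
  "ys_const n \<mu> = conv n (young_symmetrizer \<mu>) (young_symmetrizer \<mu>) id"

lemma conv_ys_const:
  "\<mu> \<in> partitions n \<Longrightarrow> conv n (young_symmetrizer \<mu>) (young_symmetrizer \<mu>) \<sigma> = ys_const n \<mu> * young_symmetrizer \<mu> \<sigma>"
  unfolding ys_const_def by (rule conv_ys_ys)

lemma ys_const_nonzero: "\<mu> \<in> partitions n \<Longrightarrow> ys_const n \<mu> \<noteq> 0"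
  using irr_char_degree[of \<mu> n] by (auto simp: ys_const_def)

lemma irr_char_conj_sum:
  assumes "\<mu> \<in> partitions n" "g \<in> perms n"
  shows "irr_char \<mu> g = conj_sum n (young_symmetrizer \<mu>) g / ys_const n \<mu>"
  using irr_char_trace[OF assms] conj_sum_ys_inv[OF assms] ys_const_nonzero[OF assms(1)]
  by (simp add: ys_const_def field_simps)

lemma class_fun_irr_char: 
  assumes \<mu>: "\<mu> \<in> partitions n"
  shows "class_fun n (irr_char \<mu>)"
  unfolding class_fun_def
proof (intro ballI)
  fix h g assume h: "h \<in> perms n" and g: "g \<in> perms n"
  have "h \<circ> g \<circ> inv h \<in> perms n" by (intro perms_comp perms_inv h g)
  then show "irr_char \<mu> (h \<circ> g \<circ> inv h) = irr_char \<mu> g"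
    unfolding irr_char_conj_sum[OF \<mu> g] by (simp only: irr_char_conj_sum[OF \<mu>] class_funD[OF class_fun_conj_sum h g])
qed

lemma irr_char_real:
  assumes \<mu>: "\<mu> \<in> partitions n" and g: "g \<in> perms n"
  shows "irr_char \<mu> g \<in> \<real>"
  unfolding irr_char_conj_sum[OF \<mu> g] conj_sum_def ys_const_def conv_def
  by (intro Reals_divide sum_in_Reals Reals_mult ysym_real)

text \<open>Bilinear rather than hermitian, which makes no difference on characters, as they are
  real.\<close>

definition ip :: "nat \<Rightarrow> ((nat \<Rightarrow> nat) \<Rightarrow> complex) \<Rightarrow> ((nat \<Rightarrow> nat) \<Rightarrow> complex) \<Rightarrow> complex" where
  "ip n \<phi> \<psi> = (\<Sum>g\<in>perms n. \<phi> g * \<psi> g) / fact n"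

lemma ip_commute: "ip n \<phi> \<psi> = ip n \<psi> \<phi>"
  by (simp add: ip_def mult.commute)

lemma ip_cong: "(\<And>g. g \<in> perms n \<Longrightarrow> \<phi> g = \<phi>' g) \<Longrightarrow> ip n \<phi> \<psi> = ip n \<phi>' \<psi>"
  unfolding ip_def by (intro arg_cong2[where f = "(/)"] sum.cong refl) simp

lemma ip_sum: "ip n (\<lambda>g. \<Sum>i\<in>I. a i * \<phi> i g) \<psi> = (\<Sum>i\<in>I. a i * ip n (\<phi> i) \<psi>)"
  unfolding ip_def sum_distrib_right sum_distrib_left sum_divide_distrib
  by (subst sum.swap) (simp add: mult.assoc)

lemma ip_irr_char_left:
  assumes \<mu>: "\<mu> \<in> partitions n" and \<psi>: "class_fun n \<psi>"
  shows "ip n (irr_char \<mu>) \<psi> = (\<Sum>g\<in>perms n. young_symmetrizer \<mu> g * \<psi> g) / ys_const n \<mu>"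
proof -
  have "(\<Sum>g\<in>perms n. irr_char \<mu> g * \<psi> g) = (\<Sum>g\<in>perms n. conj_sum n (young_symmetrizer \<mu>) g * \<psi> g) / ys_const n \<mu>"
    unfolding sum_divide_distrib by (intro sum.cong refl) (simp only: irr_char_conj_sum[OF \<mu>] times_divide_eq_left)
  then show ?thesis by (simp add: ip_def sum_conj_sum_mult[OF \<psi>])
qed

text \<open>The sum over pairs is arranged into coefficients of products of one symmetrizer with a
  translate of the other, because these are semi-invariant: under the rows of \<mu> from the left
  and the columns of \<nu> from the right.\<close>

lemma ip_irr_char:
  assumes \<mu>: "\<mu> \<in> partitions n" and \<nu>: "\<nu> \<in> partitions n"
  shows "ip n (irr_char \<mu>) (irr_char \<nu>) =
    (\<Sum>x\<in>perms n. conv n (young_symmetrizer \<mu>) (\<lambda>\<tau>. young_symmetrizer \<nu> (x \<circ> \<tau>)) (inv x)) / (ys_const n \<mu> * ys_const n \<nu>)"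
proof -
  let ?a = "young_symmetrizer \<mu>" and ?b = "young_symmetrizer \<nu>"
  have "(\<Sum>g\<in>perms n. ?a g * irr_char \<nu> g) = (\<Sum>g\<in>perms n. ?a g * (conj_sum n ?b (inv g) / ys_const n \<nu>))"
    by (intro sum.cong refl) (simp only: irr_char_conj_sum[OF \<nu>] conj_sum_ys_inv[OF \<nu>])
  also have "\<dots> = (\<Sum>g\<in>perms n. \<Sum>x\<in>perms n. ?a g * ?b (x \<circ> (inv g \<circ> inv x))) / ys_const n \<nu>"
    by (simp add: sum_divide_distrib conj_sum_def sum_distrib_left comp_assoc)
  also have "(\<Sum>g\<in>perms n. \<Sum>x\<in>perms n. ?a g * ?b (x \<circ> (inv g \<circ> inv x))) =
      (\<Sum>x\<in>perms n. conv n ?a (\<lambda>\<tau>. ?b (x \<circ> \<tau>)) (inv x))"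
    unfolding conv_def by (rule sum.swap)
  finally show ?thesis by (simp add: ip_irr_char_left[OF \<mu> class_fun_irr_char[OF \<nu>]])
qed

lemma conv_ys_right_translate:
  assumes \<nu>: "\<nu> \<in> partitions n" and q: "q \<in> column_stabilizer \<nu>"
  shows "conv n f (\<lambda>\<tau>. young_symmetrizer \<nu> (x \<circ> \<tau>)) (\<sigma> \<circ> q) = of_int (sign q) * conv n f (\<lambda>\<tau>. young_symmetrizer \<nu> (x \<circ> \<tau>)) \<sigma>"
  unfolding conv_def sum_distrib_left
proof (rule sum.cong[OF refl], goal_cases)
  case (1 p)
  have "x \<circ> (inv p \<circ> (\<sigma> \<circ> q)) = (x \<circ> (inv p \<circ> \<sigma>)) \<circ> q" by (simp only: comp_assoc)
  then have "young_symmetrizer \<nu> (x \<circ> (inv p \<circ> (\<sigma> \<circ> q))) = of_int (sign q) * young_symmetrizer \<nu> (x \<circ> (inv p \<circ> \<sigma>))"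
    by (simp only: ysym_right[OF q])
  then show ?case
    by (simp only: mult.left_commute)
qed

lemma ip_irr_char_not_dominated:
  assumes \<mu>: "\<mu> \<in> partitions n" and \<nu>: "\<nu> \<in> partitions n" and nd: "\<not> dominated \<mu> \<nu>"
  shows "ip n (irr_char \<mu>) (irr_char \<nu>) = 0"
proof -
  have "conv n (young_symmetrizer \<mu>) (\<lambda>\<tau>. young_symmetrizer \<nu> (x \<circ> \<tau>)) (inv x) = 0" if x: "x \<in> perms n" for x
  proof (rule semi_invariant_eq_0[where z = "conv n (young_symmetrizer \<mu>) (\<lambda>\<tau>. young_symmetrizer \<nu> (x \<circ> \<tau>))", OF \<mu> \<nu> _ nd])
    show "inv x permutes {..<n}" using perms_inv[OF x] by simp
  qed (rule conv_ys_left[OF \<mu>], assumption, rule conv_ys_right_translate[OF \<nu>], assumption)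
  then show ?thesis unfolding ip_irr_char[OF \<mu> \<nu>] by (simp only: sum.neutral div_0 ball_simps cong: sum.cong) simp
qed

lemma ip_irr_char_self:
  assumes \<mu>: "\<mu> \<in> partitions n"
  shows "ip n (irr_char \<mu>) (irr_char \<mu>) = 1"
proof -
  let ?c = "young_symmetrizer \<mu>" and ?\<alpha> = "ys_const n \<mu>"
  have "(\<Sum>x\<in>perms n. conv n ?c (\<lambda>\<tau>. ?c (x \<circ> \<tau>)) (inv x)) =
      (\<Sum>x\<in>perms n. conv n ?c (\<lambda>\<tau>. ?c (x \<circ> \<tau>)) id * ?c (inv x))"
  proof (rule sum.cong[OF refl], goal_cases)
    case x: (1 x)
    show ?case
    proof (rule semi_invariant_eq_scalar[where z = "conv n ?c (\<lambda>\<tau>. ?c (x \<circ> \<tau>))", OF \<mu>])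
      show "inv x permutes {..<n}" using perms_inv[OF x] by simp
    qed (rule conv_ys_left[OF \<mu>], assumption, rule conv_ys_right_translate[OF \<mu>], assumption)
  qed
  also have "\<dots> = (\<Sum>g\<in>perms n. \<Sum>x\<in>perms n. ?c g * ?c (x \<circ> inv g) * ?c (inv x))"
    unfolding conv_def sum_distrib_right comp_id by (rule sum.swap)
  also have "\<dots> = (\<Sum>g\<in>perms n. \<Sum>y\<in>perms n. ?c g * ?c y * ?c (inv g \<circ> inv y))"
  proof (rule sum.cong[OF refl], goal_cases)
    case g: (1 g)
    have "(\<Sum>x\<in>perms n. ?c g * ?c (x \<circ> inv g) * ?c (inv x)) =
       (\<Sum>y\<in>perms n. ?c g * ?c ((y \<circ> g) \<circ> inv g) * ?c (inv (y \<circ> g)))"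
      by (rule sum_perms_right[OF g, symmetric])
    also have "\<dots> = (\<Sum>y\<in>perms n. ?c g * ?c y * ?c (inv g \<circ> inv y))"
      by (rule sum.cong[OF refl]) (simp only: comp_assoc perms_cancel[OF g] comp_id perms_inv_comp[OF _ g])
    finally show ?case .
  qed
  \<comment> \<open>The inner convolution yields one factor \<open>?\<alpha>\<close>; the sum that
    then remains is the definition of \<open>?\<alpha>\<close> and yields the other.\<close>
  also have "\<dots> = (\<Sum>y\<in>perms n. ?c y * conv n ?c ?c (inv y))"
    unfolding conv_def sum_distrib_left by (rule trans[OF sum.swap]) (simp only: mult_ac)
  also have "\<dots> = (\<Sum>y\<in>perms n. ?\<alpha> * (?c y * ?c (inv y)))"
    by (rule sum.cong[OF refl]) (subst conv_ys_const[OF \<mu>], simp only: mult.left_commute)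
  also have "\<dots> = ?\<alpha> * ?\<alpha>"
    unfolding sum_distrib_left[symmetric] by (simp only: ys_const_def conv_def comp_id)
  finally show ?thesis unfolding ip_irr_char[OF \<mu> \<mu>] using ys_const_nonzero[OF \<mu>] by simp
qed

lemma ip_irr_char_orthonormal:
  assumes \<mu>: "\<mu> \<in> partitions n" and \<nu>: "\<nu> \<in> partitions n"
  shows "ip n (irr_char \<mu>) (irr_char \<nu>) = (if \<mu> = \<nu> then 1 else 0)"
proof (cases "\<mu> = \<nu>")
  case False
  then consider "\<not> dominated \<mu> \<nu>" | "\<not> dominated \<nu> \<mu>" using dominated_antisym[OF \<mu> \<nu>] by blast
  then show ?thesis
    using False ip_irr_char_not_dominated[OF \<mu> \<nu>] ip_irr_char_not_dominated[OF \<nu> \<mu>] ip_commute[of n "irr_char \<mu>" "irr_char \<nu>"]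
    by cases simp_all
qed (simp add: ip_irr_char_self[OF \<nu>])

text \<open>A character is a combination of conjugates of the symmetrizer, and a class function acts
  on all of them by the same scalar.\<close>

lemma conv_class_fun_irr_char:
  assumes \<mu>: "\<mu> \<in> partitions n" and \<phi>: "class_fun n \<phi>"
  shows "\<exists>k. \<forall>\<sigma>\<in>perms n. conv n \<phi> (irr_char \<mu>) \<sigma> = k * irr_char \<mu> \<sigma>"
proof (intro exI ballI)
  let ?c = "young_symmetrizer \<mu>"
  fix \<sigma> assume \<sigma>: "\<sigma> \<in> perms n"
  have "conv n \<phi> (irr_char \<mu>) \<sigma> = (\<Sum>p\<in>perms n. \<phi> p * (conj_sum n ?c (inv p \<circ> \<sigma>) / ys_const n \<mu>))"
    unfolding conv_def by (rule sum.cong[OF refl]) (simp only: irr_char_conj_sum[OF \<mu> perms_comp[OF perms_inv \<sigma>]])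
  also have "\<dots> = (\<Sum>p\<in>perms n. \<Sum>x\<in>perms n. \<phi> p * ?c (x \<circ> (inv p \<circ> \<sigma>) \<circ> inv x)) / ys_const n \<mu>"
    unfolding conj_sum_def sum_divide_distrib sum_distrib_left by simp
  also have "(\<Sum>p\<in>perms n. \<Sum>x\<in>perms n. \<phi> p * ?c (x \<circ> (inv p \<circ> \<sigma>) \<circ> inv x)) =
      (\<Sum>x\<in>perms n. \<Sum>p\<in>perms n. \<phi> p * ?c (x \<circ> (inv p \<circ> \<sigma>) \<circ> inv x))" by (rule sum.swap)
  also have "\<dots> = (\<Sum>x\<in>perms n. conv n \<phi> ?c (x \<circ> \<sigma> \<circ> inv x))"
  proof (rule sum.cong[OF refl], goal_cases)
    case x: (1 x)
    have "conv n \<phi> ?c (x \<circ> \<sigma> \<circ> inv x) = (\<Sum>p\<in>perms n. \<phi> (x \<circ> p \<circ> inv x) * ?c (inv (x \<circ> p \<circ> inv x) \<circ> (x \<circ> \<sigma> \<circ> inv x)))"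
      unfolding conv_def by (rule sum_perms_conj[OF x, symmetric])
    also have "\<dots> = (\<Sum>p\<in>perms n. \<phi> p * ?c (x \<circ> (inv p \<circ> \<sigma>) \<circ> inv x))"
    proof (rule sum.cong[OF refl])
      fix p assume p: "p \<in> perms n"
      show "\<phi> (x \<circ> p \<circ> inv x) * ?c (inv (x \<circ> p \<circ> inv x) \<circ> (x \<circ> \<sigma> \<circ> inv x)) = \<phi> p * ?c (x \<circ> (inv p \<circ> \<sigma>) \<circ> inv x)"
        unfolding class_funD[OF \<phi> x p] perms_inv_conj[OF x p] by (simp only: comp_assoc perms_cancel[OF x])
    qed
    finally show ?case by simp
  qed
  also have "\<dots> = (\<Sum>x\<in>perms n. conv n \<phi> ?c id * ?c (x \<circ> \<sigma> \<circ> inv x))"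
    by (rule sum.cong[OF refl], rule conv_class_fun_ys[OF \<mu> \<phi>]) (intro perms_comp perms_inv \<sigma>)
  finally show "conv n \<phi> (irr_char \<mu>) \<sigma> = conv n \<phi> ?c id * irr_char \<mu> \<sigma>"
    unfolding irr_char_conj_sum[OF \<mu> \<sigma>] conj_sum_def by (simp add: sum_distrib_left)
qed

section \<open>Restriction to the permutations of one point fewer\<close>

lemma sum_ysym:
  assumes "\<mu> \<in> partitions n"
  shows "(\<Sum>g\<in>perms n. young_symmetrizer \<mu> g * F g) =
    (\<Sum>p\<in>row_stabilizer \<mu>. \<Sum>q\<in>column_stabilizer \<mu>. of_int (sign q) * F (p \<circ> q))"
proof -
  have "(\<Sum>g\<in>perms n. young_symmetrizer \<mu> g * F g) =
     (\<Sum>p\<in>row_stabilizer \<mu>. \<Sum>q\<in>column_stabilizer \<mu>. \<Sum>g\<in>perms n. (if p \<circ> q = g then of_int (sign q) else 0) * F g)"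
    unfolding young_symmetrizer_def sum_distrib_right
    by (rule trans[OF sum.swap], rule sum.cong[OF refl], rule sum.swap)
  also have "\<dots> = (\<Sum>p\<in>row_stabilizer \<mu>. \<Sum>q\<in>column_stabilizer \<mu>. of_int (sign q) * F (p \<circ> q))"
  proof (rule sum.cong[OF refl], rule sum.cong[OF refl])
    fix p q assume "p \<in> row_stabilizer \<mu>" "q \<in> column_stabilizer \<mu>"
    then have pq: "p \<circ> q \<in> perms n" by (intro perms_comp ys_row_perms[OF assms] ys_column_perms[OF assms])
    have "(\<Sum>g\<in>perms n. (if p \<circ> q = g then of_int (sign q) else 0) * F g) =
       (\<Sum>g\<in>perms n. if p \<circ> q = g then of_int (sign q) * F g else 0)"
      by (rule sum.cong[OF refl]) simp
    also have "\<dots> = of_int (sign q) * F (p \<circ> q)" using pq finite_perms[of n] by (subst sum.delta') simp_all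
    finally show "(\<Sum>g\<in>perms n. (if p \<circ> q = g then of_int (sign q) else 0) * F g) = of_int (sign q) * F (p \<circ> q)" .
  qed
  finally show ?thesis .
qed

text \<open>Conjugation by \<open>x\<close> turns each \<open>p \<circ> q\<close> into such a
  product for \<rho>, with the same sign. So every term is the square of a sign, and nothing
  cancels.\<close>

lemma ysym_pairing:
  assumes \<kappa>: "\<kappa> \<in> partitions n" and \<rho>: "\<rho> \<in> partitions (Suc n)" and x: "x \<in> perms (Suc n)"
    and R: "\<And>p. p \<in> row_stabilizer \<kappa> \<Longrightarrow> x \<circ> p \<circ> inv x \<in> row_stabilizer \<rho>"
    and C: "\<And>q. q \<in> column_stabilizer \<kappa> \<Longrightarrow> x \<circ> q \<circ> inv x \<in> column_stabilizer \<rho>"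
  shows "(\<Sum>g\<in>perms n. young_symmetrizer \<kappa> g * young_symmetrizer \<rho> (x \<circ> g \<circ> inv x)) \<noteq> 0"
proof -
  have "(\<Sum>g\<in>perms n. young_symmetrizer \<kappa> g * young_symmetrizer \<rho> (x \<circ> g \<circ> inv x)) =
     (\<Sum>p\<in>row_stabilizer \<kappa>. \<Sum>q\<in>column_stabilizer \<kappa>. of_int (sign q) * young_symmetrizer \<rho> (x \<circ> (p \<circ> q) \<circ> inv x))"
    by (rule sum_ysym[OF \<kappa>])
  also have "\<dots> = (\<Sum>p\<in>row_stabilizer \<kappa>. \<Sum>q\<in>column_stabilizer \<kappa>. 1)"
  proof (rule sum.cong[OF refl], rule sum.cong[OF refl])
    fix p q assume p: "p \<in> row_stabilizer \<kappa>" and q: "q \<in> column_stabilizer \<kappa>"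
    have "permutation s" if "s \<in> perms (Suc n)" for s
      using that by (intro permutes_imp_permutation[OF finite_lessThan[of "Suc n"]]) simp
    then have "permutation x" "permutation (inv x)" "permutation q"
      using x perms_inv[OF x] ys_column_perms[OF \<kappa> q] perms_mono by blast+
    then have "sign (x \<circ> q \<circ> inv x) = sign x * sign q * sign x"
      by (simp only: sign_compose sign_inverse permutation_compose)
    then have s: "sign (x \<circ> q \<circ> inv x) = sign q" by (simp add: mult.assoc mult.left_commute)
    have "x \<circ> (p \<circ> q) \<circ> inv x = (x \<circ> p \<circ> inv x) \<circ> (id \<circ> (x \<circ> q \<circ> inv x))"
      by (simp only: comp_assoc perms_cancel[OF x] id_comp)
    then have "young_symmetrizer \<rho> (x \<circ> (p \<circ> q) \<circ> inv x) = of_int (sign q)"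
      by (simp only: ysym_left[OF R[OF p]] ysym_right[OF C[OF q]] ysym_id s mult_1_right)
    then show "of_int (sign q) * young_symmetrizer \<rho> (x \<circ> (p \<circ> q) \<circ> inv x) = 1"
      by (simp flip: of_int_mult)
  qed
  also have "\<dots> \<noteq> 0"
    using id_row_stabilizer[of \<kappa>] id_column_stabilizer[of \<kappa>] finite_row_stabilizer[of \<kappa>] finite_column_stabilizer[of \<kappa>]
    by auto
  finally show ?thesis .
qed

text \<open>Filled along rows, the tableau of \<rho> does not extend that of \<kappa> unless the new
  box comes last. The permutation \<open>x\<close> makes up for this: an entry goes to the entry of
  \<rho> in the same cell, and \<open>n\<close> to the one in the new box.\<close>

lemma tableau_embedding:
  assumes \<kappa>: "\<kappa> \<in> partitions n" and \<rho>: "\<rho> \<in> partitions (Suc n)"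
    and cover: "rows \<rho> = inc (rows \<kappa>) i"
  obtains x where "x \<in> perms (Suc n)"
    "\<And>m. m < n \<Longrightarrow> row_of \<rho> (x m) = row_of \<kappa> m" "\<And>m. m < n \<Longrightarrow> col_of \<rho> (x m) = col_of \<kappa> m"
proof -
  note s\<kappa> = sum_list_part[OF \<kappa>] and s\<rho> = sum_list_part[OF \<rho>]
  define cl where "cl m = (if m < n then (row_of \<kappa> m, col_of \<kappa> m) else (i, rows \<kappa> i))" for m
  have cl: "cl m \<in> cells \<rho>" if "m < Suc n" for m
  proof (cases "m < n")
    case True
    have "col_of \<kappa> m < rows \<kappa> (row_of \<kappa> m)" using row_col_cell[of m \<kappa>] True s\<kappa> by (simp add: mem_cells_iff)
    then show ?thesis using True by (auto simp: cl_def mem_cells_iff cover inc_def)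
  qed (simp add: cl_def mem_cells_iff cover inc_def)
  have inj_cl: "inj_on cl {..<Suc n}"
  proof (rule inj_onI)
    fix m m' assume m: "m \<in> {..<Suc n}" "m' \<in> {..<Suc n}" and eq: "cl m = cl m'"
    have ne: "(row_of \<kappa> k, col_of \<kappa> k) \<noteq> (i, rows \<kappa> i)" if "k < n" for k
      using row_col_cell[of k \<kappa>] that s\<kappa> by (auto simp: mem_cells_iff)
    show "m = m'"
    proof (cases "m < n"; cases "m' < n")
      assume "m < n" "m' < n"
      then show ?thesis using eq row_col_inject[of m \<kappa> m'] s\<kappa> by (simp add: cl_def)
    next
      assume "m < n" "\<not> m' < n"
      then show ?thesis using eq ne[of m] by (simp add: cl_def)
    next
      assume "\<not> m < n" "m' < n"
      then show ?thesis using eq ne[of m'] by (auto simp: cl_def)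
    next
      assume "\<not> m < n" "\<not> m' < n"
      then show ?thesis using m by simp
    qed
  qed
  define x where "x m = (if m < Suc n then tableau_entry \<rho> (cl m) else m)" for m
  have "inj_on x {..<Suc n}"
  proof (rule inj_onI)
    fix m m' assume m: "m \<in> {..<Suc n}" "m' \<in> {..<Suc n}" and "x m = x m'"
    then have "tableau_entry \<rho> (cl m) = tableau_entry \<rho> (cl m')" by (simp add: x_def)
    then have "cl m = cl m'"
      using inj_onD[OF bij_betw_imp_inj_on[OF bij_tableau_entry[of \<rho>]]] cl m by simp
    then show "m = m'" using inj_onD[OF inj_cl] m by simp
  qed
  moreover have "x m < Suc n" if "m < Suc n" for m
    using bij_betw_apply[OF bij_tableau_entry cl[OF that]] that s\<rho> by (simp add: x_def)
  then have "x ` {..<Suc n} \<subseteq> {..<Suc n}" by auto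
  ultimately have "bij_betw x {..<Suc n} {..<Suc n}" by (simp add: bij_betw_def endo_inj_surj)
  then have "x permutes {..<Suc n}" by (rule bij_imp_permutes) (simp add: x_def)
  moreover have "row_of \<rho> (x m) = row_of \<kappa> m" "col_of \<rho> (x m) = col_of \<kappa> m" if "m < n" for m
    using cl[of m] that by (simp_all add: x_def cl_def row_of_entry col_of_entry)
  ultimately show ?thesis using that by simp
qed

lemma fiber_stabilizer_conj:
  assumes x: "x \<in> perms (Suc n)" and p: "p \<in> perms n" and r: "\<And>m. m < n \<Longrightarrow> r (x m) = r' m"
    and pr: "\<forall>m<n. r' (p m) = r' m"
  shows "x \<circ> p \<circ> inv x permutes {..<Suc n} \<and> (\<forall>y<Suc n. r ((x \<circ> p \<circ> inv x) y) = r y)"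
proof
  have p': "p \<in> perms (Suc n)" using p perms_mono by blast
  have "x \<circ> p \<circ> inv x \<in> perms (Suc n)" by (intro perms_comp perms_inv x p')
  then show "x \<circ> p \<circ> inv x permutes {..<Suc n}" by simp
  show "\<forall>y<Suc n. r ((x \<circ> p \<circ> inv x) y) = r y"
  proof (intro allI impI)
    fix y assume "y < Suc n"
    have y: "x (inv x y) = y" using permutes_inverses(1)[of x "{..<Suc n}" y] x by simp
    show "r ((x \<circ> p \<circ> inv x) y) = r y"
    proof (cases "inv x y < n")
      case True
      then have "p (inv x y) < n" using permutes_less_iff[of p n] p by simp
      then have "r (x (p (inv x y))) = r (x (inv x y))" using r[OF True] r pr True by simp
      then show ?thesis by (simp add: y)
    next
      case False
      then have "p (inv x y) = inv x y" using permutes_not_in[of p "{..<n}" "inv x y"] p by simp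
      then show ?thesis by (simp add: y)
    qed
  qed
qed

text \<open>On \<open>Suc n\<close> points, \<open>u y\<close> is the product of the symmetrizer of
  \<kappa>, of \<open>y\<close>, and of the symmetrizer of \<rho> with its permutations inverted.
  Both outer factors are quasi-idempotent, so \<open>u\<close> describes a multiple of a projection,
  and the multiplicity is the dimension of its image.\<close>

lemma ip_restrict_irr_char:
  assumes \<kappa>: "\<kappa> \<in> partitions n" and \<rho>: "\<rho> \<in> partitions (Suc n)"
  shows "\<exists>m. ip n (irr_char \<rho>) (irr_char \<kappa>) = of_nat m \<and> ((\<exists>i. rows \<rho> = inc (rows \<kappa>) i) \<longrightarrow> m > 0)"
proof -
  let ?a = "young_symmetrizer \<kappa>" and ?b = "young_symmetrizer \<rho>"
  let ?G = "perms (Suc n)" and ?\<beta> = "ys_const (Suc n) \<rho>"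
  let ?\<gamma> = "ys_const n \<kappa> * ?\<beta>"
  define u where "u y \<sigma> = (if \<sigma> \<in> ?G then \<Sum>g\<in>perms n. ?a g * ?b (inv \<sigma> \<circ> g \<circ> y) else 0)" for y \<sigma>
  have sub: "g \<in> ?G" if "g \<in> perms n" for g using that perms_mono by blast
  have clf: "class_fun n (irr_char \<rho>)"
    unfolding class_fun_def using class_funD[OF class_fun_irr_char[OF \<rho>]] sub by blast
  have "(\<Sum>x\<in>?G. u x x) = ?\<gamma> * trace_on (fvs.span (u ` ?G)) (\<lambda>f. f)"
  proof (rule trace_on_quasi_projection[OF finite_perms, where T = "\<lambda>f. f"])
    fix y assume y: "y \<in> ?G"
    show "(\<Sum>x\<in>?G. fscale (u y x) (u x)) = fscale ?\<gamma> (u y)"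
    proof
      fix \<sigma>
      have "(\<Sum>x\<in>?G. u y x * u x \<sigma>) = ?\<gamma> * u y \<sigma>"
      proof (cases "\<sigma> \<in> ?G")
        case \<sigma>: True
        have inner: "(\<Sum>x\<in>?G. ?b (inv \<sigma> \<circ> g' \<circ> x) * ?b (inv x \<circ> g \<circ> y)) = ?\<beta> * ?b (inv \<sigma> \<circ> (g' \<circ> g) \<circ> y)"
          if g: "g \<in> perms n" and g': "g' \<in> perms n" for g g'
        proof -
          let ?h = "inv \<sigma> \<circ> g'"
          have h: "?h \<in> ?G" by (intro perms_comp perms_inv \<sigma> sub g')
          have "(\<Sum>x\<in>?G. ?b (?h \<circ> x) * ?b (inv x \<circ> g \<circ> y)) =
              (\<Sum>x\<in>?G. ?b (?h \<circ> x) * ?b (inv (?h \<circ> x) \<circ> (?h \<circ> (g \<circ> y))))"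
          proof (rule sum.cong[OF refl], goal_cases)
            case x: (1 x)
            have "inv x \<circ> g \<circ> y = inv (?h \<circ> x) \<circ> (?h \<circ> (g \<circ> y))"
              unfolding perms_inv_comp[OF h x] comp_assoc[of "inv x"] perms_cancel(1)[OF h] ..
            then show ?case by (simp only:)
          qed
          also have "\<dots> = conv (Suc n) ?b ?b (?h \<circ> (g \<circ> y))"
            unfolding conv_def by (rule sum_perms_left[OF h])
          also have "\<dots> = ?\<beta> * ?b (?h \<circ> (g \<circ> y))" by (rule conv_ys_const[OF \<rho>])
          finally show ?thesis by (simp only: comp_assoc)
        qed
        have "(\<Sum>x\<in>?G. u y x * u x \<sigma>) =
            (\<Sum>x\<in>?G. \<Sum>g\<in>perms n. \<Sum>g'\<in>perms n. ?a g * ?a g' * (?b (inv \<sigma> \<circ> g' \<circ> x) * ?b (inv x \<circ> g \<circ> y)))"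
          by (rule sum.cong[OF refl]) (simp only: u_def \<sigma> if_True sum_product mult_ac)
        also have "\<dots> = (\<Sum>g\<in>perms n. \<Sum>g'\<in>perms n. \<Sum>x\<in>?G. ?a g * ?a g' * (?b (inv \<sigma> \<circ> g' \<circ> x) * ?b (inv x \<circ> g \<circ> y)))"
          by (rule trans[OF sum.swap], rule sum.cong[OF refl], rule sum.swap)
        also have "\<dots> = (\<Sum>g\<in>perms n. \<Sum>g'\<in>perms n. ?\<beta> * (?a g * ?a g' * ?b (inv \<sigma> \<circ> (g' \<circ> g) \<circ> y)))"
          by (intro sum.cong[OF refl]) (simp only: sum_distrib_left[symmetric] inner mult.left_commute)
        also have "\<dots> = (\<Sum>g'\<in>perms n. \<Sum>g\<in>perms n. ?\<beta> * (?a g * ?a g' * ?b (inv \<sigma> \<circ> (g' \<circ> g) \<circ> y)))"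
          by (rule sum.swap)
        also have "\<dots> = (\<Sum>g'\<in>perms n. \<Sum>k\<in>perms n. ?\<beta> * (?a (inv g' \<circ> k) * ?a g' * ?b (inv \<sigma> \<circ> k \<circ> y)))"
        proof (rule sum.cong[OF refl], goal_cases)
          case g': (1 g')
          then show ?case
            using sum_perms_left[of g' n "\<lambda>k. ?\<beta> * (?a (inv g' \<circ> k) * ?a g' * ?b (inv \<sigma> \<circ> k \<circ> y))"]
            by (simp only: perms_cancel(1))
        qed
        also have "\<dots> = (\<Sum>k\<in>perms n. ?\<beta> * (conv n ?a ?a k * ?b (inv \<sigma> \<circ> k \<circ> y)))"
          unfolding conv_def sum_distrib_right sum_distrib_left
          by (rule trans[OF sum.swap]) (intro sum.cong[OF refl], simp only: mult_ac)
        also have "\<dots> = (\<Sum>k\<in>perms n. ?\<gamma> * (?a k * ?b (inv \<sigma> \<circ> k \<circ> y)))"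
          by (intro sum.cong[OF refl], subst conv_ys_const[OF \<kappa>]) (simp only: mult_ac)
        also have "\<dots> = ?\<gamma> * u y \<sigma>"
          by (simp only: u_def \<sigma> if_True sum_distrib_left)
        finally show ?thesis .
      qed (simp add: u_def)
      then show "(\<Sum>x\<in>?G. fscale (u y x) (u x)) \<sigma> = fscale ?\<gamma> (u y) \<sigma>"
        by (simp add: sum_fun_apply fscale_def)
    qed
    show "u y \<in> fvs.span (u ` ?G)" using y by (intro fvs.span_base) simp
  qed simp_all
  moreover have "(\<Sum>x\<in>?G. u x x) = (\<Sum>g\<in>perms n. ?a g * conj_sum (Suc n) ?b g)"
  proof -
    have "(\<Sum>x\<in>?G. u x x) = (\<Sum>x\<in>?G. \<Sum>g\<in>perms n. ?a g * ?b (inv x \<circ> g \<circ> inv (inv x)))"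
      by (rule sum.cong[OF refl]) (simp only: u_def if_True perms_cancel(5))
    also have "\<dots> = (\<Sum>x\<in>?G. \<Sum>g\<in>perms n. ?a g * ?b (x \<circ> g \<circ> inv x))"
      by (rule sum_perms_inv[of "\<lambda>x. \<Sum>g\<in>perms n. ?a g * ?b (x \<circ> g \<circ> inv x)"])
    also have "\<dots> = (\<Sum>g\<in>perms n. ?a g * conj_sum (Suc n) ?b g)"
      unfolding conj_sum_def sum_distrib_left by (rule sum.swap)
    finally show ?thesis .
  qed
  moreover have "ip n (irr_char \<rho>) (irr_char \<kappa>) = (\<Sum>g\<in>perms n. ?a g * conj_sum (Suc n) ?b g) / ?\<gamma>"
  proof -
    have "(\<Sum>g\<in>perms n. ?a g * irr_char \<rho> g) = (\<Sum>g\<in>perms n. ?a g * conj_sum (Suc n) ?b g) / ?\<beta>"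
      unfolding sum_divide_distrib
      by (rule sum.cong[OF refl]) (simp only: irr_char_conj_sum[OF \<rho> sub] times_divide_eq_right)
    then show ?thesis
      unfolding ip_commute[of n "irr_char \<rho>"] ip_irr_char_left[OF \<kappa> clf] by simp
  qed
  ultimately have ip: "ip n (irr_char \<rho>) (irr_char \<kappa>) = trace_on (fvs.span (u ` ?G)) (\<lambda>f. f)"
    using ys_const_nonzero[OF \<kappa>] ys_const_nonzero[OF \<rho>] by simp
  have "\<exists>v\<in>u ` ?G. v \<noteq> 0" if cov: "rows \<rho> = inc (rows \<kappa>) i" for i
  proof -
    obtain x where x: "x \<in> ?G" and xr: "\<And>m. m < n \<Longrightarrow> row_of \<rho> (x m) = row_of \<kappa> m"
      and xc: "\<And>m. m < n \<Longrightarrow> col_of \<rho> (x m) = col_of \<kappa> m"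
      using tableau_embedding[OF \<kappa> \<rho> cov] by blast
    have "(\<Sum>g\<in>perms n. ?a g * ?b (x \<circ> g \<circ> inv x)) \<noteq> 0"
    proof (rule ysym_pairing[OF \<kappa> \<rho> x])
      show "x \<circ> p \<circ> inv x \<in> row_stabilizer \<rho>" if "p \<in> row_stabilizer \<kappa>" for p
        using that fiber_stabilizer_conj[where r = "row_of \<rho>" and r' = "row_of \<kappa>" and p = p, OF x _ xr]
        unfolding row_stab_iff sum_list_part[OF \<kappa>] sum_list_part[OF \<rho>] by blast
      show "x \<circ> p \<circ> inv x \<in> column_stabilizer \<rho>" if "p \<in> column_stabilizer \<kappa>" for p
        using that fiber_stabilizer_conj[where r = "col_of \<rho>" and r' = "col_of \<kappa>" and p = p, OF x _ xc]
        unfolding col_stab_iff sum_list_part[OF \<kappa>] sum_list_part[OF \<rho>] by blast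
    qed
    \<comment> \<open>This diagonal value is the sum just shown to be nonzero.\<close>
    then have "u (inv x) (inv x) \<noteq> 0"
      by (simp only: u_def perms_inv[OF x] if_True perms_cancel(5)[OF x] not_False_eq_True)
    then have "u (inv x) \<noteq> 0" by (metis zero_fun_apply)
    then show ?thesis using perms_inv[OF x] by blast
  qed
  then show ?thesis
    unfolding ip using trace_on_id[OF finite_imageI[OF finite_perms], of u "Suc n"] by blast
qed

section \<open>Branching\<close>

definition covers :: "nat list \<Rightarrow> nat list \<Rightarrow> bool" where
  "covers \<nu> \<kappa> \<longleftrightarrow> (\<exists>i. rows \<nu> = inc (rows \<kappa>) i)"

lemma sum_partitions_rows: "(\<Sum>\<nu>\<in>partitions n. h (rows \<nu>)) = (\<Sum>a\<in>diagrams n. h a)"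
  by (rule sum.reindex_bij_betw[OF bij_row_lengths])

lemma diagrams_below:
  assumes a: "a \<in> diagrams (Suc n)"
  shows "{b \<in> diagrams n. \<exists>i. a = inc b i} = dec a ` removable a" "inj_on (dec a) (removable a)"
proof -
  show "{b \<in> diagrams n. \<exists>i. a = inc b i} = dec a ` removable a"
  proof (intro equalityI subsetI)
    fix b assume "b \<in> {b \<in> diagrams n. \<exists>i. a = inc b i}"
    then obtain i where b: "b \<in> diagrams n" "a = inc b i" by blast
    have "b (Suc i) \<le> b i" by (rule antimonoD[OF diagramsD(1)[OF b(1)]]) simp
    then have "i \<in> removable a" unfolding b(2) by (simp add: removable_def inc_def)
    then show "b \<in> dec a ` removable a" unfolding b(2) by (intro image_eqI[of _ _ i]) simp_all
  next
    fix b assume "b \<in> dec a ` removable a"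
    then obtain i where i: "i \<in> removable a" "b = dec a i" by blast
    then have "b \<in> diagrams n" "a = inc b i" using dec_in_diagrams[OF a i(1)] inc_dec[OF i(1)] by simp_all
    then show "b \<in> {b \<in> diagrams n. \<exists>i. a = inc b i}" by blast
  qed
  show "inj_on (dec a) (removable a)"
  proof (rule inj_onI)
    fix i j assume ij: "i \<in> removable a" "j \<in> removable a" "dec a i = dec a j"
    show "i = j"
    proof (rule ccontr)
      assume "i \<noteq> j"
      then have "a i - 1 = a i" using fun_cong[OF ij(3), of i] by (simp add: dec_def)
      then show False using ij(1) by (simp add: removable_def)
    qed
  qed
qed

lemma diagrams_above:
  assumes b: "b \<in> diagrams n"
  shows "{a \<in> diagrams (Suc n). \<exists>i. a = inc b i} = inc b ` addable b" "inj_on (inc b) (addable b)"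
proof -
  show "{a \<in> diagrams (Suc n). \<exists>i. a = inc b i} = inc b ` addable b"
  proof (intro equalityI subsetI)
    fix a assume "a \<in> {a \<in> diagrams (Suc n). \<exists>i. a = inc b i}"
    then obtain i where a: "a \<in> diagrams (Suc n)" "a = inc b i" by blast
    have "i \<in> addable b"
    proof (cases i)
      case (Suc j)
      have "a i \<le> a j" by (rule antimonoD[OF diagramsD(1)[OF a(1)]]) (simp add: Suc)
      then show ?thesis unfolding a(2) by (simp add: addable_def inc_def Suc)
    qed (simp add: addable_def)
    then show "a \<in> inc b ` addable b" using a(2) by blast
  next
    fix a assume "a \<in> inc b ` addable b"
    then show "a \<in> {a \<in> diagrams (Suc n). \<exists>i. a = inc b i}" using inc_in_diagrams[OF b] by blast
  qed
  show "inj_on (inc b) (addable b)"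
  proof (rule inj_onI)
    fix i j assume eq: "inc b i = inc b j"
    have "Suc (b i) = inc b j i" using fun_cong[OF eq, of i] by (simp add: inc_def)
    then show "i = j" by (cases "i = j") (simp_all add: inc_def)
  qed
qed

lemma sum_covered:
  assumes \<nu>: "\<nu> \<in> partitions (Suc n)"
  shows "(\<Sum>\<kappa>\<in>partitions n. if covers \<nu> \<kappa> then h (rows \<kappa>) else 0) =
    down h (rows \<nu>)"
proof -
  let ?a = "rows \<nu>"
  note a = rows_in_diagrams[OF \<nu>]
  have "(\<Sum>\<kappa>\<in>partitions n. if covers \<nu> \<kappa> then h (rows \<kappa>) else 0) =
      (\<Sum>b\<in>diagrams n. if \<exists>i. ?a = inc b i then h b else 0)"
    unfolding covers_def by (rule sum_partitions_rows)
  also have "\<dots> = (\<Sum>b\<in>{b \<in> diagrams n. \<exists>i. ?a = inc b i}. h b)"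
    by (rule sum.inter_filter[symmetric, OF finite_diagrams])
  also have "\<dots> = down h ?a"
    unfolding diagrams_below(1)[OF a] by (subst sum.reindex[OF diagrams_below(2)[OF a]]) (simp add: o_def)
  finally show ?thesis .
qed

lemma sum_covering:
  assumes \<kappa>: "\<kappa> \<in> partitions n"
  shows "(\<Sum>\<nu>\<in>partitions (Suc n). if covers \<nu> \<kappa> then h (rows \<nu>) else 0) =
    up h (rows \<kappa>)"
proof -
  let ?b = "rows \<kappa>"
  note b = rows_in_diagrams[OF \<kappa>]
  have "(\<Sum>\<nu>\<in>partitions (Suc n). if covers \<nu> \<kappa> then h (rows \<nu>) else 0) =
      (\<Sum>a\<in>diagrams (Suc n). if \<exists>i. a = inc ?b i then h a else 0)"
    unfolding covers_def by (rule sum_partitions_rows)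
  also have "\<dots> = (\<Sum>a\<in>{a \<in> diagrams (Suc n). \<exists>i. a = inc ?b i}. h a)"
    by (rule sum.inter_filter[symmetric, OF finite_diagrams])
  also have "\<dots> = up h ?b"
    unfolding diagrams_above(1)[OF b] by (subst sum.reindex[OF diagrams_above(2)[OF b]]) (simp add: o_def)
  finally show ?thesis .
qed

lemma num_standard_tableaux_rec:
  assumes \<nu>: "\<nu> \<in> partitions (Suc n)"
  shows "num_standard_tableaux \<nu> = (\<Sum>\<kappa>\<in>partitions n. if covers \<nu> \<kappa> then num_standard_tableaux \<kappa> else 0)"
  unfolding num_standard_tableaux_eq sum_covered[OF \<nu>] by (rule tab_count_rec[OF rows_in_diagrams[OF \<nu>]])

lemma sum_num_standard_tableaux_squares: "(\<Sum>\<nu>\<in>partitions n. (num_standard_tableaux \<nu>)\<^sup>2) = fact n"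
  unfolding num_standard_tableaux_eq sum_partitions_rows[of "\<lambda>a. (tab_count a)\<^sup>2"] by (rule sum_tab_count_squares)

section \<open>Degrees and completeness of the irreducible characters\<close>

definition degree_char :: "nat list \<Rightarrow> nat" where
  "degree_char \<mu> = (THE d. irr_char \<mu> id = of_nat d)"

lemma degree_char:
  assumes "\<mu> \<in> partitions n"
  shows "irr_char \<mu> id = of_nat (degree_char \<mu>)" "degree_char \<mu> > 0"
proof -
  obtain d where d: "d > 0" "irr_char \<mu> id = of_nat d" using irr_char_degree[OF assms] by blast
  then have "degree_char \<mu> = d" unfolding degree_char_def by (intro the_equality) simp_all
  then show "irr_char \<mu> id = of_nat (degree_char \<mu>)" "degree_char \<mu> > 0" using d by simp_all
qed

lemma ip_sum_right: "ip n \<psi> (\<lambda>g. \<Sum>i\<in>I. a i * \<phi> i g) = (\<Sum>i\<in>I. a i * ip n \<psi> (\<phi> i))"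
  using ip_sum[of n a \<phi> I \<psi>] by (simp add: ip_commute[of n \<psi>])

lemma ip_sum_irr_char:
  assumes "\<nu> \<in> partitions n"
  shows "ip n (\<lambda>g. \<Sum>\<mu>\<in>partitions n. a \<mu> * irr_char \<mu> g) (irr_char \<nu>) = a \<nu>"
proof -
  have "(\<Sum>\<mu>\<in>partitions n. a \<mu> * ip n (irr_char \<mu>) (irr_char \<nu>)) = (\<Sum>\<mu>\<in>partitions n. if \<mu> = \<nu> then a \<mu> else 0)"
    by (rule sum.cong[OF refl]) (simp add: ip_irr_char_orthonormal[OF _ assms])
  then show ?thesis unfolding ip_sum using assms finite_partitions by simp
qed

text \<open>Bessel's inequality for \<open>n!\<close> times the indicator function of the identity.\<close>

lemma degree_char_bessel:
  shows "(\<Sum>\<mu>\<in>partitions n. (degree_char \<mu>)\<^sup>2) \<le> fact n"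
    and "(\<Sum>\<mu>\<in>partitions n. (degree_char \<mu>)\<^sup>2) = fact n \<Longrightarrow> g \<in> perms n \<Longrightarrow>
      (\<Sum>\<mu>\<in>partitions n. of_nat (degree_char \<mu>) * irr_char \<mu> g) = (if g = id then fact n else 0)"
proof -
  define \<delta> :: "(nat \<Rightarrow> nat) \<Rightarrow> complex" where "\<delta> g = (if g = id then fact n else 0)" for g
  define S where "S g = (\<Sum>\<mu>\<in>partitions n. of_nat (degree_char \<mu>) * irr_char \<mu> g)" for g
  define D where "D g = \<delta> g - S g" for g
  let ?s = "\<Sum>\<mu>\<in>partitions n. (degree_char \<mu>)\<^sup>2"
  have \<delta>: "ip n \<phi> \<delta> = \<phi> id" for \<phi>
  proof -
    have "(\<Sum>g\<in>perms n. \<phi> g * \<delta> g) = (\<Sum>g\<in>perms n. if g = id then \<phi> g * fact n else 0)"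
      by (rule sum.cong[OF refl]) (simp add: \<delta>_def)
    then show ?thesis using finite_perms[of n] perms_id[of n] by (simp add: ip_def)
  qed
  have SS: "ip n S S = of_nat ?s"
  proof -
    have "ip n S S = (\<Sum>\<mu>\<in>partitions n. of_nat (degree_char \<mu>) * ip n S (irr_char \<mu>))"
      unfolding S_def[abs_def] by (rule ip_sum_right)
    also have "\<dots> = (\<Sum>\<mu>\<in>partitions n. of_nat (degree_char \<mu>) * of_nat (degree_char \<mu>))"
      unfolding S_def[abs_def] by (rule sum.cong[OF refl]) (simp only: ip_sum_irr_char)
    finally show ?thesis by (simp add: power2_eq_square)
  qed
  have S\<delta>: "ip n S \<delta> = of_nat ?s"
    unfolding \<delta> S_def of_nat_sum
    by (rule sum.cong[OF refl]) (simp only: degree_char(1) power2_eq_square of_nat_mult)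
  \<comment> \<open>The square norm of the deviation \<open>D\<close> is the defect in Bessel's
    inequality.\<close>
  have "ip n D D = ip n \<delta> \<delta> - 2 * ip n S \<delta> + ip n S S"
    unfolding ip_def D_def by (simp add: algebra_simps sum.distrib sum_subtractf add_divide_distrib diff_divide_distrib sum_distrib_left)
  also have "ip n \<delta> \<delta> = fact n" unfolding \<delta> by (simp add: \<delta>_def)
  also have "fact n - 2 * ip n S \<delta> + ip n S S = fact n - of_nat ?s" unfolding S\<delta> SS by simp
  finally have DD: "(\<Sum>g\<in>perms n. D g * D g) = fact n * (fact n - of_nat ?s)"
    by (simp add: ip_def field_simps)
  have "(fact n :: complex) \<in> \<real>" using Reals_of_nat[of "fact n"] by simp
  then have real: "D g \<in> \<real>" if "g \<in> perms n" for g
    unfolding D_def S_def \<delta>_def using that irr_char_real[of _ n g]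
    by (intro Reals_diff sum_in_Reals Reals_mult) auto
  \<comment> \<open>Since \<open>D\<close> is real, the bilinear form is a sum of squares, and its
    vanishing forces \<open>D\<close> to vanish.\<close>
  have "D g * D g = of_real ((Re (D g))\<^sup>2)" if "g \<in> perms n" for g
    using real[OF that] by (metis of_real_Re of_real_mult power2_eq_square)
  then have "(\<Sum>g\<in>perms n. D g * D g) = of_real (\<Sum>g\<in>perms n. (Re (D g))\<^sup>2)"
    unfolding of_real_sum by (intro sum.cong refl)
  then have "complex_of_real (\<Sum>g\<in>perms n. (Re (D g))\<^sup>2) = complex_of_real (fact n * (fact n - real ?s))"
    unfolding DD by simp
  then have R: "(\<Sum>g\<in>perms n. (Re (D g))\<^sup>2) = fact n * (fact n - real ?s)"
    by (simp only: of_real_eq_iff)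
  have "0 \<le> (\<Sum>g\<in>perms n. (Re (D g))\<^sup>2)" by (intro sum_nonneg) simp
  then have "real ?s \<le> fact n"
    unfolding R using zero_le_mult_iff[of "fact n" "fact n - real ?s"] fact_gt_zero[of n, where 'a = real] by linarith
  then show "?s \<le> fact n" by (metis of_nat_fact of_nat_le_iff)
  assume "?s = fact n" and g: "g \<in> perms n"
  then have "(\<Sum>g\<in>perms n. (Re (D g))\<^sup>2) = 0" unfolding R by simp
  then have "Re (D g) = 0" using g finite_perms[of n] by (simp add: sum_nonneg_eq_0_iff)
  then have "D g = 0" using real[OF g] by (metis of_real_0 of_real_Re)
  then show "(\<Sum>\<mu>\<in>partitions n. of_nat (degree_char \<mu>) * irr_char \<mu> g) = (if g = id then fact n else 0)"
    by (simp add: D_def S_def \<delta>_def)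
qed

text \<open>With equality in Bessel's inequality, the degree-weighted sum of characters is n! times
  the unit of convolution. Convolving \<phi> with it gives back n! times \<phi>, and each summand is
  a multiple of an irreducible character.\<close>

lemma class_fun_expansion:
  assumes deg: "(\<Sum>\<mu>\<in>partitions n. (degree_char \<mu>)\<^sup>2) = fact n"
    and \<phi>: "class_fun n \<phi>" and \<sigma>: "\<sigma> \<in> perms n"
  shows "\<phi> \<sigma> = (\<Sum>\<mu>\<in>partitions n. ip n \<phi> (irr_char \<mu>) * irr_char \<mu> \<sigma>)"
proof -
  have "\<exists>k. \<forall>\<mu>\<in>partitions n. \<forall>\<sigma>\<in>perms n. conv n \<phi> (irr_char \<mu>) \<sigma> = k \<mu> * irr_char \<mu> \<sigma>"
    using conv_class_fun_irr_char[OF _ \<phi>] by (intro bchoice) blast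
  then obtain k where k: "\<And>\<mu> \<sigma>. \<mu> \<in> partitions n \<Longrightarrow> \<sigma> \<in> perms n \<Longrightarrow> conv n \<phi> (irr_char \<mu>) \<sigma> = k \<mu> * irr_char \<mu> \<sigma>"
    by blast
  define a where "a \<mu> = of_nat (degree_char \<mu>) * k \<mu> / fact n" for \<mu>
  have exp: "\<phi> \<sigma> = (\<Sum>\<mu>\<in>partitions n. a \<mu> * irr_char \<mu> \<sigma>)" if \<sigma>: "\<sigma> \<in> perms n" for \<sigma>
  proof -
    have "fact n * \<phi> \<sigma> = (\<Sum>p\<in>perms n. if p = \<sigma> then fact n * \<phi> p else 0)"
      using \<sigma> finite_perms[of n] by simp
    also have "\<dots> = (\<Sum>p\<in>perms n. \<phi> p * (\<Sum>\<mu>\<in>partitions n. of_nat (degree_char \<mu>) * irr_char \<mu> (inv p \<circ> \<sigma>)))"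
    proof (rule sum.cong[OF refl], goal_cases)
      case p: (1 p)
      have "inv p \<circ> \<sigma> = id \<longleftrightarrow> p = \<sigma>"
      proof
        assume "inv p \<circ> \<sigma> = id"
        then show "p = \<sigma>" using perms_cancel(2)[OF p, of \<sigma>] by simp
      qed (use perms_cancel(3)[OF p] in simp)
      then show ?case
        by (simp only: degree_char_bessel(2)[OF deg perms_comp[OF perms_inv[OF p] \<sigma>]]) simp
    qed
    also have "\<dots> = (\<Sum>\<mu>\<in>partitions n. of_nat (degree_char \<mu>) * conv n \<phi> (irr_char \<mu>) \<sigma>)"
      unfolding conv_def sum_distrib_left by (rule trans[OF sum.swap]) (simp only: mult.left_commute)
    also have "\<dots> = fact n * (\<Sum>\<mu>\<in>partitions n. a \<mu> * irr_char \<mu> \<sigma>)"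
      unfolding sum_distrib_left by (rule sum.cong[OF refl]) (simp add: a_def k[OF _ \<sigma>])
    finally show ?thesis by simp
  qed
  have "ip n \<phi> (irr_char \<nu>) = a \<nu>" if "\<nu> \<in> partitions n" for \<nu>
    using ip_sum_irr_char[OF that, of a] ip_cong[of n \<phi> _ "irr_char \<nu>", OF exp] by simp
  then show ?thesis unfolding exp[OF \<sigma>] by (intro sum.cong refl) simp
qed

lemma class_fun_restrict: "class_fun (Suc n) \<phi> \<Longrightarrow> class_fun n \<phi>"
  using perms_mono[of n] unfolding class_fun_def by blast

lemma partitions_0: "partitions 0 = {[]}"
proof -
  have "rows ` partitions 0 = {rows []}"
    using bij_row_lengths[of 0] by (simp add: bij_betw_def diagrams_0 rows_def[abs_def])
  moreover have "[] \<in> partitions 0" by (simp add: partitions_def)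
  ultimately show ?thesis
    using bij_betw_imp_inj_on[OF bij_row_lengths[of 0]] by (auto simp: inj_on_def)
qed

text \<open>
  Each covered \<open>\<kappa>\<close> contributes at least its degree to the degree of \<open>\<nu>\<close>, so the
  degrees are at least the numbers of standard tableaux. Since the squares of both
  sum up to \<open>n!\<close>, no multiplicity can exceed one.
\<close>

lemma branching:
  assumes IH: "\<And>\<kappa>. \<kappa> \<in> partitions n \<Longrightarrow> degree_char \<kappa> = num_standard_tableaux \<kappa>"
  shows "\<nu> \<in> partitions (Suc n) \<Longrightarrow> degree_char \<nu> = num_standard_tableaux \<nu>"
    and "\<nu> \<in> partitions (Suc n) \<Longrightarrow> \<kappa> \<in> partitions n \<Longrightarrow> ip n (irr_char \<nu>) (irr_char \<kappa>) = (if covers \<nu> \<kappa> then 1 else 0)"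
proof -
  \<comment> \<open>The induction hypothesis makes the characters on \<open>n\<close> points
    complete, so restrictions can be expanded in them.\<close>
  have full: "(\<Sum>\<mu>\<in>partitions n. (degree_char \<mu>)\<^sup>2) = fact n"
    using sum_num_standard_tableaux_squares[of n] by (simp add: IH cong: sum.cong)
  have "\<exists>m. \<forall>\<nu>\<in>partitions (Suc n). \<forall>\<kappa>\<in>partitions n. ip n (irr_char \<nu>) (irr_char \<kappa>) = of_nat (m \<nu> \<kappa>) \<and> (covers \<nu> \<kappa> \<longrightarrow> m \<nu> \<kappa> > 0)"
  proof (intro bchoice ballI)
    fix \<nu> \<kappa> assume "\<nu> \<in> partitions (Suc n)" "\<kappa> \<in> partitions n"
    then show "\<exists>m. ip n (irr_char \<nu>) (irr_char \<kappa>) = of_nat m \<and> (covers \<nu> \<kappa> \<longrightarrow> m > 0)"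
      using ip_restrict_irr_char unfolding covers_def by blast
  qed
  then obtain m where m: "\<And>\<nu> \<kappa>. \<nu> \<in> partitions (Suc n) \<Longrightarrow> \<kappa> \<in> partitions n \<Longrightarrow> ip n (irr_char \<nu>) (irr_char \<kappa>) = of_nat (m \<nu> \<kappa>)"
    and m0: "\<And>\<nu> \<kappa>. \<nu> \<in> partitions (Suc n) \<Longrightarrow> \<kappa> \<in> partitions n \<Longrightarrow> covers \<nu> \<kappa> \<Longrightarrow> m \<nu> \<kappa> > 0"
    by blast
  have d: "degree_char \<nu> = (\<Sum>\<kappa>\<in>partitions n. m \<nu> \<kappa> * num_standard_tableaux \<kappa>)" if \<nu>: "\<nu> \<in> partitions (Suc n)" for \<nu>
  proof -
    have "irr_char \<nu> id = (\<Sum>\<kappa>\<in>partitions n. ip n (irr_char \<nu>) (irr_char \<kappa>) * irr_char \<kappa> id)"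
      by (rule class_fun_expansion[OF full class_fun_restrict[OF class_fun_irr_char[OF \<nu>]] perms_id])
    also have "\<dots> = (\<Sum>\<kappa>\<in>partitions n. of_nat (m \<nu> \<kappa> * num_standard_tableaux \<kappa>))"
      by (rule sum.cong[OF refl]) (simp only: m[OF \<nu>] degree_char(1) IH of_nat_mult)
    finally have "complex_of_nat (degree_char \<nu>) = of_nat (\<Sum>\<kappa>\<in>partitions n. m \<nu> \<kappa> * num_standard_tableaux \<kappa>)"
      unfolding degree_char(1)[OF \<nu>] of_nat_sum .
    then show ?thesis by (simp only: of_nat_eq_iff)
  qed
  have le: "(if covers \<nu> \<kappa> then num_standard_tableaux \<kappa> else 0) \<le> m \<nu> \<kappa> * num_standard_tableaux \<kappa>"
    if "\<nu> \<in> partitions (Suc n)" "\<kappa> \<in> partitions n" for \<nu> \<kappa>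
    using m0[OF that] by (cases "m \<nu> \<kappa>") auto
  have ge: "num_standard_tableaux \<nu> \<le> degree_char \<nu>" if "\<nu> \<in> partitions (Suc n)" for \<nu>
    unfolding d[OF that] num_standard_tableaux_rec[OF that] by (intro sum_mono le that)
  have sq: "(num_standard_tableaux \<nu>)\<^sup>2 \<le> (degree_char \<nu>)\<^sup>2" if "\<nu> \<in> partitions (Suc n)" for \<nu>
    using ge[OF that] by (rule power_mono) simp
  have "(\<Sum>\<nu>\<in>partitions (Suc n). (num_standard_tableaux \<nu>)\<^sup>2) = (\<Sum>\<nu>\<in>partitions (Suc n). (degree_char \<nu>)\<^sup>2)"
    using degree_char_bessel(1)[of "Suc n"] sum_num_standard_tableaux_squares[of "Suc n"]
      sum_mono[of "partitions (Suc n)" "\<lambda>\<nu>. (num_standard_tableaux \<nu>)\<^sup>2" "\<lambda>\<nu>. (degree_char \<nu>)\<^sup>2", OF sq]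
    by linarith
  then have "(num_standard_tableaux \<nu>)\<^sup>2 = (degree_char \<nu>)\<^sup>2" if "\<nu> \<in> partitions (Suc n)" for \<nu>
    by (rule sum_mono_inv[OF _ sq that finite_partitions])
  then have deg: "degree_char \<nu> = num_standard_tableaux \<nu>" if "\<nu> \<in> partitions (Suc n)" for \<nu>
    using that by (metis power2_eq_iff_nonneg zero_le)
  show "\<nu> \<in> partitions (Suc n) \<Longrightarrow> degree_char \<nu> = num_standard_tableaux \<nu>" by (rule deg)
  show "ip n (irr_char \<nu>) (irr_char \<kappa>) = (if covers \<nu> \<kappa> then 1 else 0)"
    if \<nu>: "\<nu> \<in> partitions (Suc n)" and \<kappa>: "\<kappa> \<in> partitions n"
  proof -
    have "(\<Sum>\<kappa>\<in>partitions n. if covers \<nu> \<kappa> then num_standard_tableaux \<kappa> else 0) = (\<Sum>\<kappa>\<in>partitions n. m \<nu> \<kappa> * num_standard_tableaux \<kappa>)"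
      using deg[OF \<nu>] unfolding d[OF \<nu>] num_standard_tableaux_rec[OF \<nu>] by (rule sym)
    then have "(if covers \<nu> \<kappa> then num_standard_tableaux \<kappa> else 0) = m \<nu> \<kappa> * num_standard_tableaux \<kappa>"
      by (rule sum_mono_inv[OF _ le[OF \<nu>] \<kappa> finite_partitions])
    moreover have "num_standard_tableaux \<kappa> > 0" using degree_char(2)[OF \<kappa>] IH[OF \<kappa>] by simp
    ultimately have "m \<nu> \<kappa> = (if covers \<nu> \<kappa> then 1 else 0)" by (simp split: if_splits)
    then show ?thesis unfolding m[OF \<nu> \<kappa>] by simp
  qed
qed

lemma degree_char_eq: "\<mu> \<in> partitions n \<Longrightarrow> degree_char \<mu> = num_standard_tableaux \<mu>"
proof (induction n arbitrary: \<mu>)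
  case 0
  then have \<mu>: "\<mu> = []" by (simp add: partitions_0)
  have "(degree_char [])\<^sup>2 \<le> 1" using degree_char_bessel(1)[of 0] by (simp add: partitions_0)
  moreover have "degree_char [] > 0" by (rule degree_char(2)[of _ 0]) (simp add: partitions_0)
  ultimately have "degree_char [] = 1" using power2_nat_le_eq_le[of "degree_char []" 1] by simp
  moreover have "num_standard_tableaux [] = 1"
    unfolding num_standard_tableaux_eq by (simp add: rows_def[abs_def] tab_count_zero)
  ultimately show ?case by (simp add: \<mu>)
next
  case (Suc n)
  show ?case by (rule branching(1)[OF Suc.IH Suc.prems])
qed

lemma sum_degree_char_squares: "(\<Sum>\<mu>\<in>partitions n. (degree_char \<mu>)\<^sup>2) = fact n"
  using sum_num_standard_tableaux_squares[of n] by (simp add: degree_char_eq cong: sum.cong)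

lemma ip_irr_char_restrict:
  "\<nu> \<in> partitions (Suc n) \<Longrightarrow> \<kappa> \<in> partitions n \<Longrightarrow> ip n (irr_char \<nu>) (irr_char \<kappa>) = (if covers \<nu> \<kappa> then 1 else 0)"
  by (rule branching(2)[OF degree_char_eq])

section \<open>Kronecker powers of the standard character\<close>

definition num_fixed :: "nat \<Rightarrow> (nat \<Rightarrow> nat) \<Rightarrow> complex" where
  "num_fixed n g = (\<Sum>i<n. if g i = i then 1 else 0)"

lemma class_fun_num_fixed_mult:
  assumes \<phi>: "class_fun n \<phi>"
  shows "class_fun n (\<lambda>g. num_fixed n g * \<phi> g)"
  unfolding class_fun_def
proof (intro ballI)
  fix h g assume h: "h \<in> perms n" and g: "g \<in> perms n"
  have h': "h permutes {..<n}" using h by simp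
  have "num_fixed n g = (\<Sum>i<n. if (h \<circ> g \<circ> inv h) (h i) = h i then 1 else 0)"
    unfolding num_fixed_def by (simp add: permutes_inverses(2)[OF h'] inj_eq[OF permutes_inj[OF h']])
  also have "\<dots> = num_fixed n (h \<circ> g \<circ> inv h)"
    unfolding num_fixed_def by (rule sum.permute[OF h', unfolded o_def, symmetric])
  finally show "num_fixed n (h \<circ> g \<circ> inv h) * \<phi> (h \<circ> g \<circ> inv h) = num_fixed n g * \<phi> g"
    by (simp only: class_funD[OF \<phi> h g])
qed

lemma perms_fixing_last: "{g \<in> perms (Suc n). g n = n} = perms n"
proof (intro equalityI subsetI)
  fix g assume "g \<in> {g \<in> perms (Suc n). g n = n}"
  then have g: "g permutes {..<Suc n}" "g n = n" by auto
  have "g permutes {..<n}"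
    by (rule permutes_superset[OF g(1)]) (use g(2) in \<open>auto simp: less_Suc_eq\<close>)
  then show "g \<in> perms n" by simp
next
  fix g assume g: "g \<in> perms n"
  then have "g n = n" using permutes_not_in[of g "{..<n}" n] by simp
  then show "g \<in> {g \<in> perms (Suc n). g n = n}" using g perms_mono by blast
qed

text \<open>Every point contributes the sum over its stabilizer, which is conjugate to that of the
  last point; the factor \<open>Suc n\<close> then reduces the factorial. This is Frobenius
  reciprocity for the permutation character.\<close>

lemma ip_num_fixed:
  assumes \<phi>: "class_fun (Suc n) \<phi>" and \<psi>: "class_fun (Suc n) \<psi>"
  shows "ip (Suc n) (\<lambda>g. num_fixed (Suc n) g * \<phi> g) \<psi> = ip n \<phi> \<psi>"
proof -
  let ?G = "perms (Suc n)"
  have one: "(\<Sum>g\<in>?G. if g i = i then \<phi> g * \<psi> g else 0) = (\<Sum>g\<in>perms n. \<phi> g * \<psi> g)" if i: "i < Suc n" for i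
  proof -
    let ?h = "transpose n i"
    have h: "?h \<in> ?G" using permutes_swap_id[of n "{..<Suc n}" i] i by simp
    have inv_h: "inv ?h = ?h" by (rule inv_transpose_eq)
    have "(\<Sum>g\<in>?G. if g i = i then \<phi> g * \<psi> g else 0) =
        (\<Sum>g\<in>?G. if (?h \<circ> g \<circ> inv ?h) i = i then \<phi> (?h \<circ> g \<circ> inv ?h) * \<psi> (?h \<circ> g \<circ> inv ?h) else 0)"
      by (rule sum_perms_conj[OF h, of "\<lambda>g. if g i = i then \<phi> g * \<psi> g else 0", symmetric])
    also have "\<dots> = (\<Sum>g\<in>?G. if g n = n then \<phi> g * \<psi> g else 0)"
    proof (rule sum.cong[OF refl], goal_cases)
      case g: (1 g)
      have "(?h \<circ> g \<circ> inv ?h) i = i \<longleftrightarrow> ?h (g n) = i" unfolding inv_h by simp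
      also have "\<dots> \<longleftrightarrow> g n = n" by (auto simp: transpose_eq_iff)
      finally show ?case
        by (simp only: class_funD[OF \<phi> h g] class_funD[OF \<psi> h g])
    qed
    also have "\<dots> = (\<Sum>g\<in>perms n. \<phi> g * \<psi> g)"
      unfolding perms_fixing_last[of n, symmetric] by (rule sum.inter_filter[OF finite_perms, symmetric])
    finally show ?thesis .
  qed
  have "(\<Sum>g\<in>?G. num_fixed (Suc n) g * \<phi> g * \<psi> g) =
      (\<Sum>g\<in>?G. \<Sum>i<Suc n. if g i = i then \<phi> g * \<psi> g else 0)"
    unfolding num_fixed_def mult.assoc sum_distrib_right by (intro sum.cong refl) simp
  also have "\<dots> = (\<Sum>i<Suc n. \<Sum>g\<in>?G. if g i = i then \<phi> g * \<psi> g else 0)" by (rule sum.swap)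
  also have "\<dots> = of_nat (Suc n) * (\<Sum>g\<in>perms n. \<phi> g * \<psi> g)" using one by simp
  finally show ?thesis unfolding ip_def by (simp add: fact_Suc del: of_nat_Suc sum.lessThan_Suc)
qed

text \<open>
  Multiplication by the permutation character amounts to restriction to
  \<open>S\<^sub>n\<close> followed by induction.
\<close>

lemma num_fixed_mult_irr_char:
  assumes a: "a \<in> diagrams (Suc n)" and g: "g \<in> perms (Suc n)"
  shows "num_fixed (Suc n) g * irr_char (of_rows a) g =
    down (up (\<lambda>b. irr_char (of_rows b) g)) a"
proof -
  let ?\<nu> = "of_rows a" and ?X = "\<lambda>a. irr_char (of_rows a) g"
  have \<nu>: "?\<nu> \<in> partitions (Suc n)" by (rule of_rows_in_partitions[OF a])
  have ra: "rows ?\<nu> = a" by (rule rows_of_rows[OF diagramsD(1,2)[OF a]])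
  have rX: "irr_char \<mu> g = ?X (rows \<mu>)" if "\<mu> \<in> partitions m" for \<mu> m
    using of_rows_row_lengths[of \<mu>] that by (simp add: partitions_def)
  \<comment> \<open>By the branching rule, this counts the common lower neighbours of the two
    partitions.\<close>
  have mult: "ip n (irr_char ?\<nu>) (irr_char \<mu>) =
      (\<Sum>\<kappa>\<in>partitions n. if covers ?\<nu> \<kappa> then if covers \<mu> \<kappa> then 1 else 0 else 0)"
    if \<mu>: "\<mu> \<in> partitions (Suc n)" for \<mu>
  proof -
    have "ip n (irr_char ?\<nu>) (irr_char \<mu>) =
        ip n (\<lambda>g. \<Sum>\<kappa>\<in>partitions n. ip n (irr_char ?\<nu>) (irr_char \<kappa>) * irr_char \<kappa> g) (irr_char \<mu>)"
      by (rule ip_cong) (rule class_fun_expansion[OF sum_degree_char_squares class_fun_restrict[OF class_fun_irr_char[OF \<nu>]]])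
    also have "\<dots> = (\<Sum>\<kappa>\<in>partitions n. ip n (irr_char ?\<nu>) (irr_char \<kappa>) * ip n (irr_char \<kappa>) (irr_char \<mu>))"
      by (rule ip_sum)
    also have "\<dots> = (\<Sum>\<kappa>\<in>partitions n. if covers ?\<nu> \<kappa> then if covers \<mu> \<kappa> then 1 else 0 else 0)"
      by (rule sum.cong[OF refl])
         (simp add: ip_irr_char_restrict[OF \<nu>] ip_irr_char_restrict[OF \<mu>] ip_commute[of n _ "irr_char \<mu>"])
    finally show ?thesis .
  qed
  have "num_fixed (Suc n) g * irr_char ?\<nu> g =
      (\<Sum>\<mu>\<in>partitions (Suc n). ip (Suc n) (\<lambda>g. num_fixed (Suc n) g * irr_char ?\<nu> g) (irr_char \<mu>) * irr_char \<mu> g)"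
    by (rule class_fun_expansion[OF sum_degree_char_squares class_fun_num_fixed_mult[OF class_fun_irr_char[OF \<nu>]] g])
  also have "\<dots> = (\<Sum>\<mu>\<in>partitions (Suc n). \<Sum>\<kappa>\<in>partitions n.
      if covers ?\<nu> \<kappa> then if covers \<mu> \<kappa> then irr_char \<mu> g else 0 else 0)"
  proof (rule sum.cong[OF refl], goal_cases)
    case \<mu>: (1 \<mu>)
    show ?case
      unfolding ip_num_fixed[OF class_fun_irr_char[OF \<nu>] class_fun_irr_char[OF \<mu>]] mult[OF \<mu>] sum_distrib_right
      by (intro sum.cong refl) simp
  qed
  also have "\<dots> = (\<Sum>\<kappa>\<in>partitions n. \<Sum>\<mu>\<in>partitions (Suc n).
      if covers ?\<nu> \<kappa> then if covers \<mu> \<kappa> then irr_char \<mu> g else 0 else 0)" by (rule sum.swap)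
  also have "\<dots> = (\<Sum>\<kappa>\<in>partitions n. if covers ?\<nu> \<kappa> then
      up ?X (rows \<kappa>) else 0)"
  proof (rule sum.cong[OF refl], goal_cases)
    case \<kappa>: (1 \<kappa>)
    have "(\<Sum>\<mu>\<in>partitions (Suc n). if covers \<mu> \<kappa> then irr_char \<mu> g else 0) =
        (\<Sum>\<mu>\<in>partitions (Suc n). if covers \<mu> \<kappa> then ?X (rows \<mu>) else 0)"
      by (rule sum.cong[OF refl]) (simp only: rX)
    also have "\<dots> = up ?X (rows \<kappa>)" by (rule sum_covering[OF \<kappa>])
    finally show ?case by simp
  qed
  also have "\<dots> = down (up ?X) a"
    using sum_covered[OF \<nu>, of "up ?X"] unfolding ra .
  finally show ?thesis .
qed

section \<open>The trivial and the standard character\<close>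

lemma rows_singleton: "rows [n] = (\<lambda>i. if i = 0 then n else 0)"
  by (auto simp: rows_def fun_eq_iff)

text \<open>For a single row every permutation preserves rows, so the symmetrizer and hence the
  character are constant. A constant of norm one that is a degree must be 1.\<close>

lemma irr_char_trivial:
  assumes n: "n > 0" and g: "g \<in> perms n"
  shows "irr_char [n] g = 1"
proof -
  have \<mu>: "[n] \<in> partitions n" using n by (simp add: partitions_def)
  have "row_of [n] x = 0" if "x < n" for x
    using row_col_cell[of x "[n]"] that by (simp add: cells_def)
  then have R: "p \<in> row_stabilizer [n]" if "p \<in> perms n" for p
    using that permutes_less_iff[of p n] by (simp add: row_stab_iff)
  have "young_symmetrizer [n] p = 1" if "p \<in> perms n" for p
    using ysym_left[OF R[OF that], of id] by (simp add: ysym_id)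
  then have "conj_sum n (young_symmetrizer [n]) g = fact n" if "g \<in> perms n" for g
    unfolding conj_sum_def using that perms_comp perms_inv card_perms[of n] by simp
  then have const: "irr_char [n] g = irr_char [n] id" if "g \<in> perms n" for g
    using that perms_id by (simp only: irr_char_conj_sum[OF \<mu>])
  have "ip n (irr_char [n]) (irr_char [n]) = (\<Sum>g\<in>perms n. irr_char [n] id * irr_char [n] id) / fact n"
    unfolding ip_def by (intro arg_cong2[where f = "(/)"] sum.cong refl) (simp only: const)
  also have "\<dots> = of_nat ((degree_char [n])\<^sup>2)"
    unfolding degree_char(1)[OF \<mu>] by (simp add: card_perms power2_eq_square)
  finally have "complex_of_nat ((degree_char [n])\<^sup>2) = of_nat 1"
    using ip_irr_char_self[OF \<mu>] by simp
  then have "(degree_char [n])\<^sup>2 = 1" by (simp only: of_nat_eq_iff)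
  then show ?thesis unfolding const[OF g] degree_char(1)[OF \<mu>] by (simp add: power2_eq_square)
qed

text \<open>A box moved away from the single row \<open>[n]\<close> either returns to it or starts a
  second row.\<close>

lemma irr_char_standard:
  assumes n: "n \<ge> 2" and g: "g \<in> perms n"
  shows "irr_char [n - 1, 1] g = num_fixed n g - 1"
proof -
  obtain m where m: "n = Suc m" "m > 0" using n by (cases n) auto
  let ?a = "rows [n]"
  have \<mu>: "[n] \<in> partitions n" using m by (simp add: partitions_def)
  have "removable ?a = {0}" by (auto simp: removable_def rows_singleton m)
  moreover have "dec ?a 0 = rows [m]" by (auto simp: dec_def rows_singleton m)
  moreover have "addable (rows [m]) = {0, 1}"
    using m(2) by (auto simp: addable_def rows_singleton)
  moreover have "inc (rows [m]) 0 = ?a" by (auto simp: inc_def rows_singleton m)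
  moreover have "inc (rows [m]) 1 = rows [n - 1, 1]"
    by (auto simp: inc_def rows_def m fun_eq_iff less_Suc_eq)
  moreover have "of_rows ?a = [n]" "of_rows (rows [n - 1, 1]) = [n - 1, 1]"
    using m by (simp_all add: of_rows_row_lengths)
  ultimately have "num_fixed n g * irr_char [n] g = irr_char [n] g + irr_char [n - 1, 1] g"
    using num_fixed_mult_irr_char[of ?a m g] rows_in_diagrams[OF \<mu>] g unfolding m(1) by simp
  then show ?thesis using irr_char_trivial[of n g] n g by simp
qed

section \<open>Multiplicities in the powers, as a recursion on diagrams\<close>

fun kronecker_mult :: "nat \<Rightarrow> nat \<Rightarrow> (nat \<Rightarrow> nat) \<Rightarrow> nat" where
  "kronecker_mult n 0 a = (if a = rows [n] then 1 else 0)"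
| "kronecker_mult n (Suc k) a =
    down (up (kronecker_mult n k)) a - kronecker_mult n k a"

text \<open>Without a removable box there would be no standard tableau, but their number is a degree
  and so positive.\<close>

lemma removable_nonempty:
  assumes a: "a \<in> diagrams (Suc n)"
  shows "removable a \<noteq> {}"
proof
  assume "removable a = {}"
  then have "tab_count a = 0" using tab_count_rec[OF a] by simp
  moreover have "tab_count a > 0"
    using degree_char(2)[OF of_rows_in_partitions[OF a]] degree_char_eq[OF of_rows_in_partitions[OF a]]
    by (simp add: num_standard_tableaux_eq rows_of_rows[OF diagramsD(1,2)[OF a]])
  ultimately show False by simp
qed

text \<open>Putting a removed box back contributes \<open>kronecker_mult m k a\<close> to the
  right-hand side, so the truncated subtraction in the recursion loses nothing.\<close>

lemma kronecker_mult_Suc: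
  assumes a: "a \<in> diagrams (Suc n)"
  shows "kronecker_mult m (Suc k) a + kronecker_mult m k a =
    down (up (kronecker_mult m k)) a"
proof -
  obtain i where i: "i \<in> removable a" using removable_nonempty[OF a] by blast
  have fin: "finite (removable a)" "finite (addable (dec a i))"
    using finite_removable[OF diagramsD(2)[OF a]] finite_addable[OF diagramsD(2)[OF dec_in_diagrams[OF a i]]] by simp_all
  have "kronecker_mult m k a = kronecker_mult m k (inc (dec a i) i)" by (simp add: inc_dec[OF i])
  also have "\<dots> \<le> (\<Sum>j\<in>addable (dec a i). kronecker_mult m k (inc (dec a i) j))"
    using addable_dec[OF diagramsD(1)[OF a] i] fin(2) by (intro member_le_sum) simp_all
  also have "\<dots> \<le> down (up (kronecker_mult m k)) a"
    using member_le_sum[of i "removable a" "\<lambda>i. \<Sum>j\<in>addable (dec a i). kronecker_mult m k (inc (dec a i) j)"] i fin(1)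
    by simp
  finally show ?thesis by simp
qed

text \<open>Moving a box is a symmetric relation, both diagrams lying above a common
  \<open>b\<close>. This transfers the move from the characters to their coefficients.\<close>

lemma sum_down_up_swap:
  fixes h :: "(nat \<Rightarrow> nat) \<Rightarrow> (nat \<Rightarrow> nat) \<Rightarrow> complex"
  shows "(\<Sum>a\<in>diagrams (Suc n). \<Sum>i\<in>removable a. \<Sum>j\<in>addable (dec a i). h a (inc (dec a i) j)) =
    (\<Sum>a\<in>diagrams (Suc n). \<Sum>i\<in>removable a. \<Sum>j\<in>addable (dec a i). h (inc (dec a i) j) a)"
proof -
  note S = sum_diagrams_Suc[OF finite_diagrams finite_diagrams]
  have "(\<Sum>a\<in>diagrams (Suc n). \<Sum>i\<in>removable a. \<Sum>j\<in>addable (dec a i). h a (inc (dec a i) j)) =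
      (\<Sum>b\<in>diagrams n. \<Sum>i\<in>addable b. \<Sum>j\<in>addable b. h (inc b i) (inc b j))"
    by (rule S)
  also have "\<dots> = (\<Sum>b\<in>diagrams n. \<Sum>j\<in>addable b. \<Sum>i\<in>addable b. h (inc b i) (inc b j))"
    by (rule sum.cong[OF refl], rule sum.swap)
  also have "\<dots> = (\<Sum>a\<in>diagrams (Suc n). \<Sum>i\<in>removable a. \<Sum>j\<in>addable (dec a i). h (inc (dec a i) j) a)"
    by (rule S[symmetric])
  finally show ?thesis .
qed

lemma num_fixed_power:
  assumes n: "n > 0" and g: "g \<in> perms n"
  shows "(num_fixed n g - 1) ^ k = (\<Sum>a\<in>diagrams n. of_nat (kronecker_mult n k a) * irr_char (of_rows a) g)"
proof (induction k)
  case 0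
  have \<mu>: "[n] \<in> partitions n" using n by (simp add: partitions_def)
  have "(\<Sum>a\<in>diagrams n. of_nat (kronecker_mult n 0 a) * irr_char (of_rows a) g) =
      (\<Sum>a\<in>diagrams n. if a = rows [n] then irr_char (of_rows a) g else 0)"
    by (rule sum.cong[OF refl]) simp
  also have "\<dots> = irr_char [n] g"
    using rows_in_diagrams[OF \<mu>] finite_diagrams[of n] n by (simp add: of_rows_row_lengths)
  finally show ?case using irr_char_trivial[OF n g] by simp
next
  case (Suc k)
  obtain m where m: "n = Suc m" using n by (cases n) auto
  let ?c = "\<lambda>a. complex_of_nat (kronecker_mult n k a)" and ?X = "\<lambda>a. irr_char (of_rows a) g"
  have "(num_fixed n g - 1) ^ Suc k = (\<Sum>a\<in>diagrams n. ?c a * (num_fixed n g * ?X a)) - (\<Sum>a\<in>diagrams n. ?c a * ?X a)"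
    by (simp add: Suc sum_distrib_left left_diff_distrib mult.left_commute sum_subtractf)
  also have "(\<Sum>a\<in>diagrams n. ?c a * (num_fixed n g * ?X a)) =
      (\<Sum>a\<in>diagrams n. \<Sum>i\<in>removable a. \<Sum>j\<in>addable (dec a i). ?c a * ?X (inc (dec a i) j))"
  proof (rule sum.cong[OF refl], goal_cases)
    case (1 a)
    then show ?case
      using num_fixed_mult_irr_char[of a m g] g unfolding m by (simp only: sum_distrib_left)
  qed
  also have "\<dots> = (\<Sum>a\<in>diagrams n. \<Sum>i\<in>removable a. \<Sum>j\<in>addable (dec a i). ?c (inc (dec a i) j) * ?X a)"
    unfolding m by (rule sum_down_up_swap)
  also have "\<dots> = (\<Sum>a\<in>diagrams n. of_nat (kronecker_mult n (Suc k) a + kronecker_mult n k a) * ?X a)"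
  proof (rule sum.cong[OF refl], goal_cases)
    case (1 a)
    then have "kronecker_mult n (Suc k) a + kronecker_mult n k a =
        down (up (kronecker_mult n k)) a"
      using kronecker_mult_Suc[of a m n k] m by simp
    then show ?case
      by (simp only: of_nat_sum sum_distrib_right)
  qed
  finally show ?case by (simp add: distrib_right sum.distrib del: kronecker_mult.simps)
qed

text \<open>The description ranges over all decompositions; orthonormality shows that they agree in
  the coefficient at \<mu>.\<close>

lemma irr_multiplicity_eq:
  assumes dec: "irr_decomposition n \<chi> c" and \<mu>: "\<mu> \<in> partitions n"
  shows "irr_multiplicity n \<chi> \<mu> = c \<mu>"
  unfolding irr_multiplicity_def
proof (rule the_equality)
  have coeff: "ip n \<chi> (irr_char \<mu>) = of_nat (c' \<mu>)" if c': "irr_decomposition n \<chi> c'" for c'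
  proof -
    have "ip n \<chi> (irr_char \<mu>) = ip n (\<lambda>g. \<Sum>\<nu>\<in>partitions n. of_nat (c' \<nu>) * irr_char \<nu> g) (irr_char \<mu>)"
      by (rule ip_cong) (use c' in \<open>simp add: irr_decomposition_def\<close>)
    then show ?thesis by (simp only: ip_sum_irr_char[OF \<mu>])
  qed
  show "\<exists>c'. irr_decomposition n \<chi> c' \<and> c' \<mu> = c \<mu>" using dec by blast
  fix m assume "\<exists>c'. irr_decomposition n \<chi> c' \<and> c' \<mu> = m"
  then obtain c' where c': "irr_decomposition n \<chi> c'" "c' \<mu> = m" by blast
  have "complex_of_nat (c' \<mu>) = of_nat (c \<mu>)" using coeff[OF c'(1)] coeff[OF dec] by simp
  then show "m = c \<mu>" using c'(2) by (simp only: of_nat_eq_iff)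
qed

lemma irr_multiplicity_kronecker_power:
  assumes n: "n \<ge> 2" and \<mu>: "\<mu> \<in> partitions n"
  shows "irr_multiplicity n (kronecker_power (irr_char [n - 1, 1]) k) \<mu> = kronecker_mult n k (rows \<mu>)"
proof (rule irr_multiplicity_eq[OF _ \<mu>])
  show "irr_decomposition n (kronecker_power (irr_char [n - 1, 1]) k) (\<lambda>\<nu>. kronecker_mult n k (rows \<nu>))"
    unfolding irr_decomposition_def
  proof (intro allI impI)
    fix g assume "g permutes {..<n}"
    then have g: "g \<in> perms n" by simp
    have "kronecker_power (irr_char [n - 1, 1]) k g = (num_fixed n g - 1) ^ k"
      by (simp only: kronecker_power_def irr_char_standard[OF n g])
    also have "\<dots> = (\<Sum>a\<in>diagrams n. of_nat (kronecker_mult n k a) * irr_char (of_rows a) g)"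
      using n by (intro num_fixed_power g) simp
    also have "\<dots> = (\<Sum>\<nu>\<in>partitions n. of_nat (kronecker_mult n k (rows \<nu>)) * irr_char (of_rows (rows \<nu>)) g)"
      by (rule sum_partitions_rows[symmetric])
    also have "\<dots> = (\<Sum>\<nu>\<in>partitions n. of_nat (kronecker_mult n k (rows \<nu>)) * irr_char \<nu> g)"
      by (rule sum.cong[OF refl]) (simp add: partitions_def of_rows_row_lengths)
    finally show "kronecker_power (irr_char [n - 1, 1]) k g =
        (\<Sum>\<nu>\<in>partitions n. of_nat (kronecker_mult n k (rows \<nu>)) * irr_char \<nu> g)" .
  qed
qed

section \<open>Splitting off the first row\<close>

definition tail_rows :: "(nat \<Rightarrow> nat) \<Rightarrow> nat \<Rightarrow> nat" where
  "tail_rows a i = a (Suc i)"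

lemma tail_in_diagrams:
  assumes a: "a \<in> diagrams n"
  shows "tail_rows a \<in> diagrams (n - a 0)" "a 0 \<le> n"
proof -
  note D = diagramsD[OF a]
  obtain N where N: "{i. 0 < a i} \<subseteq> {..<N}"
    using finite_nat_bounded[OF D(2)] by blast
  then have N': "{i. 0 < a i} \<subseteq> {..<Suc N}" "{i. 0 < tail_rows a i} \<subseteq> {..<N}" by (auto simp: tail_rows_def)
  have anti: "antimono (tail_rows a)" unfolding tail_rows_def
    by (rule antimonoI, rule antimonoD[OF D(1)]) simp
  have fin: "finite {i. 0 < tail_rows a i}" by (rule finite_subset[OF N'(2)]) simp
  have "n = sum a {..<Suc N}" using sum_support[OF _ N'(1)] D(3) by simp
  also have "\<dots> = a 0 + sum (tail_rows a) {..<N}" by (simp add: sum.lessThan_Suc_shift tail_rows_def del: sum.lessThan_Suc)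
  also have "sum (tail_rows a) {..<N} = sum (tail_rows a) {i. 0 < tail_rows a i}"
    using sum_support[OF _ N'(2)] by simp
  finally have n: "n = a 0 + sum (tail_rows a) {i. 0 < tail_rows a i}" .
  then show "a 0 \<le> n" by simp
  have "sum (tail_rows a) {i. 0 < tail_rows a i} = n - a 0" using n by simp
  then show "tail_rows a \<in> diagrams (n - a 0)" using anti fin unfolding diagrams_def by blast
qed

lemma addable_tail: "addable a = insert 0 (Suc ` {j \<in> addable (tail_rows a). j = 0 \<longrightarrow> a 1 < a 0})"
proof (rule set_eqI)
  fix j show "j \<in> addable a \<longleftrightarrow> j \<in> insert 0 (Suc ` {j \<in> addable (tail_rows a). j = 0 \<longrightarrow> a 1 < a 0})"
  proof (cases j)
    case (Suc k)
    then show ?thesis by (cases k) (auto simp: addable_def tail_rows_def)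
  qed (simp add: addable_def)
qed

lemma removable_tail: "removable a = (if a 1 < a 0 then {0} else {}) \<union> Suc ` removable (tail_rows a)"
proof (rule set_eqI)
  fix j show "j \<in> removable a \<longleftrightarrow> j \<in> (if a 1 < a 0 then {0} else {}) \<union> Suc ` removable (tail_rows a)"
    by (cases j) (auto simp: removable_def tail_rows_def)
qed

lemma tail_inc [simp]: "tail_rows (inc a (Suc j)) = inc (tail_rows a) j" "tail_rows (inc a 0) = tail_rows a"
  and tail_dec [simp]: "tail_rows (dec a (Suc j)) = dec (tail_rows a) j" "tail_rows (dec a 0) = tail_rows a"
  by (auto simp: tail_rows_def inc_def dec_def fun_eq_iff)

lemma inc_dec_zero [simp]:
  "inc a 0 0 = Suc (a 0)" "inc a (Suc j) 0 = a 0" "dec a 0 0 = a 0 - 1" "dec a (Suc j) 0 = a 0"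
  by (simp_all add: inc_def dec_def)

text \<open>Whether the second row may grow depends on the first, which the tail does not see. If it
  may not, the term is assumed to vanish, so the sum can run over all addable rows of the
  tail.\<close>

lemma sum_addable_tail:
  fixes h :: "nat \<Rightarrow> nat"
  assumes fin: "finite {i. 0 < tail_rows a i}"
    and z: "\<not> a 1 < a 0 \<Longrightarrow> h (Suc 0) = 0"
  shows "(\<Sum>j\<in>addable a. h j) = h 0 + (\<Sum>j\<in>addable (tail_rows a). h (Suc j))"
proof -
  let ?A = "{j \<in> addable (tail_rows a). j = 0 \<longrightarrow> a 1 < a 0}"
  have f: "finite (addable (tail_rows a))" by (rule finite_addable[OF fin])
  have "(\<Sum>j\<in>addable a. h j) = h 0 + (\<Sum>j\<in>Suc ` ?A. h j)"
    unfolding addable_tail[of a] using f by (subst sum.insert) auto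
  also have "(\<Sum>j\<in>Suc ` ?A. h j) = (\<Sum>j\<in>?A. h (Suc j))" by (simp add: sum.reindex)
  also have "\<dots> = (\<Sum>j\<in>addable (tail_rows a). h (Suc j))"
  proof (rule sum.mono_neutral_left[OF f])
    show "\<forall>j\<in>addable (tail_rows a) - ?A. h (Suc j) = 0"
    proof
      fix j assume "j \<in> addable (tail_rows a) - ?A"
      then have "j = 0" "\<not> a 1 < a 0" by auto
      then show "h (Suc j) = 0" using z by simp
    qed
  qed auto
  finally show ?thesis .
qed

lemma sum_removable_tail:
  fixes h :: "nat \<Rightarrow> nat"
  assumes fin: "finite {i. 0 < tail_rows a i}"
  shows "(\<Sum>i\<in>removable a. h i) = (if a 1 < a 0 then h 0 else 0) + (\<Sum>i\<in>removable (tail_rows a). h (Suc i))"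
  unfolding removable_tail[of a] using finite_removable[OF fin]
  by (subst sum.union_disjoint) (auto simp: sum.reindex)

text \<open>A move raises \<open>a 1\<close> by at most one while \<open>k\<close> drops by one, so
  all neighbours inherit the bound; hence an induction on \<open>k\<close> over all
  diagrams.\<close>

lemma kronecker_mult_eq:
  assumes n: "n > 0" and a: "a \<in> diagrams n" and k: "n \<ge> k + a 1"
  shows "kronecker_mult n k a = tab_count (tail_rows a) * marked_count k (n - a 0)"
  using a k
proof (induction k arbitrary: a)
  case 0
  note t = tail_in_diagrams[OF "0.prems"(1)]
  show ?case
  proof (cases "n - a 0 = 0")
    case True
    then have z: "tail_rows a = (\<lambda>_. 0)" using t(1) by (simp add: diagrams_0)
    have "a i = rows [n] i" for i
      using True t(2) fun_cong[OF z, of "i - 1"] by (cases i) (auto simp: tail_rows_def rows_singleton)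
    then have "a = rows [n]" by (rule ext)
    then show ?thesis using True z by (simp add: marked_count_0 tab_count_zero)
  next
    case False
    then have "a \<noteq> rows [n]" by (auto simp: rows_singleton)
    then show ?thesis using False by (simp add: marked_count_0)
  qed
next
  case (Suc k)
  obtain m where m: "n = Suc m" using n by (cases n) auto
  note a = Suc.prems(1)
  define b where "b = tail_rows a"
  define r where "r = n - a 0"
  let ?f = tab_count and ?F = "marked_count k"
  let ?K = "kronecker_mult n k"
  let ?G = "\<lambda>c. ?f (tail_rows c) * ?F (n - c 0)"
  have b: "b \<in> diagrams r" and a0: "a 0 \<le> n" using tail_in_diagrams[OF a] by (simp_all add: b_def r_def)
  note Db = diagramsD[OF b]
  have G: "kronecker_mult n k c = ?G c" if "c \<in> diagrams n" "c 1 \<le> Suc (a 1)" for c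
    using Suc.IH[OF that(1)] that(2) Suc.prems(2) by simp
  have nb: "?K (inc (dec a i) j) = ?G (inc (dec a i) j)"
    if i: "i \<in> removable a" and j: "j \<in> addable (dec a i)" for i j
  proof (rule G)
    show "inc (dec a i) j \<in> diagrams n"
      using inc_in_diagrams[OF dec_in_diagrams[of a m i] j] a i unfolding m by simp
    show "inc (dec a i) j 1 \<le> Suc (a 1)" by (auto simp: inc_def dec_def)
  qed
  \<comment> \<open>A nonzero \<open>?F r\<close> forces \<open>r \<le> k\<close>, so
    \<open>a 0 \<ge> n - k > a 1\<close>. Read backwards, a move blocked by the first row has weight
    zero.\<close>
  have small: "a 1 < a 0" if "?F r \<noteq> 0"
  proof -
    have "r \<le> k" using that marked_count_eq_0[of k r] by (cases "k < r") auto
    then show ?thesis using Suc.prems(2) a0 by (simp add: r_def)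
  qed
  have small2: "a 1 < a 0 - 1" if "?F (Suc r) \<noteq> 0"
  proof -
    have "Suc r \<le> k" using that marked_count_eq_0[of k "Suc r"] by (cases "k < Suc r") auto
    then show ?thesis using Suc.prems(2) a0 by (simp add: r_def)
  qed
  \<comment> \<open>The box taken from the first row returns there or enters the tail, which in all
    its ways gives \<open>Suc r\<close> times \<open>?f b\<close>.\<close>
  have first: "up ?K (dec a 0) =
      ?f b * ?F r + Suc r * ?f b * ?F (Suc r)" if lt: "a 1 < a 0"
  proof -
    have "0 \<in> removable a" using lt by (simp add: removable_def)
    then have "up ?K (dec a 0) =
      up ?G (dec a 0)"
      by (intro sum.cong refl nb)
    also have "\<dots> = ?f b * ?F r + (\<Sum>j\<in>addable b. ?f (inc b j) * ?F (Suc r))"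
    proof (subst sum_addable_tail)
      show "finite {i. 0 < tail_rows (dec a 0) i}" using Db(2) by (simp add: b_def)
      have e: "n - (a 0 - 1) = Suc r" "Suc (a 0 - 1) = a 0" using lt a0 by (simp_all add: r_def)
      show "?G (inc (dec a 0) (Suc 0)) = 0" if "\<not> dec a 0 1 < dec a 0 0"
        using that small2 e by (auto simp: dec_def)
      show "?G (inc (dec a 0) 0) +
          (\<Sum>j\<in>addable (tail_rows (dec a 0)). ?G (inc (dec a 0) (Suc j))) =
          ?f b * ?F r + (\<Sum>j\<in>addable b. ?f (inc b j) * ?F (Suc r))"
        using e by (simp add: b_def[symmetric] r_def[symmetric])
    qed
    also have "\<dots> = ?f b * ?F r + Suc r * ?f b * ?F (Suc r)"
      by (simp only: sum_distrib_right[symmetric] tab_count_up[OF b])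
    finally show ?thesis .
  qed
  \<comment> \<open>A box taken from the tail enters the first row or returns to the tail, which
    then has \<open>r - 1\<close> boxes; hence the factor \<open>r\<close>.\<close>
  have rest: "up ?K (dec a (Suc i)) =
      ?f (dec b i) * (?F (r - 1) + r * ?F r)" if i: "i \<in> removable b" for i
  proof -
    have r: "r > 0"
    proof (rule ccontr)
      assume "\<not> r > 0"
      then have "b = (\<lambda>_. 0)" using b by (simp add: diagrams_0)
      then show False using i by (simp add: removable_def)
    qed
    then obtain s where s: "r = Suc s" by (cases r) auto
    have bi: "dec b i \<in> diagrams s" using dec_in_diagrams b i s by simp
    have "Suc i \<in> removable a" using i unfolding removable_tail[of a] b_def by blast
    then have "up ?K (dec a (Suc i)) =
      up ?G (dec a (Suc i))"
      by (intro sum.cong refl nb)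
    also have "\<dots> = ?f (dec b i) * ?F (r - 1) + (\<Sum>j\<in>addable (dec b i). ?f (inc (dec b i) j) * ?F r)"
    proof (subst sum_addable_tail)
      show "finite {l. 0 < tail_rows (dec a (Suc i)) l}" using diagramsD(2)[OF bi] by (simp add: b_def)
      show "?G (inc (dec a (Suc i)) (Suc 0)) = 0"
        if "\<not> dec a (Suc i) 1 < dec a (Suc i) 0"
      proof -
        have "\<not> a 1 < a 0" using that by (auto simp: dec_def split: if_splits)
        then show ?thesis using small by (auto simp: r_def)
      qed
      show "?G (inc (dec a (Suc i)) 0) +
          (\<Sum>j\<in>addable (tail_rows (dec a (Suc i))). ?G (inc (dec a (Suc i)) (Suc j))) =
          ?f (dec b i) * ?F (r - 1) + (\<Sum>j\<in>addable (dec b i). ?f (inc (dec b i) j) * ?F r)"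
        by (simp add: b_def[symmetric] r_def)
    qed
    also have "\<dots> = ?f (dec b i) * ?F (r - 1) + (Suc s * ?f (dec b i)) * ?F r"
      by (simp only: sum_distrib_right[symmetric] tab_count_up[OF bi])
    also have "\<dots> = ?f (dec b i) * (?F (r - 1) + r * ?F r)" by (simp add: s algebra_simps)
    finally show ?thesis .
  qed
  have ka: "kronecker_mult n k a = ?f b * ?F r" using G[OF a] by (simp add: b_def r_def)
  have "kronecker_mult n (Suc k) a + kronecker_mult n k a =
      down (up ?K) a"
    using kronecker_mult_Suc[of a m n k] a m by simp
  also have "\<dots> = (if a 1 < a 0 then up ?K (dec a 0) else 0) +
      (\<Sum>i\<in>removable b. up ?K (dec a (Suc i)))"
    unfolding b_def by (rule sum_removable_tail) (use Db(2) in \<open>simp add: b_def\<close>)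
  also have "(if a 1 < a 0 then up ?K (dec a 0) else 0) =
      ?f b * ?F r + Suc r * ?f b * ?F (Suc r)"
  proof (cases "a 1 < a 0")
    case False
    then have "?F r = 0" using small by blast
    moreover have "?F (Suc r) = 0" by (rule ccontr) (use small2 False in fastforce)
    ultimately show ?thesis using False by simp
  qed (simp add: first)
  also have "(\<Sum>i\<in>removable b. up ?K (dec a (Suc i))) =
      down ?f b * (?F (r - 1) + r * ?F r)"
    unfolding sum_distrib_right by (rule sum.cong[OF refl], rule rest)
  also have "down ?f b = (if r = 0 then 0 else ?f b)"
  proof (cases r)
    case 0
    then have "b = (\<lambda>_. 0)" using b by (simp add: diagrams_0)
    then show ?thesis using 0 by (simp add: removable_def)
  next
    case (Suc s)
    then show ?thesis using tab_count_rec[of b s] b by simp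
  qed
  \<comment> \<open>The subtracted multiplicity cancels the term in which the box of the first row
    is put back.\<close>
  finally have "kronecker_mult n (Suc k) a =
      Suc r * ?f b * ?F (Suc r) + (if r = 0 then 0 else ?f b) * (?F (r - 1) + r * ?F r)"
    unfolding ka by simp
  also have "\<dots> = ?f b * marked_count (Suc k) r"
    unfolding marked_count_Suc by (simp add: algebra_simps)
  finally show ?case by (simp add: b_def r_def)
qed

theorem proposition2:
  fixes k n :: nat and \<mu> :: "nat list"
  assumes "k \<ge> 1" and "n \<ge> 2"
    and "\<mu> \<in> partitions n"
    and "n \<ge> k + second_part \<mu>"
  shows "irr_multiplicity n (kronecker_power (irr_char [n - 1, 1]) k) \<mu> =
    num_standard_tableaux (tl \<mu>) *
      (\<Sum>m1 = 0..n - hd \<mu>. (k choose m1) *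
        (\<Sum>m2 = n - hd \<mu> - m1..(k - m1) div 2.
          (m2 choose (n - hd \<mu> - m1)) * p2 (k - m1) m2))"
proof -
  let ?a = "rows \<mu>"
  \<comment> \<open>A positive \<open>n\<close> rules out the empty list, on which \<open>hd\<close>
    would have no meaning.\<close>
  have ne: "\<mu> \<noteq> []" using assms(2,3) by (auto simp: partitions_def)
  have "?a 0 = hd \<mu>" using ne by (simp add: rows_def hd_conv_nth)
  moreover have "?a 1 = second_part \<mu>" by (simp add: rows_def second_part_def)
  moreover have "tail_rows ?a = rows (tl \<mu>)"
    using ne by (cases \<mu>) (auto simp: tail_rows_def rows_def fun_eq_iff)
  ultimately show ?thesis
    using irr_multiplicity_kronecker_power[OF assms(2,3)] kronecker_mult_eq[of n ?a k] rows_in_diagrams[OF assms(3)] assms(2,4)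
    by (simp add: num_standard_tableaux_eq marked_count_def)
qed

end
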